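(* Let $(K,v)$ be a valued field of characteristic $p>0$ and of finite rank $r$. Let $(K'|K,v)$ be a maximal immediate subextension of the purely inseparable extension $(K^{1/p}|K,v)$, and assume that $K'|K$ is finite, of degree $p^m$ with $m\geq 0$. Then the number of distinct distances modulo $vK$ of elements in all normal defect extensions of prime degree of $(K,v)$, as well as the number of distinct distances modulo $vK$ of elements in Artin--Schreier defect extensions of $(K,v)$, are bounded by $r+m$. In particular, if $K$ has finite $p$-degree $k$, then this number is bounded by $r+k$.
   Context: Valuations are written additively; $vK$ is the value group, $Kv$ the residue field, $\widetilde{vK}$ the divisible hull of $vK$. An extension of $v$ from $K$ to its algebraic closure $\tilde K$ is fixed. The rank of $(K,v)$, if finite, is the number of proper convex subgroups of $vK$. $K^{1/p}=\{c^{1/p}\mid c\in K\}$. $K$ has finite $p$-degree $k$ if $[K^{1/p}:K]=[K:K^p]=p^k$. An extension $(L|K,v)$ is immediate if the canonical embeddings $vK\to vL$ and $Kv\to Lv$ are onto. For $a\in\tilde K$, put $v(a-K)=\{v(a-c)\mid c\in K\}$. The distance $\mathrm{dist}(a,K)$ is the cut in $\widetilde{vK}$ whose lower cut set is the smallest initial segment of $\widetilde{vK}$ containing $v(a-K)\cap\widetilde{vK}$. The cut $\alpha+\mathrm{dist}(a,K)$ is obtained by adding $\alpha$ to all elements of the lower cut set. Two distances are equal modulo $vK$ if one is obtained from the other by adding some $\alpha\in vK$. For a finite normal extension $L|K$ one has $[L:K]=d\cdot e\cdot f\cdot g$, where $g$ is the number of extensions of $v$ to $L$, $e$ their common ramification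 index, $f$ their common inertia degree; a defect extension is one with $d>1$. If a normal extension of prime degree has nontrivial defect, then its degree is $p=\mathrm{char}\,Kv$, the extension of $v$ to $L$ is unique and $(L|K,v)$ is immediate. An Artin--Schreier defect extension is a Galois extension of degree $p$ of $K$ (where $\mathrm{char}\,K=p$) with nontrivial defect. "Distances of elements in" a family of extensions $L|K$ means the cuts $\mathrm{dist}(b,K)$ for $b\in L\setminus K$, with $L|K$ in the family. *)

theory Defs
  imports "HOL-Algebra.Algebraic_Closure_Type" "HOL-Library.FuncSet"
begin

section \<open>Valuations\<close>

text \<open>
  Valuations are additive, with values in a linearly ordered abelian group.  The value \<open>\<infinity>\<close> of \<open>0\<close>
  is not represented: a valuation of a subfield \<open>F\<close> is only constrained on \<open>F - {0}\<close>, and no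
  definition below depends on \<open>v 0\<close>.
\<close>

definition valuation_on :: "'a::field set \<Rightarrow> ('a \<Rightarrow> 'g::linordered_ab_group_add) \<Rightarrow> bool" where
  "valuation_on F v \<longleftrightarrow>
     (\<forall>x\<in>F - {0}. \<forall>y\<in>F - {0}. v (x * y) = v x + v y) \<and>
     (\<forall>x\<in>F - {0}. \<forall>y\<in>F - {0}. x + y \<noteq> 0 \<longrightarrow> min (v x) (v y) \<le> v (x + y))"

definition value_group :: "('a::field \<Rightarrow> 'g::linordered_ab_group_add) \<Rightarrow> 'a set \<Rightarrow> 'g set" where
  "value_group v F = v ` (F - {0})"

definition valuation_ring :: "('a::field \<Rightarrow> 'g::linordered_ab_group_add) \<Rightarrow> 'a set \<Rightarrow> 'a set" where
  "valuation_ring v F = {x \<in> F. x \<noteq> 0 \<longrightarrow> 0 \<le> v x}"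

definition valuation_ideal :: "('a::field \<Rightarrow> 'g::linordered_ab_group_add) \<Rightarrow> 'a set \<Rightarrow> 'a set" where
  "valuation_ideal v F = {x \<in> F. x \<noteq> 0 \<longrightarrow> 0 < v x}"

text \<open>
  In the sequel, \<open>v\<close> is a valuation of the whole field type \<open>'a\<close> (an algebraic closure of the base
  field), and subfields \<open>F\<close> carry its restriction.  Their value groups are then literally subgroups
  of the same group, and their residue fields are realised inside the residue field of \<open>'a\<close> through
  the canonical embeddings.
\<close>

definition ambient_residue_field ::
    "('a::field \<Rightarrow> 'g::linordered_ab_group_add) \<Rightarrow> 'a set ring" where
  "ambient_residue_field v =
     (ring_of_type_algebra\<lparr>carrier := valuation_ring v UNIV\<rparr>) Quot (valuation_ideal v UNIV)"

definition residue_field ::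
    "('a::field \<Rightarrow> 'g::linordered_ab_group_add) \<Rightarrow> 'a set \<Rightarrow> 'a set set" where
  "residue_field v F =
     (\<lambda>x. valuation_ideal v UNIV
            +>\<^bsub>ring_of_type_algebra\<lparr>carrier := valuation_ring v UNIV\<rparr>\<^esub> x) ` valuation_ring v F"

definition convex_subgroup :: "'g::linordered_ab_group_add set \<Rightarrow> 'g set \<Rightarrow> bool" where
  "convex_subgroup G H \<longleftrightarrow>
     H \<subseteq> G \<and> 0 \<in> H \<and> (\<forall>x\<in>H. \<forall>y\<in>H. x - y \<in> H) \<and>
     (\<forall>x\<in>H. \<forall>z\<in>H. \<forall>y\<in>G. x \<le> y \<and> y \<le> z \<longrightarrow> y \<in> H)"

definition has_rank ::
    "('a::field \<Rightarrow> 'g::linordered_ab_group_add) \<Rightarrow> 'a set \<Rightarrow> nat \<Rightarrow> bool" where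
  "has_rank v F r \<longleftrightarrow>
     finite {H. convex_subgroup (value_group v F) H \<and> H \<noteq> value_group v F} \<and>
     card {H. convex_subgroup (value_group v F) H \<and> H \<noteq> value_group v F} = r"


section \<open>Extensions\<close>

definition field_extension :: "'a::field set \<Rightarrow> 'a set \<Rightarrow> bool" where
  "field_extension K L \<longleftrightarrow>
     subfield K ring_of_type_algebra \<and> subfield L ring_of_type_algebra \<and> K \<subseteq> L"

text \<open>\<open>L|K\<close> is finite of degree \<open>n\<close>.\<close>

definition has_degree :: "'a::field set \<Rightarrow> 'a set \<Rightarrow> nat \<Rightarrow> bool" where
  "has_degree K L n \<longleftrightarrow> ring.dimension ring_of_type_algebra n K L"

definition ramification_index ::
    "('a::field \<Rightarrow> 'g::linordered_ab_group_add) \<Rightarrow> 'a set \<Rightarrow> 'a set \<Rightarrow> nat" where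
  "ramification_index v K L =
     card ((\<lambda>\<gamma>. (\<lambda>\<alpha>. \<alpha> + \<gamma>) ` value_group v K) ` value_group v L)"

definition inertia_degree ::
    "('a::field \<Rightarrow> 'g::linordered_ab_group_add) \<Rightarrow> 'a set \<Rightarrow> 'a set \<Rightarrow> nat" where
  "inertia_degree v K L =
     ring.dim (ambient_residue_field v) (residue_field v K) (residue_field v L)"

text \<open>
  Extensions of \<open>v\<close> from \<open>K\<close> to an algebraic extension \<open>L\<close> are counted as valuations with values in
  \<open>'g\<close> that agree with \<open>v\<close> on \<open>K\<close>, normalised outside their domain.  When \<open>'a\<close> is an algebraic closure
  of \<open>K\<close>, \<open>'g\<close> contains the divisible hull of the value group of \<open>K\<close>, in which all these extensions
  take their values, and two equivalent extensions are equal; so nothing is missed or counted twice.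
\<close>

definition num_extensions ::
    "('a::field \<Rightarrow> 'g::linordered_ab_group_add) \<Rightarrow> 'a set \<Rightarrow> 'a set \<Rightarrow> nat" where
  "num_extensions v K L =
     card {w \<in> extensional (L - {0}). valuation_on L w \<and> (\<forall>x\<in>K - {0}. w x = v x)}"

text \<open>For a finite normal extension: \<open>[L:K] = d * e * f * g\<close> with defect \<open>d > 1\<close>.\<close>

definition nontrivial_defect ::
    "('a::field \<Rightarrow> 'g::linordered_ab_group_add) \<Rightarrow> 'a set \<Rightarrow> 'a set \<Rightarrow> bool" where
  "nontrivial_defect v K L \<longleftrightarrow>
     (\<exists>n d. has_degree K L n \<and>
        n = d * ramification_index v K L * inertia_degree v K L * num_extensions v K L \<and> d > 1)"

definition immediate_extension ::
    "('a::field \<Rightarrow> 'g::linordered_ab_group_add) \<Rightarrow> 'a set \<Rightarrow> 'a set \<Rightarrow> bool" where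
  "immediate_extension v K L \<longleftrightarrow>
     field_extension K L \<and>
     value_group v L = value_group v K \<and> residue_field v L = residue_field v K"

text \<open>The field type \<open>'k\<close>, viewed inside its algebraic closure.\<close>

abbreviation base_field :: "'k::field alg_closure set" where
  "base_field \<equiv> range to_ac"

definition normal_extension :: "'k::field alg_closure set \<Rightarrow> bool" where
  "normal_extension L \<longleftrightarrow>
     field_extension base_field L \<and>
     (\<forall>q :: 'k poly. Factorial_Ring.irreducible q \<and> (\<exists>x\<in>L. poly (map_poly to_ac q) x = 0) \<longrightarrow>
        (\<forall>x. poly (map_poly to_ac q) x = 0 \<longrightarrow> x \<in> L))"

text \<open>An irreducible polynomial is separable if all its roots in the algebraic closure are simple.\<close>

definition separable_extension :: "'k::field alg_closure set \<Rightarrow> bool" where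
  "separable_extension L \<longleftrightarrow>
     field_extension base_field L \<and>
     (\<forall>q :: 'k poly. Factorial_Ring.irreducible q \<and> (\<exists>x\<in>L. poly (map_poly to_ac q) x = 0) \<longrightarrow>
        rsquarefree (map_poly to_ac q))"

definition galois_extension :: "'k::field alg_closure set \<Rightarrow> bool" where
  "galois_extension L \<longleftrightarrow> normal_extension L \<and> separable_extension L"

definition normal_defect_extension_prime_degree ::
    "('k::field alg_closure \<Rightarrow> 'g::linordered_ab_group_add) \<Rightarrow> 'k alg_closure set \<Rightarrow> bool" where
  "normal_defect_extension_prime_degree v L \<longleftrightarrow>
     normal_extension L \<and> (\<exists>q::nat. prime q \<and> has_degree base_field L q) \<and>
     nontrivial_defect v base_field L"

definition artin_schreier_defect_extension ::
    "('k::field alg_closure \<Rightarrow> 'g::linordered_ab_group_add) \<Rightarrow> 'k alg_closure set \<Rightarrow> bool" where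
  "artin_schreier_defect_extension v L \<longleftrightarrow>
     galois_extension L \<and> has_degree base_field L CHAR('k) \<and> nontrivial_defect v base_field L"

text \<open>\<open>K\<^sup>1\<^sup>/\<^sup>p\<close> for \<open>p = char K\<close>.\<close>

definition p_root_field :: "'k::field alg_closure set" where
  "p_root_field = {x. x ^ CHAR('k) \<in> base_field}"

definition maximal_immediate_in_p_root_field ::
    "('k::field alg_closure \<Rightarrow> 'g::linordered_ab_group_add) \<Rightarrow> 'k alg_closure set \<Rightarrow> bool" where
  "maximal_immediate_in_p_root_field v M \<longleftrightarrow>
     M \<subseteq> p_root_field \<and> immediate_extension v base_field M \<and>
     (\<forall>N. M \<subseteq> N \<and> N \<subseteq> p_root_field \<and> immediate_extension v base_field N \<longrightarrow> N = M)"

definition has_p_degree :: "'k::field itself \<Rightarrow> nat \<Rightarrow> bool" where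
  "has_p_degree _ k \<longleftrightarrow>
     has_degree (base_field :: 'k alg_closure set) p_root_field (CHAR('k) ^ k) \<and>
     has_degree (range (\<lambda>x::'k. x ^ CHAR('k))) (UNIV :: 'k set) (CHAR('k) ^ k)"


section \<open>Distances\<close>

text \<open>
  The divisible hull of a subgroup \<open>G\<close>, formed inside the torsion free group \<open>'g\<close>; it is the full
  divisible hull if \<open>G\<close> is the value group of a subfield over which \<open>'a\<close> is an algebraic closure.
\<close>

definition divisible_hull :: "'g::linordered_ab_group_add set \<Rightarrow> 'g set" where
  "divisible_hull G = {\<gamma>. \<exists>n>0. (\<Sum>i<n::nat. \<gamma>) \<in> G}"

text \<open>A cut in the divisible hull is represented by its lower cut set.\<close>

definition distance ::
    "('a::field \<Rightarrow> 'g::linordered_ab_group_add) \<Rightarrow> 'a set \<Rightarrow> 'a \<Rightarrow> 'g set" where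
  "distance v K a =
     {\<gamma> \<in> divisible_hull (value_group v K).
        \<exists>\<delta> \<in> {v (a - c) | c. c \<in> K \<and> c \<noteq> a} \<inter> divisible_hull (value_group v K). \<gamma> \<le> \<delta>}"

definition distance_eq_mod :: "'g::linordered_ab_group_add set \<Rightarrow> ('g set \<times> 'g set) set" where
  "distance_eq_mod G = {(D, D'). \<exists>\<alpha>\<in>G. D' = (\<lambda>\<gamma>. \<alpha> + \<gamma>) ` D}"

definition distances_mod ::
    "('a::field \<Rightarrow> 'g::linordered_ab_group_add) \<Rightarrow> 'a set \<Rightarrow> ('a set \<Rightarrow> bool) \<Rightarrow> 'g set set set" where
  "distances_mod v K P =
     {distance v K b | b L. P L \<and> b \<in> L - K} // distance_eq_mod (value_group v K)"

end

theory Submission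
  imports Defs
begin

text \<open>
  If \<open>v(b - K)\<close> has no maximum and all conjugates of \<open>b\<close>, an element of degree \<open>p\<close>, are closer to
  \<open>b\<close> than \<open>K\<close> is, then counting the roots near \<open>b\<close> shows that no polynomial over \<open>K\<close> of degree
  less than \<open>p\<close> has a root that close.  Hence \<open>K(b)|K\<close> is immediate, and all its elements outside
  \<open>K\<close> have the same distance modulo \<open>vK\<close>.

  Every extension in question is generated by a \<open>p\<close>-th root or by an Artin--Schreier generator
  \<open>\<theta>\<close>.  In the second case, either \<open>v(\<theta> - K)\<close> is the set of values below a proper convex subgroup,
  which leaves \<open>r\<close> possibilities, or \<open>\<theta>\<close> has the same distance as some \<open>p\<close>-th root.  The distance
  of a \<open>p\<close>-th root is attained in the maximal immediate extension \<open>K'\<close>, by maximality; and along a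
  tower of \<open>m\<close> steps of degree \<open>p\<close> from \<open>K\<close> to \<open>K'\<close>, each step adds at most one new distance.
\<close>

section \<open>Subfields of a field type\<close>

text \<open>\<open>K\<close> is not assumed henselian, so a priori conjugate elements may have
  different values. What prevents this is the defect: a prime degree d*e*f*g with d > 1 leaves e = f
  = g = 1. From g = 1, composing \<open>v\<close> with a \<open>K\<close>-embedding of
  \<open>L\<close> into itself gives back \<open>v\<close>; from e = f = 1, every nonzero element of
  \<open>L\<close> has a leading term in \<open>K\<close>. Together they show that n conjugates of a
  nonzero element cannot add up to 0 unless p divides n. This forces the degree to be p, and it
  makes the orbits long enough to produce an Artin-Schreier generator. In the tower all distances
  are measured over \<open>K\<close>, whereas a single step E(b)|E is understood over
  \<open>E\<close>. So an element is first compared with \<open>E\<close>: either some member of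
  \<open>E\<close> is closer to it than all of \<open>K\<close>, and its distance is an old one, or
  \<open>K\<close> approximates it as well as \<open>E\<close> does, and its distances over both
  fields agree. The bound by the p-degree comes from the same tower, built inside K^(1/p) until no
  p-th root can be adjoined immediately.\<close>

definition is_subfield :: "'a::field set \<Rightarrow> bool" where
  "is_subfield K \<longleftrightarrow> 0 \<in> K \<and> 1 \<in> K \<and> (\<forall>x\<in>K. \<forall>y\<in>K. x - y \<in> K) \<and>
     (\<forall>x\<in>K. \<forall>y\<in>K. x * y \<in> K) \<and> (\<forall>x\<in>K. inverse x \<in> K)"

lemma ring_of_type_algebra_simps [simp]:
  "carrier (ring_of_type_algebra :: 'a::ring_1 ring) = UNIV"
  "x \<otimes>\<^bsub>ring_of_type_algebra\<^esub> y = x * (y :: 'a)"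
  "x \<oplus>\<^bsub>ring_of_type_algebra\<^esub> y = x + (y :: 'a)"
  "\<one>\<^bsub>ring_of_type_algebra\<^esub> = (1 :: 'a)"
  "\<zero>\<^bsub>ring_of_type_algebra\<^esub> = (0 :: 'a)"
  by (simp_all add: ring_of_type_algebra_def)

lemma a_inv_ring_of_type_algebra [simp]:
  "\<ominus>\<^bsub>ring_of_type_algebra\<^esub> x = - (x :: 'a::comm_ring_1)"
proof -
  interpret ring "ring_of_type_algebra :: 'a ring" by (rule ring_from_type_algebra)
  show ?thesis by (rule minus_equality) simp_all
qed

lemma Units_ring_of_type_algebra [simp]:
  "Units (ring_of_type_algebra :: 'a::field ring) = UNIV - {0}"
proof -
  interpret field "ring_of_type_algebra :: 'a ring" by (rule field_from_type_algebra)
  show ?thesis by (simp add: field_Units)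
qed

lemma m_inv_ring_of_type_algebra [simp]:
  "x \<noteq> 0 \<Longrightarrow> inv\<^bsub>ring_of_type_algebra\<^esub> x = inverse (x :: 'a::field)"
proof -
  interpret field "ring_of_type_algebra :: 'a ring" by (rule field_from_type_algebra)
  show "x \<noteq> 0 \<Longrightarrow> ?thesis" by (rule comm_inv_char) auto
qed

text \<open>Polynomials and valuations live on the field type, dimensions of extensions in
  \<open>HOL-Algebra\<close>; this equivalence is the passage between the two. Closure under
  \<open>inverse\<close> may include 0 because \<open>inverse 0 = 0\<close>.\<close>

lemma subfield_iff_is_subfield: "subfield K ring_of_type_algebra \<longleftrightarrow> is_subfield K"
proof -
  interpret field "ring_of_type_algebra :: 'a ring" by (rule field_from_type_algebra)
  show ?thesis
  proof
    assume *: "subfield K ring_of_type_algebra"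
    note sub = subfieldE[OF this]
    have "x - y \<in> K" if "x \<in> K" "y \<in> K" for x y
      using subringE(5,7)[OF sub(1)] that by (metis a_inv_ring_of_type_algebra
          add_uminus_conv_diff ring_of_type_algebra_simps(3))
    moreover have "inverse x \<in> K" if "x \<in> K" for x
    proof (cases "x = 0")
      case False
      thus ?thesis using subfield_m_inv(1)[OF *, of x] that by auto
    qed (use subringE(2)[OF sub(1)] in auto)
    ultimately show "is_subfield K"
      using subringE(2,3,6)[OF sub(1)] by (auto simp: is_subfield_def)
  next
    assume K: "is_subfield K"
    have neg: "- x \<in> K" if "x \<in> K" for x
      using K that unfolding is_subfield_def by (metis diff_0)
    have "subring K ring_of_type_algebra"
      using K neg unfolding is_subfield_def
      by (intro subringI) (auto, metis diff_minus_eq_add)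
    moreover have "K - {0} \<subseteq> Units (ring_of_type_algebra\<lparr>carrier := K\<rparr>)"
      using K unfolding is_subfield_def Units_def
      by (auto intro!: bexI[of _ "inverse _"])
    ultimately show "subfield K ring_of_type_algebra"
      using subfieldI'[of K] K unfolding is_subfield_def by auto
  qed
qed

context
  fixes K :: "'a::field set"
  assumes K: "is_subfield K"
begin

lemma subfield_zero: "0 \<in> K" and subfield_one: "1 \<in> K"
  and subfield_diff: "x \<in> K \<Longrightarrow> y \<in> K \<Longrightarrow> x - y \<in> K"
  and subfield_mult: "x \<in> K \<Longrightarrow> y \<in> K \<Longrightarrow> x * y \<in> K"
  and subfield_inverse: "x \<in> K \<Longrightarrow> inverse x \<in> K"
  using K by (auto simp: is_subfield_def)

lemma subfield_minus: "x \<in> K \<Longrightarrow> - x \<in> K"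
  using subfield_diff[of 0 x] subfield_zero by simp

lemma subfield_add: "x \<in> K \<Longrightarrow> y \<in> K \<Longrightarrow> x + y \<in> K"
  using subfield_diff[of x "- y"] subfield_minus[of y] by simp

lemma subfield_divide: "x \<in> K \<Longrightarrow> y \<in> K \<Longrightarrow> x / y \<in> K"
  by (simp add: divide_inverse subfield_mult subfield_inverse)

lemma subfield_power: "x \<in> K \<Longrightarrow> x ^ n \<in> K"
  by (induction n) (auto intro: subfield_mult subfield_one)

lemma subfield_sum: "(\<And>i. i \<in> I \<Longrightarrow> f i \<in> K) \<Longrightarrow> sum f I \<in> K"
  by (induction I rule: infinite_finite_induct) (auto intro: subfield_zero subfield_add)

lemma subfield_of_nat: "of_nat n \<in> K"
  by (induction n) (auto intro: subfield_zero subfield_one subfield_add)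

end

lemmas subfield_closed = subfield_zero subfield_one subfield_diff subfield_mult subfield_inverse
  subfield_minus subfield_add subfield_divide subfield_power subfield_of_nat

section \<open>Polynomials with coefficients in a subfield\<close>

definition poly_over :: "'a::field set \<Rightarrow> 'a poly \<Rightarrow> bool" where
  "poly_over K f \<longleftrightarrow> (\<forall>i. coeff f i \<in> K)"

context
  fixes K :: "'a::field set"
  assumes K: "is_subfield K"
begin

lemma poly_over_0: "poly_over K 0" and poly_over_const: "x \<in> K \<Longrightarrow> poly_over K [:x:]"
  and poly_over_pCons: "x \<in> K \<Longrightarrow> poly_over K f \<Longrightarrow> poly_over K (pCons x f)"
  and poly_over_add: "poly_over K f \<Longrightarrow> poly_over K g \<Longrightarrow> poly_over K (f + g)"
  and poly_over_diff: "poly_over K f \<Longrightarrow> poly_over K g \<Longrightarrow> poly_over K (f - g)"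
  and poly_over_smult: "x \<in> K \<Longrightarrow> poly_over K f \<Longrightarrow> poly_over K (smult x f)"
  and poly_over_monom: "x \<in> K \<Longrightarrow> poly_over K (monom x n)"
  by (auto simp: poly_over_def coeff_pCons subfield_closed[OF K] split: nat.splits)

lemma poly_over_mult: "poly_over K f \<Longrightarrow> poly_over K g \<Longrightarrow> poly_over K (f * g)"
  by (auto simp: poly_over_def coeff_mult intro!: subfield_sum[OF K] subfield_closed[OF K])

lemma poly_over_pderiv: "poly_over K f \<Longrightarrow> poly_over K (pderiv f)"
  by (simp only: poly_over_def coeff_pderiv)
    (metis K subfield_mult subfield_of_nat)

lemma poly_over_poly: "poly_over K f \<Longrightarrow> x \<in> K \<Longrightarrow> poly f x \<in> K"
  by (auto simp: poly_over_def poly_altdef intro!: subfield_sum[OF K] subfield_closed[OF K])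

text \<open>Each step of long division uses only the quotient of two leading coefficients, which
  lies in \<open>K\<close>; so quotient and remainder keep their coefficients in \<open>K\<close>.
  The alternative \<open>s = 0\<close> covers constant \<open>f\<close>.\<close>

lemma poly_over_division:
  assumes f: "poly_over K f" "f \<noteq> 0" and g: "poly_over K g"
  shows "\<exists>q s. poly_over K q \<and> poly_over K s \<and> g = q * f + s \<and> (s = 0 \<or> degree s < degree f)"
  using g
proof (induction "degree g" arbitrary: g rule: less_induct)
  case less
  show ?case
  proof (cases "g = 0 \<or> degree g < degree f")
    case True
    thus ?thesis using less.prems by (intro exI[of _ 0] exI[of _ g]) (auto simp: poly_over_0)
  next
    case False
    define c where "c = lead_coeff g / lead_coeff f"
    define m where "m = monom c (degree g - degree f)"
    define g' where "g' = g - m * f"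
    have c: "c \<in> K" using less.prems f unfolding c_def poly_over_def by (intro subfield_closed[OF K]) auto
    have m: "poly_over K m" unfolding m_def using c by (rule poly_over_monom)
    have g': "poly_over K g'" unfolding g'_def by (intro poly_over_diff less.prems poly_over_mult m f)
    have c0: "c \<noteq> 0" using False f by (auto simp: c_def)
    have deg: "degree (m * f) = degree g"
      using False f c0 by (simp add: m_def degree_mult_eq degree_monom_eq)
    have lc: "lead_coeff (m * f) = lead_coeff g"
      using f by (simp only: lead_coeff_mult m_def lead_coeff_monom) (simp add: c_def)
    consider "g' = 0" | "degree g' < degree g" | "degree g = 0"
    proof -
      have "degree g' \<le> degree g" unfolding g'_def using deg by (intro degree_diff_le) auto
      moreover have "coeff g' (degree g) = 0" unfolding g'_def using deg lc by simp
      ultimately have "degree g' < degree g \<or> g' = 0"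
        by (metis leading_coeff_0_iff le_neq_implies_less)
      thus ?thesis using that by blast
    qed
    hence "g' = 0 \<or> degree g' < degree g"
    proof cases
      case 3
      hence "degree f = 0" using False by simp
      then obtain a b where "f = [:a:]" "g = [:b:]" using 3 degree_0_id by metis
      hence "g' = 0" using f by (simp add: g'_def m_def c_def monom_0)
      thus ?thesis by simp
    qed auto
    then obtain q s where qs: "poly_over K q" "poly_over K s" "g' = q * f + s"
       "s = 0 \<or> degree s < degree f"
      using less.hyps[of g'] g' poly_over_0 by (metis add_0 mult_zero_left)
    show ?thesis
      using qs m by (intro exI[of _ "q + m"] exI[of _ s])
        (auto simp: poly_over_add g'_def algebra_simps)
  qed
qed

end

section \<open>Valuations of a field type\<close>

locale valued_field =
  fixes v :: "'a::field \<Rightarrow> 'g::linordered_ab_group_add"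
  assumes valuation: "valuation_on UNIV v"
begin

text \<open>Strict inequality of values in which 0 has the value infinity, since \<open>v 0\<close>
  is arbitrary.\<close>

definition vgt :: "'g \<Rightarrow> 'a \<Rightarrow> bool" where
  "vgt g x \<longleftrightarrow> x = 0 \<or> g < v x"

text \<open>Equality of leading terms: \<open>x\<close> and \<open>y\<close> differ by a factor in 1
  + M, where M is the valuation ideal. This refines equality of values, is multiplicative, and sees
  the residue of a unit.\<close>

definition veq :: "'a \<Rightarrow> 'a \<Rightarrow> bool" where
  "veq x y \<longleftrightarrow> x \<noteq> 0 \<and> y \<noteq> 0 \<and> vgt (v x) (x - y)"

lemma v_mult: "x \<noteq> 0 \<Longrightarrow> y \<noteq> 0 \<Longrightarrow> v (x * y) = v x + v y"
  using valuation by (auto simp: valuation_on_def)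

lemma v_add: "x \<noteq> 0 \<Longrightarrow> y \<noteq> 0 \<Longrightarrow> x + y \<noteq> 0 \<Longrightarrow> min (v x) (v y) \<le> v (x + y)"
  using valuation by (auto simp: valuation_on_def)

lemma v_one [simp]: "v 1 = 0"
  using v_mult[of 1 1] by simp

lemma v_minus [simp]: "v (- x) = v x"
proof (cases "x = 0")
  case False
  have "v (- 1) + v (- 1) = 0" using v_mult[of "- 1" "- 1"] by simp
  hence "v (- 1) = 0" by simp
  thus ?thesis using v_mult[of "- 1" x] False by simp
qed simp

lemma v_diff_commute: "v (x - y) = v (y - x)"
  using v_minus[of "x - y"] by simp

lemma v_inverse: "x \<noteq> 0 \<Longrightarrow> v (inverse x) = - v x"
  using v_mult[of x "inverse x"] by (simp add: eq_neg_iff_add_eq_0 add.commute)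

lemma v_divide: "x \<noteq> 0 \<Longrightarrow> y \<noteq> 0 \<Longrightarrow> v (x / y) = v x - v y"
  by (simp add: divide_inverse v_mult v_inverse)

lemma vgt_0 [simp]: "vgt g 0"
  by (simp add: vgt_def)

lemma vgt_add: "vgt g x \<Longrightarrow> vgt g y \<Longrightarrow> vgt g (x + y)"
  using v_add[of x y] by (cases "x = 0 \<or> y = 0 \<or> x + y = 0") (auto simp: vgt_def min_def split: if_splits)

lemma vgt_minus [simp]: "vgt g (- x) \<longleftrightarrow> vgt g x"
  by (simp add: vgt_def)

lemma vgt_diff: "vgt g x \<Longrightarrow> vgt g y \<Longrightarrow> vgt g (x - y)"
  using vgt_add[of g x "- y"] by simp

lemma vgt_diff_commute: "vgt g (x - y) \<longleftrightarrow> vgt g (y - x)"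
  using vgt_minus[of g "x - y"] by simp

lemma vgt_mono: "vgt g x \<Longrightarrow> h \<le> g \<Longrightarrow> vgt h x"
  by (auto simp: vgt_def)

lemma vgt_of_nat_mult: "vgt g x \<Longrightarrow> vgt g (of_nat n * x)"
  by (induction n) (auto simp: algebra_simps intro: vgt_add)

lemma vgt_mult: "vgt g y \<Longrightarrow> x \<noteq> 0 \<Longrightarrow> vgt (v x + g) (x * y)"
  by (cases "y = 0") (auto simp: vgt_def v_mult)

lemma v_add_dominant:
  assumes "x \<noteq> 0" "vgt (v x) e"
  shows "x + e \<noteq> 0" "v (x + e) = v x"
proof -
  show 1: "x + e \<noteq> 0"
  proof
    assume "x + e = 0"
    hence "e = - x" by (metis add.commute add_eq_0_iff)
    thus False using assms by (simp add: vgt_def)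
  qed
  show "v (x + e) = v x"
  proof (cases "e = 0")
    case False
    hence lt: "v x < v e" using assms by (simp add: vgt_def)
    have "v x \<le> v (x + e)" using v_add[OF assms(1) False 1] lt by (simp add: min_def split: if_splits)
    moreover have "\<not> v x < v (x + e)"
    proof
      assume *: "v x < v (x + e)"
      have "min (v (x + e)) (v (- e)) \<le> v (x + e + - e)"
        using 1 False assms by (intro v_add) auto
      thus False using * lt by (simp add: min_def split: if_splits)
    qed
    ultimately show ?thesis by simp
  qed simp
qed

lemma v_of_eq_add: "x \<noteq> 0 \<Longrightarrow> vgt (v x) (y - x) \<Longrightarrow> v y = v x"
  using v_add_dominant(2)[of x "y - x"] by simp

lemma veq_v: "veq x y \<Longrightarrow> v x = v y"
  using v_of_eq_add[of x y] by (simp add: veq_def vgt_diff_commute)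

lemma veqI: "x \<noteq> 0 \<Longrightarrow> vgt (v x) (x - y) \<Longrightarrow> veq x y"
  using v_add_dominant(1)[of x "y - x"] by (simp add: veq_def vgt_diff_commute)

lemma veq_refl: "x \<noteq> 0 \<Longrightarrow> veq x x"
  by (simp add: veq_def)

lemma veq_sym: "veq x y \<Longrightarrow> veq y x"
  using veq_v[of x y] by (simp add: veq_def vgt_diff_commute)

lemma veq_trans: "veq x y \<Longrightarrow> veq y z \<Longrightarrow> veq x z"
  using veq_v[of x y] vgt_add[of "v x" "x - y" "y - z"] by (simp add: veq_def)

lemma veq_mult:
  assumes "veq x y" "veq x' y'" shows "veq (x * x') (y * y')"
proof -
  have ne: "x \<noteq> 0" "y \<noteq> 0" "x' \<noteq> 0" "y' \<noteq> 0" using assms by (auto simp: veq_def)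
  have "vgt (v x + v x') (x * (x' - y') + y' * (x - y))"
    using vgt_mult[of "v x'" "x' - y'" x] vgt_mult[of "v x" "x - y" y'] assms ne
      veq_v[OF assms(2)] by (intro vgt_add) (auto simp: veq_def add.commute)
  also have "x * (x' - y') + y' * (x - y) = x * x' - y * y'" by (simp add: algebra_simps)
  finally show ?thesis using ne by (simp add: veq_def v_mult)
qed

lemma v_power_mono_strict:
  assumes "x \<noteq> 0" "y \<noteq> 0" "v x < v y" "0 < n" shows "v (x ^ n) < v (y ^ n)"
  using assms(4)
proof (induction n rule: nat_induct_non_zero)
  case (Suc n)
  thus ?case using assms by (simp add: v_mult add_strict_mono)
qed (use assms in simp)

lemma v_power_eq: "x \<noteq> 0 \<Longrightarrow> y \<noteq> 0 \<Longrightarrow> v x = v y \<Longrightarrow> v (x ^ n) = v (y ^ n)"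
  by (induction n) (auto simp: v_mult)

lemma v_power_less_iff:
  assumes "x \<noteq> 0" "y \<noteq> 0" "0 < n" shows "v (x ^ n) < v (y ^ n) \<longleftrightarrow> v x < v y"
  using v_power_mono_strict[OF assms(1,2) _ assms(3)] v_power_mono_strict[OF assms(2,1) _ assms(3)]
    v_power_eq[OF assms(1,2)]
  by (metis less_asym less_linear order_less_irrefl)

end

section \<open>Approximation from a subfield\<close>

lemma poly_splits_induct [consumes 1, case_names const factor]:
  fixes G :: "'a::alg_closed_field poly"
  assumes "G \<noteq> 0"
    and "\<And>a. a \<noteq> 0 \<Longrightarrow> P [:a:]"
    and "\<And>\<rho> Q. Q \<noteq> 0 \<Longrightarrow> P Q \<Longrightarrow> P ([:- \<rho>, 1:] * Q)"
  shows "P G"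
  using assms(1)
proof (induction "degree G" arbitrary: G)
  case 0
  then obtain a where "G = [:a:]" by (metis degree_0_id)
  thus ?case using 0 assms(2) by auto
next
  case (Suc n)
  then obtain \<rho> where "poly G \<rho> = 0" using alg_closed_imp_poly_has_root[of G] by auto
  then obtain Q where Q: "G = [:- \<rho>, 1:] * Q" by (metis poly_eq_0_iff_dvd dvdE)
  hence "Q \<noteq> 0" using Suc by auto
  moreover have "degree G = Suc (degree Q)" unfolding Q using \<open>Q \<noteq> 0\<close> by (subst degree_mult_eq) auto
  ultimately show ?case using Suc Q assms(3) by auto
qed

context valued_field
begin

text \<open>The filter of elements of \<open>K\<close> approaching \<open>b\<close>, by which "for
  all \<open>c\<close> close enough to \<open>b\<close>" becomes \<open>eventually\<close>. It takes
  the place of a pseudo Cauchy sequence and its well-ordered index set.\<close>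

definition near :: "'a set \<Rightarrow> 'a \<Rightarrow> 'a filter" where
  "near K b = (INF c0\<in>K. principal {c \<in> K. v (b - c0) \<le> v (b - c)})"

text \<open>In classical terms, \<open>b\<close> is a limit of a pseudo Cauchy sequence in
  \<open>K\<close> that has no limit in \<open>K\<close>. The condition \<open>b \<notin> K\<close>
  also keeps b - c away from 0, where the value of \<open>v\<close> carries no meaning.\<close>

definition pseudo_limit :: "'a set \<Rightarrow> 'a \<Rightarrow> bool" where
  "pseudo_limit K b \<longleftrightarrow> is_subfield K \<and> b \<notin> K \<and> (\<forall>c\<in>K. \<exists>c'\<in>K. v (b - c) < v (b - c'))"

end

locale approximation = valued_field v
  for v :: "'a::alg_closed_field \<Rightarrow> 'g::linordered_ab_group_add" +
  fixes K :: "'a set" and b :: 'a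
  assumes pseudo_limit: "pseudo_limit K b"
begin

lemma K: "is_subfield K" and b_notin: "b \<notin> K"
  and better: "c \<in> K \<Longrightarrow> \<exists>c'\<in>K. v (b - c) < v (b - c')"
  using pseudo_limit by (auto simp: pseudo_limit_def)

lemma eventually_near:
  "eventually P (near K b) \<longleftrightarrow> (\<exists>c0\<in>K. \<forall>c\<in>K. v (b - c0) \<le> v (b - c) \<longrightarrow> P c)"
proof -
  have "eventually P (near K b) \<longleftrightarrow>
      (\<exists>c0\<in>K. eventually P (principal {c \<in> K. v (b - c0) \<le> v (b - c)}))"
    unfolding near_def
  proof (rule eventually_INF_base)
    fix x y assume "x \<in> K" "y \<in> K"
    thus "\<exists>z\<in>K. principal {c \<in> K. v (b - z) \<le> v (b - c)}
        \<le> inf (principal {c \<in> K. v (b - x) \<le> v (b - c)}) (principal {c \<in> K. v (b - y) \<le> v (b - c)})"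
      by (intro bexI[of _ "if v (b - x) \<le> v (b - y) then y else x"]) auto
  qed (use subfield_zero[OF K] in auto)
  thus ?thesis by (auto simp: eventually_principal)
qed

lemma near_mem: "eventually (\<lambda>c. c \<in> K) (near K b)"
  using subfield_zero[OF K] by (auto simp: eventually_near)

lemma near_ne: "eventually (\<lambda>c. c - b \<noteq> 0) (near K b)"
  using near_mem by eventually_elim (use b_notin in auto)

lemma near_better: "c0 \<in> K \<Longrightarrow> eventually (\<lambda>c. v (b - c0) < v (c - b)) (near K b)"
  using better[of c0] by (auto simp: eventually_near v_diff_commute[of _ b] intro: less_le_trans)

lemma near_not_bot: "near K b \<noteq> bot"
  unfolding trivial_limit_def eventually_near by blast

lemma near_happens: "eventually P (near K b) \<Longrightarrow> \<exists>c\<in>K. P c"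
  using eventually_happens[OF eventually_conj[OF near_mem]] near_not_bot by auto

definition leading :: "'a poly \<Rightarrow> 'a \<Rightarrow> nat \<Rightarrow> bool" where
  "leading G C k \<longleftrightarrow> eventually (\<lambda>c. veq (C * (c - b) ^ k) (poly G c)) (near K b)"

text \<open>The exponent \<open>k\<close> counts the roots of \<open>G\<close> that are closer to \<open>b\<close> than every element of \<open>K\<close>.\<close>

lemma leading_exists:
  assumes "G \<noteq> 0"
  shows "\<exists>C k. C \<noteq> 0 \<and> k \<le> degree G \<and> leading G C k \<and> (k = 0 \<longrightarrow> C = poly G b) \<and>
    eventually (\<lambda>c. vgt (v (C * (c - b) ^ k)) ((c - b) * poly (pderiv G) c - of_nat k * (C * (c - b) ^ k)))
      (near K b)"
  using assms
proof (induction G rule: poly_splits_induct)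
  case (const a)
  show ?case
    by (rule exI[of _ a], rule exI[of _ 0]) (use const in \<open>auto simp: leading_def veq_refl pderiv_pCons\<close>)
next
  case (factor \<rho> Q)
  then obtain C k where C: "C \<noteq> 0" and k: "k \<le> degree Q" and l: "leading Q C k"
    and k0: "k = 0 \<longrightarrow> C = poly Q b"
    and der: "eventually (\<lambda>c. vgt (v (C * (c - b) ^ k))
        ((c - b) * poly (pderiv Q) c - of_nat k * (C * (c - b) ^ k))) (near K b)"
    by blast
  define G where "G = [:- \<rho>, 1:] * Q"
  have deg: "degree G = Suc (degree Q)" unfolding G_def using factor by (subst degree_mult_eq) auto
  have pG: "poly G c = (c - \<rho>) * poly Q c" for c
    by (simp add: G_def algebra_simps)
  have pd: "poly (pderiv G) c = poly Q c + (c - \<rho>) * poly (pderiv Q) c" for c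
    unfolding G_def by (subst pderiv_mult) (simp add: pderiv_pCons algebra_simps)
  show ?case
  \<comment> \<open>A root \<rho> closer to \<open>b\<close> than all of \<open>K\<close> behaves
    like \<open>b\<close>: c - \<rho> has the leading term of c - b, and the exponent grows by one.
    Otherwise c - \<rho> has the constant leading term of b - \<rho> as soon as \<open>c\<close> is
    close enough, and the exponent stays.\<close>
  proof (cases "\<forall>c\<in>K. vgt (v (b - c)) (\<rho> - b)")
    case True
    have "eventually (\<lambda>c. veq (c - b) (c - \<rho>)) (near K b)"
      using near_mem near_ne
      by eventually_elim (use True in \<open>auto simp: veq_def vgt_def v_diff_commute\<close>)
    hence "eventually (\<lambda>c. veq (C * (c - b) ^ Suc k) (poly G c) \<and>
      vgt (v (C * (c - b) ^ Suc k))
        ((c - b) * poly (pderiv G) c - of_nat (Suc k) * (C * (c - b) ^ Suc k))) (near K b)"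
      using l[unfolded leading_def] der near_ne
    proof eventually_elim
      case (elim c)
      define t where "t = c - b"
      define Y where "Y = C * t ^ k"
      have Y: "Y \<noteq> 0" "t \<noteq> 0" using C elim by (auto simp: Y_def t_def)
      have vY: "v (C * t ^ Suc k) = v t + v Y" using Y C by (simp add: Y_def v_mult add_ac)
      have veqs: "veq t (c - \<rho>)" "veq Y (poly Q c)" using elim by (simp_all add: t_def Y_def)
      have e: "vgt (v Y) (t * poly (pderiv Q) c - of_nat k * Y)" using elim by (simp add: t_def Y_def)
      \<comment> \<open>The claim on the derivative says that (c - b) G'(c) / G(c) is k modulo the
        valuation ideal: every close root contributes 1, every other root 0. The error is split into
        three parts: replacing \<open>poly Q c\<close> by \<open>Y\<close>, the error inherited from
        \<open>Q\<close>, and replacing c - \<rho> by \<open>t\<close>.\<close>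
      have "vgt (v t + v Y) (t * (poly Q c - Y) + (c - \<rho>) * (t * poly (pderiv Q) c - of_nat k * Y)
         + of_nat k * (Y * ((c - \<rho>) - t)))"
        using vgt_mult[of "v Y" "poly Q c - Y" t] vgt_mult[OF e, of "c - \<rho>"]
          vgt_mult[of "v t" "(c - \<rho>) - t" Y] veqs veq_v[OF veqs(1)] Y
        by (intro vgt_add vgt_of_nat_mult) (auto simp: veq_def vgt_diff_commute add.commute)
      also have "t * (poly Q c - Y) + (c - \<rho>) * (t * poly (pderiv Q) c - of_nat k * Y)
         + of_nat k * (Y * ((c - \<rho>) - t)) = t * poly (pderiv G) c - of_nat (Suc k) * (C * t ^ Suc k)"
        unfolding pd by (simp add: Y_def algebra_simps)
      finally have "vgt (v (C * t ^ Suc k)) (t * poly (pderiv G) c - of_nat (Suc k) * (C * t ^ Suc k))"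
        by (simp only: vY)
      moreover have "veq (t * Y) ((c - \<rho>) * poly Q c)" by (intro veq_mult veqs)
      ultimately show ?case by (simp add: pG t_def Y_def mult_ac)
    qed
    thus ?thesis
      unfolding G_def[symmetric] by (intro exI[of _ C] exI[of _ "Suc k"]) (use C k deg in \<open>auto simp: leading_def eventually_conj_iff\<close>)
  next
    case False
    then obtain c1 where c1: "c1 \<in> K" "\<rho> \<noteq> b" "v (b - \<rho>) \<le> v (b - c1)"
      by (auto simp: vgt_def v_diff_commute not_less)
    define u where "u = b - \<rho>"
    have u: "u \<noteq> 0" using c1 by (simp add: u_def)
    have "eventually (\<lambda>c. veq (u * (C * (c - b) ^ k)) (poly G c) \<and>
      vgt (v (u * (C * (c - b) ^ k)))
        ((c - b) * poly (pderiv G) c - of_nat k * (u * (C * (c - b) ^ k)))) (near K b)"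
      using near_better[OF c1(1)] l[unfolded leading_def] der near_ne
    proof eventually_elim
      case (elim c)
      define t where "t = c - b"
      define Y where "Y = C * t ^ k"
      have Y: "Y \<noteq> 0" "t \<noteq> 0" using C elim by (auto simp: Y_def t_def)
      have ut: "v u < v t" using elim c1 unfolding u_def t_def by auto
      have "veq u (c - \<rho>)"
        by (rule veqI[OF u]) (use Y(2) ut in \<open>auto simp: vgt_def u_def t_def v_diff_commute\<close>)
      note veqs = this elim(2)[folded t_def, folded Y_def]
      have e: "vgt (v Y) (t * poly (pderiv Q) c - of_nat k * Y)" using elim by (simp add: t_def Y_def)
      have tQ: "vgt (v u + v Y) (t * poly Q c)"
        using ut veq_v[OF veqs(2)] veqs(2) Y by (auto simp: vgt_def v_mult veq_def)
      have "vgt (v u + v Y) (t * poly Q c + (c - \<rho>) * (t * poly (pderiv Q) c - of_nat k * Y)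
         + of_nat k * (Y * ((c - \<rho>) - u)))"
        using vgt_mult[OF e, of "c - \<rho>"] tQ
          vgt_mult[of "v u" "(c - \<rho>) - u" Y] veqs veq_v[OF veqs(1)] Y
        by (intro vgt_add vgt_of_nat_mult) (auto simp: veq_def vgt_diff_commute add.commute)
      also have "t * poly Q c + (c - \<rho>) * (t * poly (pderiv Q) c - of_nat k * Y)
         + of_nat k * (Y * ((c - \<rho>) - u)) = t * poly (pderiv G) c - of_nat k * (u * Y)"
        unfolding pd by (simp add: Y_def algebra_simps)
      finally have "vgt (v (u * Y)) (t * poly (pderiv G) c - of_nat k * (u * Y))"
        using v_mult u Y by simp
      moreover have "veq (u * Y) ((c - \<rho>) * poly Q c)" by (intro veq_mult veqs)
      ultimately show ?case by (simp add: pG t_def Y_def mult_ac)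
    qed
    thus ?thesis
      unfolding G_def[symmetric] by (intro exI[of _ "u * C"] exI[of _ k])
        (use C k k0 u deg in \<open>auto simp: leading_def eventually_conj_iff u_def pG mult_ac\<close>)
  qed
qed

text \<open>If the two values agree at one \<open>c1\<close>, then at every closer \<open>c\<close>
  the power of c - b with exponent |j - i| has a strictly larger value than at \<open>c1\<close>, so
  equality fails from there on. Thus different exponents are told apart near \<open>b\<close>,
  whatever the coefficients.\<close>

lemma near_v_ne:
  assumes "C \<noteq> 0" "D \<noteq> 0" "i \<noteq> j"
  shows "eventually (\<lambda>c. v (C * (c - b) ^ i) \<noteq> v (D * (c - b) ^ j)) (near K b)"
proof -
  have *: "eventually (\<lambda>c. v (C * (c - b) ^ i) \<noteq> v (D * (c - b) ^ j)) (near K b)"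
    if C: "C \<noteq> 0" and D: "D \<noteq> 0" and ij: "i < j" for C D :: 'a and i j :: nat
  proof (cases "\<exists>c1\<in>K. v (C * (c1 - b) ^ i) = v (D * (c1 - b) ^ j)")
    case True
    then obtain c1 where c1: "c1 \<in> K" "v (C * (c1 - b) ^ i) = v (D * (c1 - b) ^ j)" by blast
    have eq: "v (C * t ^ i) = v (D * t ^ j) \<longleftrightarrow> v C = v (D * t ^ (j - i))" if "t \<noteq> 0" for t
    proof -
      have "D * t ^ j = (D * t ^ (j - i)) * t ^ i"
        using ij by (simp add: mult.assoc power_add[symmetric])
      thus ?thesis using that C D by (metis add_right_cancel mult_eq_0_iff power_not_zero v_mult)
    qed
    show ?thesis using near_better[OF c1(1)] near_ne
    proof eventually_elim
      case (elim c)
      have ne: "c1 - b \<noteq> 0" using c1 b_notin by auto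
      have "v ((c1 - b) ^ (j - i)) < v ((c - b) ^ (j - i))"
        using elim ne ij by (intro v_power_mono_strict) (auto simp: v_diff_commute)
      hence "v (D * (c1 - b) ^ (j - i)) < v (D * (c - b) ^ (j - i))"
        using elim ne D by (simp add: v_mult)
      thus ?case using eq[OF ne] eq[OF elim(2)] c1 by auto
    qed
  next
    case False
    show ?thesis using near_mem by eventually_elim (use False in auto)
  qed
  show ?thesis
  proof (cases "i < j")
    case False
    hence "eventually (\<lambda>c. v (D * (c - b) ^ j) \<noteq> v (C * (c - b) ^ i)) (near K b)"
      using *[of D C j i] assms by simp
    thus ?thesis by eventually_elim simp
  qed (use *[of C D i j] assms in simp)
qed

lemma leading_unique:
  assumes "leading G C i" "leading G D j" "C \<noteq> 0" "D \<noteq> 0" shows "i = j"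
proof (rule ccontr)
  assume "i \<noteq> j"
  from near_v_ne[OF assms(3,4) this] assms(1,2)[unfolded leading_def]
  have "eventually (\<lambda>_. False) (near K b)"
    by eventually_elim (metis veq_v)
  thus False using near_not_bot by (simp add: trivial_limit_def)
qed

lemma leading_const: "leading G (poly G b) 0 \<Longrightarrow> eventually (\<lambda>c. veq (poly G b) (poly G c)) (near K b)"
  by (simp add: leading_def)

end

lemma degree_pderiv_le: "degree (pderiv f) \<le> degree f - 1"
  by (rule degree_le) (auto simp: coeff_pderiv coeff_eq_0)

context valued_field
begin

lemma v_add_distinct:
  assumes "x \<noteq> 0" "y \<noteq> 0" "v x \<noteq> v y" shows "v (x + y) = v x \<or> v (x + y) = v y"
proof (cases "v x < v y")
  case True
  thus ?thesis using v_add_dominant(2)[of x y] assms by (simp add: vgt_def)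
next
  case False
  thus ?thesis using v_add_dominant(2)[of y x] assms by (auto simp: vgt_def add.commute)
qed

lemma v_of_nat_nonneg: "(of_nat n :: 'a) \<noteq> 0 \<Longrightarrow> 0 \<le> v (of_nat n)"
proof (induction n)
  case (Suc n)
  show ?case
  proof (cases "(of_nat n :: 'a) = 0")
    case False
    thus ?thesis using Suc v_add[of 1 "of_nat n"] by (simp add: min_def split: if_splits)
  qed simp
qed simp

text \<open>By Bezout, k has an inverse i modulo p. Both integers have nonnegative value and their
  product is 1, so both values are 0.\<close>

lemma of_nat_unit:
  assumes "prime CHAR('a)" "\<not> CHAR('a) dvd k"
  shows "(of_nat k :: 'a) \<noteq> 0" "v (of_nat k) = 0"
proof -
  have "k \<noteq> 0" using assms(2) by (metis dvd_0_right)
  moreover have "coprime k CHAR('a)" using assms by (metis coprime_commute prime_imp_coprime)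
  ultimately obtain i j where "k * i = CHAR('a) * j + 1"
    using bezout_nat[of k "CHAR('a)"] by auto
  hence "(of_nat k :: 'a) * of_nat i = of_nat (CHAR('a) * j + 1)" by (metis of_nat_mult)
  hence *: "(of_nat k :: 'a) * of_nat i = 1" by simp
  hence ne: "(of_nat k :: 'a) \<noteq> 0" "(of_nat i :: 'a) \<noteq> 0" by auto
  thus "(of_nat k :: 'a) \<noteq> 0" by simp
  have "v (of_nat k) + v (of_nat i) = 0" using v_mult[OF ne] * by simp
  thus "v (of_nat k) = 0"
    using v_of_nat_nonneg[OF ne(1)] v_of_nat_nonneg[OF ne(2)] by (simp add: add_nonneg_eq_0_iff)
qed

end

context approximation
begin

lemma leading_mult:
  assumes "leading F C i" "leading G D j" shows "leading (F * G) (C * D) (i + j)"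
  using assms unfolding leading_def
proof eventually_elim
  case (elim c)
  show ?case using veq_mult[OF elim] by (simp add: power_add mult_ac)
qed

text \<open>By the ultrametric inequality, two of the values of \<open>G\<close>, \<open>F\<close>
  and \<open>S\<close> coincide at every \<open>c\<close>. Near \<open>b\<close> different exponents
  give different values, and since i and j are positive, the only exponents among i, j and 0 that
  can agree are i and j.\<close>

lemma leading_add:
  assumes "leading G C i" "leading F D j" "leading S e 0" "G = F + S"
    and ne: "C \<noteq> 0" "D \<noteq> 0" "e \<noteq> 0" and pos: "0 < i" "0 < j"
  shows "i = j"
proof (rule ccontr)
  assume "i \<noteq> j"
  note ev = near_v_ne[OF ne(1,2) this] near_v_ne[OF ne(1,3), of i 0] near_v_ne[OF ne(2,3), of j 0]
  have "eventually (\<lambda>c. False) (near K b)"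
    using ev(1) ev(2)[OF less_imp_neq[OF pos(1), symmetric]]
      ev(3)[OF less_imp_neq[OF pos(2), symmetric]] assms(1-3)[unfolded leading_def]
  proof eventually_elim
    case (elim c)
    have "poly G c = poly F c + poly S c" using assms(4) by simp
    thus False using v_add_distinct[of "poly F c" "poly S c"] elim(1-3)
        veq_v[OF elim(4)] veq_v[OF elim(5)] veq_v[OF elim(6)] elim(5,6)
      by (auto simp: veq_def)
  qed
  thus False using near_not_bot by (simp add: trivial_limit_def)
qed

lemma leading_linear:
  assumes "\<rho> \<in> K" "a \<noteq> 0" shows "leading [:- (a * \<rho>), a:] (a * (b - \<rho>)) 0"
  unfolding leading_def using near_better[OF assms(1)]
proof eventually_elim
  case (elim c)
  have ne: "b - \<rho> \<noteq> 0" using assms b_notin by auto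
  have "veq (b - \<rho>) (c - \<rho>)"
    by (rule veqI[OF ne]) (use elim in \<open>auto simp: vgt_def v_diff_commute\<close>)
  from veq_mult[OF veq_refl[OF assms(2)] this] show ?case by (simp add: algebra_simps)
qed

end

text \<open>All roots of the polynomial \<open>h\<close> over \<open>K\<close>, of degree \<open>p\<close>, are closer to \<open>b\<close> than \<open>K\<close> is.
  This replaces the henselian hypothesis of Kaplansky's theory of pseudo Cauchy sequences.\<close>

locale tight_approximation = approximation v K b
  for v :: "'a::alg_closed_field \<Rightarrow> 'g::linordered_ab_group_add" and K :: "'a set" and b :: 'a +
  fixes h :: "'a poly"
  assumes prime_char: "prime CHAR('a)"
    and h: "poly_over K h" "degree h = CHAR('a)" "leading h 1 CHAR('a)"
begin

text \<open>Let \<open>f\<close> be a counterexample of least degree, so that k > 0 of its roots are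
  close to \<open>b\<close>. As k < p, differentiation leaves k - 1 close roots, and minimality
  gives k = 1. Dividing by \<open>f\<close>, with remainders that have no close root, shows that a
  polynomial over \<open>K\<close> with j close roots has degree at least j * deg f. For
  \<open>h\<close>, which has degree p and p close roots, this means deg f = 1; but then the root of
  \<open>f\<close> lies in \<open>K\<close> and cannot be close to \<open>b\<close>.\<close>

lemma leading_low_degree:
  assumes "poly_over K f" "f \<noteq> 0" "degree f < CHAR('a)"
  shows "poly f b \<noteq> 0 \<and> leading f (poly f b) 0"
  using assms
proof (induction "degree f" arbitrary: f rule: less_induct)
  case less
  note f = less.prems and IH = less.hyps
  show ?case
  proof (rule ccontr)
    assume bad: "\<not> ?case"
    obtain C k where C: "C \<noteq> 0" "k \<le> degree f" and l: "leading f C k"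
      and k0: "k = 0 \<longrightarrow> C = poly f b"
      and der: "eventually (\<lambda>c. vgt (v (C * (c - b) ^ k))
        ((c - b) * poly (pderiv f) c - of_nat k * (C * (c - b) ^ k))) (near K b)"
      using leading_exists[OF f(2)] by blast
    have k: "0 < k" using bad C l k0 by (metis gr0I)
    hence "\<not> CHAR('a) dvd k" using f(3) C by (auto dest: dvd_imp_le)
    note k_unit = of_nat_unit[OF prime_char this]
    have l': "leading (pderiv f) (of_nat k * C) (k - 1)"
      unfolding leading_def using der near_ne
    proof eventually_elim
      case (elim c)
      define t where "t = c - b"
      have t: "t \<noteq> 0" using elim by (simp add: t_def)
      have "C * t ^ k \<noteq> 0" using C t by simp
      hence "v (of_nat k * (C * t ^ k)) = v (C * t ^ k)" using v_mult k_unit by simp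
      hence "veq (of_nat k * (C * t ^ k)) (t * poly (pderiv f) c)"
        using elim C t k_unit by (intro veqI) (auto simp: t_def vgt_diff_commute)
      from veq_mult[OF veq_refl this, of "inverse t"] t
      have "veq (inverse t * (of_nat k * (C * t ^ k))) (inverse t * (t * poly (pderiv f) c))"
        by simp
      moreover have "inverse t * (of_nat k * (C * t ^ k)) = of_nat k * C * t ^ (k - 1)"
        using t k by (cases k) (auto simp: field_simps)
      moreover have "inverse t * (t * poly (pderiv f) c) = poly (pderiv f) c"
        using t by simp
      ultimately show ?case unfolding t_def by (simp only:)
    qed
    have pf: "pderiv f \<noteq> 0"
    proof
      assume "pderiv f = 0"
      with l' have "eventually (\<lambda>c. False) (near K b)"
        unfolding leading_def by (simp add: veq_def)
      thus False using near_not_bot by (simp add: trivial_limit_def)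
    qed
    have "degree (pderiv f) < degree f"
      using degree_pderiv_le[of f] k C by linarith
    hence "poly (pderiv f) b \<noteq> 0 \<and> leading (pderiv f) (poly (pderiv f) b) 0"
      using less.hyps[of "pderiv f"] f poly_over_pderiv[OF K] pf by auto
    hence "k = 1" using leading_unique[OF l', of "poly (pderiv f) b" 0] C k k_unit by simp
    hence l1: "leading f C 1" using l by simp
    \<comment> \<open>Since \<open>f\<close> has exactly one close root, each division by
      \<open>f\<close> removes exactly one close root of \<open>g\<close>.\<close>
    have count: "degree f * j \<le> degree g" if "poly_over K g" "g \<noteq> 0" "leading g D j" "D \<noteq> 0" for g D j
      using that
    proof (induction "degree g" arbitrary: g D j rule: less_induct)
      case (less g)
      show ?case
      proof (cases "j = 0")
        case False
        obtain q s where qs: "poly_over K q" "poly_over K s" "g = q * f + s" "s = 0 \<or> degree s < degree f"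
          using poly_over_division[OF K f(1,2) less.prems(1)] by blast
        have s: "poly s b \<noteq> 0 \<and> leading s (poly s b) 0" if "s \<noteq> 0"
          using IH[of s] qs that f by auto
        have q: "q \<noteq> 0"
        proof
          assume "q = 0"
          hence gs: "g = s" using qs(3) by simp
          hence "leading g (poly s b) 0" "poly s b \<noteq> 0" using s less.prems(2) by auto
          thus False using leading_unique[OF less.prems(3) _ less.prems(4)] False by blast
        qed
        obtain D' j' where D': "D' \<noteq> 0" "leading q D' j'" using leading_exists[OF q] by blast
        have l2: "leading (q * f) (D' * C) (Suc j')" using leading_mult[OF D'(2) l1] by simp
        have "j = Suc j'"
        proof (cases "s = 0")
          case True
          thus ?thesis using leading_unique[OF less.prems(3) _ less.prems(4), of "D' * C"] l2 D' C qs by simp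
        next
          case sn: False
          show ?thesis
            using leading_add[OF less.prems(3) l2 _ qs(3) less.prems(4), of "poly s b"] s[OF sn] D' C False
            by simp
        qed
        have "degree (q * f) = degree q + degree f" using q f by (simp add: degree_mult_eq)
        hence deg: "degree g = degree q + degree f"
          using qs(3,4) by (auto simp: degree_add_eq_left)
        hence "degree f * j' \<le> degree q"
          using less.hyps[OF _ qs(1) q D'(2,1)] C k by auto
        thus ?thesis using deg \<open>j = Suc j'\<close> by simp
      qed simp
    qed
    have "CHAR('a) > 0" using prime_char prime_gt_0_nat by blast
    moreover have "h \<noteq> 0" using h(2) calculation by auto
    ultimately have "degree f = 1"
      using count[OF h(1) _ h(3)] h(2) C k by auto
    then obtain a0 a1 where a: "f = [:a0, a1:]" "a1 \<noteq> 0" using degree1_coeffs by metis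
    have "a0 \<in> K" "a1 \<in> K" using f(1) unfolding a poly_over_def
      by (metis coeff_pCons_0, metis coeff_pCons_0 coeff_pCons_Suc)
    hence "- a0 / a1 \<in> K" by (intro subfield_closed[OF K])
    from leading_linear[OF this a(2)] have "leading f (a1 * (b - (- a0 / a1))) 0"
      using a by simp
    moreover have "b - (- a0 / a1) \<noteq> 0" using \<open>- a0 / a1 \<in> K\<close> b_notin
      by (metis right_minus_eq)
    ultimately show False using leading_unique[OF l1] C a by fastforce
  qed
qed

lemma near_low_degree:
  assumes "poly_over K f" "f \<noteq> 0" "degree f < CHAR('a)"
  shows "poly f b \<noteq> 0" "eventually (\<lambda>c. veq (poly f b) (poly f c)) (near K b)"
  using leading_low_degree[OF assms] leading_const by auto

lemma low_degree_approximable: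
  assumes "poly_over K f" "degree f < CHAR('a)" "poly f b \<noteq> 0"
  shows "\<exists>c\<in>K. veq (poly f b) c"
proof -
  have "f \<noteq> 0" using assms by auto
  with near_low_degree(2)[OF assms(1) _ assms(2)]
  obtain c where "c \<in> K" "veq (poly f b) (poly f c)" using near_happens by blast
  thus ?thesis using poly_over_poly[OF K assms(1)] by blast
qed

text \<open>A first-order Taylor expansion: v(f(b) - f(c)) = v(f'(b)) + v(b - c) for
  \<open>c\<close> near \<open>b\<close>, so \<gamma> is v(f'(b)). The two inequalities make v(f(b)
  - K) and \<gamma> + v(b - K) cofinal in each other, which is all that a distance depends
  on.\<close>

lemma low_degree_shift:
  assumes f: "poly_over K f" "degree f < CHAR('a)" "poly f b \<notin> K"
  shows "\<exists>\<gamma>\<in>value_group v K.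
    (\<forall>d\<in>K. \<exists>c\<in>K. v (poly f b - d) \<le> \<gamma> + v (b - c)) \<and>
    (\<forall>c\<in>K. \<exists>d\<in>K. \<gamma> + v (b - c) \<le> v (poly f b - d))"
proof -
  \<comment> \<open>\<open>G\<close> need not have coefficients in \<open>K\<close>, but its
    derivative f' has, so f'(c) has the leading term of f'(b) near \<open>b\<close>. Comparison with
    the leading term k C (c - b)^k of (c - b) G'(c) gives k = 1.\<close>
  define G where "G = f - [:poly f b:]"
  have deg: "degree f \<noteq> 0"
  proof
    assume "degree f = 0"
    then obtain a where "f = [:a:]" by (metis degree_0_id)
    thus False using f by (auto simp: poly_over_def split: nat.splits dest: spec[of _ 0])
  qed
  have G0: "G \<noteq> 0"
  proof
    assume "G = 0"
    hence "f = [:poly f b:]" by (simp add: G_def)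
    thus False using deg degree_pCons_0 by metis
  qed
  have degG: "degree G = degree f" using deg unfolding G_def
    by (metis degree_add_eq_left degree_minus degree_pCons_0 diff_conv_add_uminus gr0I)
  have pdG: "pderiv G = pderiv f" by (simp add: G_def pderiv_diff pderiv_pCons)
  obtain C k where C: "C \<noteq> 0" "k \<le> degree G" and l: "leading G C k"
    and k0: "k = 0 \<longrightarrow> C = poly G b"
    and der: "eventually (\<lambda>c. vgt (v (C * (c - b) ^ k))
        ((c - b) * poly (pderiv G) c - of_nat k * (C * (c - b) ^ k))) (near K b)"
    using leading_exists[OF G0] by blast
  have "k \<noteq> 0" using k0 C by (auto simp: G_def)
  hence "\<not> CHAR('a) dvd k" using f(2) C degG by (auto dest: dvd_imp_le)
  note k_unit = of_nat_unit[OF prime_char this]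
  define D where "D = poly (pderiv f) b"
  have tf: "eventually (\<lambda>c. veq (of_nat k * C * (c - b) ^ k) ((c - b) * poly (pderiv f) c)) (near K b)"
    using der near_ne
  proof eventually_elim
    case (elim c)
    have Y: "C * (c - b) ^ k \<noteq> 0" using C elim by simp
    hence "v (of_nat k * (C * (c - b) ^ k)) = v (C * (c - b) ^ k)" using v_mult k_unit by simp
    hence "veq (of_nat k * (C * (c - b) ^ k)) ((c - b) * poly (pderiv f) c)"
      using elim Y k_unit by (intro veqI) (auto simp: vgt_diff_commute pdG)
    thus ?case by (simp add: mult.assoc)
  qed
  have pf: "pderiv f \<noteq> 0"
  proof
    assume "pderiv f = 0"
    with tf have "eventually (\<lambda>c. False) (near K b)" by (simp add: veq_def)
    thus False using near_not_bot by (simp add: trivial_limit_def)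
  qed
  have pd: "D \<noteq> 0" "eventually (\<lambda>c. veq D (poly (pderiv f) c)) (near K b)"
    using near_low_degree[OF poly_over_pderiv[OF K f(1)] pf] degree_pderiv_le[of f] f(2)
    unfolding D_def by auto
  have Dv: "v D \<in> value_group v K"
  proof -
    obtain c where "c \<in> K" "veq D (poly (pderiv f) c)" using near_happens[OF pd(2)] by blast
    moreover have "poly (pderiv f) c \<in> K - {0}"
      using calculation poly_over_poly[OF K poly_over_pderiv[OF K f(1)]] by (auto simp: veq_def)
    ultimately show ?thesis unfolding value_group_def using veq_v imageI[of _ "K - {0}" v] by metis
  qed
  have "k = 1"
  proof (rule ccontr)
    assume "k \<noteq> 1"
    from near_v_ne[OF _ pd(1) this, of "of_nat k * C"] tf pd(2) near_ne C k_unit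
    have "eventually (\<lambda>c. v (of_nat k * C * (c - b) ^ k) \<noteq> v (D * (c - b) ^ 1)) (near K b)" by simp
    with tf pd(2) near_ne have "eventually (\<lambda>c. False) (near K b)"
    proof eventually_elim
      case (elim c)
      have "veq ((c - b) * D) ((c - b) * poly (pderiv f) c)"
        using elim by (intro veq_mult veq_refl) auto
      thus False using elim veq_v by (metis mult.commute power_one_right)
    qed
    thus False using near_not_bot by (simp add: trivial_limit_def)
  qed
  have main: "eventually (\<lambda>c. v (poly f b - poly f c) = v D + v (b - c)) (near K b)"
    using tf l[unfolded leading_def] pd(2) near_ne
  proof eventually_elim
    case (elim c)
    have "v (poly f b - poly f c) = v (C * (c - b) ^ k)"
      using veq_v[OF elim(2)] by (simp add: G_def v_diff_commute)
    also have "\<dots> = v (of_nat k * C * (c - b) ^ k)"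
      using v_mult[of "of_nat k" "C * (c - b) ^ k"] k_unit C elim(4) by (simp add: mult.assoc)
    also have "\<dots> = v ((c - b) * poly (pderiv f) c)" using veq_v[OF elim(1)] .
    also have "\<dots> = v (c - b) + v D" using veq_v[OF elim(3)] elim(3,4) by (simp add: v_mult veq_def)
    finally show ?case by (simp add: v_diff_commute add.commute)
  qed
  show ?thesis
  proof (intro bexI[OF _ Dv] conjI ballI)
    \<comment> \<open>f - d is again a polynomial of low degree, so f(c) - d has the leading term of
      f(b) - d for \<open>c\<close> near \<open>b\<close>. Hence f(c) is strictly closer to f(b)
      than d is.\<close>
    fix d assume d: "d \<in> K"
    have fd: "poly_over K (f - [:d:])" "f - [:d:] \<noteq> 0" "degree (f - [:d:]) < CHAR('a)"
      using f d deg by (auto intro!: poly_over_diff[OF K] poly_over_const[OF K] degree_diff_less)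
    obtain c where c: "c \<in> K" "v (poly f b - poly f c) = v D + v (b - c)"
      "veq (poly f b - d) (poly f c - d)"
      using near_happens[OF eventually_conj[OF main near_low_degree(2)[OF fd]]] by auto
    have "poly f b - poly f c \<noteq> 0" using poly_over_poly[OF K f(1) c(1)] f(3) by auto
    hence "v (poly f b - d) < v (poly f b - poly f c)"
      using c(3) by (auto simp: veq_def vgt_def)
    thus "\<exists>c\<in>K. v (poly f b - d) \<le> v D + v (b - c)"
      using c(1,2) by (intro bexI[of _ c]) auto
  next
    fix c0 assume c0: "c0 \<in> K"
    obtain c where c: "c \<in> K" "v (poly f b - poly f c) = v D + v (b - c)" "v (b - c0) < v (c - b)"
      using near_happens[OF eventually_conj[OF main near_better[OF c0]]] by auto
    thus "\<exists>d\<in>K. v D + v (b - c0) \<le> v (poly f b - d)"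
      using poly_over_poly[OF K f(1) c(1)] by (auto intro!: bexI[of _ "poly f c"] simp: v_diff_commute)
  qed
qed

end

section \<open>Immediate extensions and distances\<close>

context valued_field
begin

text \<open>Immediacy as approximation of leading terms; for subfields this is equivalent to equal
  value groups and residue fields. It makes sense before \<open>E\<close> is known to be a field,
  and it composes along towers.\<close>

definition immediate_over :: "'a set \<Rightarrow> 'a set \<Rightarrow> bool" where
  "immediate_over K E \<longleftrightarrow> K \<subseteq> E \<and> (\<forall>z\<in>E - {0}. \<exists>c\<in>K. veq z c)"

lemma immediate_over_refl: "immediate_over K K"
  by (auto simp: immediate_over_def intro: veq_refl)

lemma immediate_over_trans: "immediate_over K E \<Longrightarrow> immediate_over E F \<Longrightarrow> immediate_over K F"
  unfolding immediate_over_def by (metis Diff_iff insert_iff empty_iff subset_trans veq_def veq_trans)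

lemma immediate_over_mono:
  "immediate_over K F \<Longrightarrow> K \<subseteq> K' \<Longrightarrow> K' \<subseteq> E \<Longrightarrow> E \<subseteq> F \<Longrightarrow> immediate_over K' E"
  unfolding immediate_over_def by (metis Diff_iff subset_iff)

lemma value_group_immediate:
  assumes "immediate_over K E" shows "value_group v E = value_group v K"
proof
  show "value_group v K \<subseteq> value_group v E"
    using assms by (auto simp: immediate_over_def value_group_def)
  show "value_group v E \<subseteq> value_group v K"
  proof
    fix g assume "g \<in> value_group v E"
    then obtain z where "z \<in> E - {0}" "g = v z" by (auto simp: value_group_def)
    then obtain c where "c \<in> K" "veq z c" "g = v z" using assms by (auto simp: immediate_over_def)
    thus "g \<in> value_group v K" using veq_v by (auto simp: value_group_def veq_def)
  qed
qed

text \<open>If \<open>d\<close> in \<open>K\<close> has the leading term of b - c, then c + d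
  approximates \<open>b\<close> strictly better than \<open>c\<close>.\<close>

lemma pseudo_limit_immediate:
  assumes "is_subfield K" "is_subfield E" "immediate_over K E" "b \<in> E" "b \<notin> K"
  shows "pseudo_limit K b"
  unfolding pseudo_limit_def
proof (intro conjI ballI assms(1,5))
  fix c assume c: "c \<in> K"
  hence "b - c \<in> E - {0}"
    using assms subfield_diff[OF assms(2)] by (auto simp: immediate_over_def)
  then obtain d where d: "d \<in> K" "veq (b - c) d"
    using assms(3) unfolding immediate_over_def by blast
  have "c + d \<in> K" using c d by (intro subfield_closed[OF assms(1)])
  moreover have "b - c - d \<noteq> 0" using assms(5) \<open>c + d \<in> K\<close> by (auto simp: diff_diff_eq)
  hence "v (b - c) < v (b - (c + d))" using d by (auto simp: veq_def vgt_def diff_diff_eq)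
  ultimately show "\<exists>c'\<in>K. v (b - c) < v (b - c')" by blast
qed

text \<open>If \<open>c'\<close> is closer to \<open>b\<close> than \<open>c\<close>, then b - c has
  the leading term of c' - c, which lies in \<open>K\<close>.\<close>

lemma pseudo_limit_value:
  assumes "pseudo_limit K b" "c \<in> K" shows "\<exists>d\<in>K. d \<noteq> 0 \<and> v (b - c) = v d"
proof -
  obtain c' where c': "c' \<in> K" "v (b - c) < v (b - c')"
    using assms by (auto simp: pseudo_limit_def)
  have "b - c \<noteq> 0" using assms by (auto simp: pseudo_limit_def)
  hence "veq (b - c) (c' - c)" using c' by (intro veqI) (auto simp: vgt_def)
  thus ?thesis using assms c' subfield_diff[of K c' c] veq_v
    by (auto simp: pseudo_limit_def veq_def intro!: bexI[of _ "c' - c"])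
qed

lemma pseudo_limit_value_group:
  assumes "pseudo_limit K b" "c \<in> K" shows "v (b - c) \<in> value_group v K"
  using pseudo_limit_value[OF assms] unfolding value_group_def by (auto intro: image_eqI)

lemma value_group_closed:
  assumes "is_subfield K"
  shows "0 \<in> value_group v K"
    and "x \<in> value_group v K \<Longrightarrow> y \<in> value_group v K \<Longrightarrow> x + y \<in> value_group v K"
    and "x \<in> value_group v K \<Longrightarrow> - x \<in> value_group v K"
    and "x \<in> value_group v K \<Longrightarrow> y \<in> value_group v K \<Longrightarrow> x - y \<in> value_group v K"
proof -
  show "0 \<in> value_group v K" unfolding value_group_def
    using subfield_one[OF assms] by (intro image_eqI[of _ _ 1]) auto
  show add: "x + y \<in> value_group v K" if xy: "x \<in> value_group v K" "y \<in> value_group v K" for x y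
  proof -
    obtain a c where "a \<in> K - {0}" "c \<in> K - {0}" "x = v a" "y = v c"
      using xy by (auto simp: value_group_def)
    thus ?thesis unfolding value_group_def
      by (intro image_eqI[of _ _ "a * c"]) (auto simp: v_mult subfield_mult[OF assms])
  qed
  show neg: "- x \<in> value_group v K" if x: "x \<in> value_group v K" for x
  proof -
    obtain a where "a \<in> K - {0}" "x = v a" using x by (auto simp: value_group_def)
    thus ?thesis unfolding value_group_def
      by (intro image_eqI[of _ _ "inverse a"]) (auto simp: v_inverse subfield_inverse[OF assms])
  qed
  show "x - y \<in> value_group v K" if "x \<in> value_group v K" "y \<in> value_group v K"
    using add[OF that(1) neg[OF that(2)]] by simp
qed

lemma value_group_subset_divisible_hull: "value_group v K \<subseteq> divisible_hull (value_group v K)"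
  unfolding divisible_hull_def by (auto intro!: exI[of _ 1])

lemma divisible_hull_add:
  assumes K: "is_subfield K" and "\<alpha> \<in> value_group v K" "\<gamma> \<in> divisible_hull (value_group v K)"
  shows "\<alpha> + \<gamma> \<in> divisible_hull (value_group v K)"
proof -
  obtain n where n: "n > 0" "(\<Sum>i<n::nat. \<gamma>) \<in> value_group v K"
    using assms(3) by (auto simp: divisible_hull_def)
  have "(\<Sum>i<n. \<alpha>) \<in> value_group v K"
    by (induction n) (auto intro: value_group_closed[OF K] assms(2))
  hence "(\<Sum>i<n. \<alpha> + \<gamma>) \<in> value_group v K"
    using n(2) by (simp only: sum.distrib value_group_closed[OF K])
  thus ?thesis using n(1) unfolding divisible_hull_def by auto
qed

lemma distance_eq:
  assumes "pseudo_limit K b"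
  shows "distance v K b =
    {\<gamma> \<in> divisible_hull (value_group v K). \<exists>c\<in>K. \<gamma> \<le> v (b - c)}"
  using assms pseudo_limit_value_group[OF assms] value_group_subset_divisible_hull[of K]
  unfolding distance_def pseudo_limit_def by (auto 0 4)

text \<open>Two fields occur because the lemma has two uses: with E = K it turns the Taylor
  expansion into an equality of distances modulo the value group, and with b = z and \<gamma> = 0 it
  compares the distances of one element over two fields.\<close>

lemma distance_eq_mod_shift:
  assumes z: "pseudo_limit K z" and b: "pseudo_limit E b" and G: "value_group v E = value_group v K"
    and \<gamma>: "\<gamma> \<in> value_group v K"
    and 1: "\<forall>d\<in>K. \<exists>c\<in>E. v (z - d) \<le> \<gamma> + v (b - c)"
    and 2: "\<forall>c\<in>E. \<exists>d\<in>K. \<gamma> + v (b - c) \<le> v (z - d)"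
  shows "(distance v E b, distance v K z) \<in> distance_eq_mod (value_group v K)"
proof -
  have K: "is_subfield K" using z by (simp add: pseudo_limit_def)
  let ?H = "divisible_hull (value_group v K)"
  have "distance v K z = (\<lambda>x. \<gamma> + x) ` distance v E b"
    unfolding distance_eq[OF z] distance_eq[OF b] G
  proof (intro equalityI subsetI)
    fix x assume "x \<in> {x \<in> ?H. \<exists>d\<in>K. x \<le> v (z - d)}"
    then obtain d where d: "x \<in> ?H" "d \<in> K" "x \<le> v (z - d)" by auto
    obtain c where c: "c \<in> E" "v (z - d) \<le> \<gamma> + v (b - c)" using 1 d by auto
    have "x \<le> \<gamma> + v (b - c)" using d(3) c(2) by simp
    hence "- \<gamma> + x \<le> v (b - c)" by (simp add: algebra_simps)
    moreover have "- \<gamma> + x \<in> ?H"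
      by (intro divisible_hull_add[OF K] value_group_closed[OF K] \<gamma> d)
    ultimately show "x \<in> (\<lambda>x. \<gamma> + x) ` {x \<in> ?H. \<exists>c\<in>E. x \<le> v (b - c)}"
      using c(1) by (intro image_eqI[of _ _ "- \<gamma> + x"]) auto
  next
    fix x assume "x \<in> (\<lambda>x. \<gamma> + x) ` {x \<in> ?H. \<exists>c\<in>E. x \<le> v (b - c)}"
    then obtain y c where y: "x = \<gamma> + y" "y \<in> ?H" "c \<in> E" "y \<le> v (b - c)" by auto
    obtain d where d: "d \<in> K" "\<gamma> + v (b - c) \<le> v (z - d)" using 2 y by auto
    have "\<gamma> + y \<le> \<gamma> + v (b - c)" using y by simp
    hence "x \<le> v (z - d)" using d(2) y(1) by (metis order_trans)
    thus "x \<in> {x \<in> ?H. \<exists>d\<in>K. x \<le> v (z - d)}"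
      using d y divisible_hull_add[OF K \<gamma> y(2)] by auto
  qed
  thus ?thesis using \<gamma> by (auto simp: distance_eq_mod_def)
qed

lemma distance_eq_mod_refl:
  assumes "is_subfield K" shows "(D, D) \<in> distance_eq_mod (value_group v K)"
proof -
  have "D = (\<lambda>\<gamma>. 0 + \<gamma>) ` D" by simp
  thus ?thesis unfolding distance_eq_mod_def using value_group_closed(1)[OF assms] by blast
qed

lemma closer_value:
  assumes "pseudo_limit K b" "c \<in> K" "vgt (v (b - c)) (y - b)" shows "v (y - c) = v (b - c)"
proof -
  have "b - c \<noteq> 0" using assms(1,2) by (auto simp: pseudo_limit_def)
  moreover have "vgt (v (b - c)) ((y - c) - (b - c))" using assms(3) by (simp only: diff_diff_eq2 diff_add_cancel)
  ultimately show ?thesis by (rule v_of_eq_add)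
qed

text \<open>Replacing \<open>b\<close> by \<open>y\<close> changes none of the values v(b - c),
  because y - b has a larger value than every b - c.\<close>

lemma closer_pseudo_limit:
  assumes b: "pseudo_limit K b" and y: "\<forall>c\<in>K. vgt (v (b - c)) (y - b)"
  shows "pseudo_limit K y" "distance v K y = distance v K b"
proof -
  have eq: "v (y - c) = v (b - c)" if "c \<in> K" for c using closer_value[OF b that] y that by blast
  have "y \<notin> K"
  proof
    assume yK: "y \<in> K"
    hence "vgt (v (b - y)) (y - b)" using y by simp
    hence "y = b" by (simp add: vgt_def v_diff_commute)
    thus False using yK b by (simp add: pseudo_limit_def)
  qed
  thus *: "pseudo_limit K y" using b eq by (auto simp: pseudo_limit_def)
  show "distance v K y = distance v K b"
    unfolding distance_eq[OF *] distance_eq[OF b] using eq by auto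
qed

end

section \<open>Adjoining elements\<close>

text \<open>This is the ring E[b]. It is shown to be a field when b^p lies in \<open>E\<close>, and
  when \<open>b\<close> is an element outside the bottom field of an extension of prime
  degree.\<close>

definition adjoin :: "'a::field set \<Rightarrow> 'a \<Rightarrow> 'a set" where
  "adjoin E b = {poly f b | f. poly_over E f}"

lemma adjoin_ring:
  assumes "is_subfield E"
  shows "E \<subseteq> adjoin E b" "b \<in> adjoin E b"
    "x \<in> adjoin E b \<Longrightarrow> y \<in> adjoin E b \<Longrightarrow> x - y \<in> adjoin E b"
    "x \<in> adjoin E b \<Longrightarrow> y \<in> adjoin E b \<Longrightarrow> x * y \<in> adjoin E b"
proof -
  show "E \<subseteq> adjoin E b"
    using poly_over_const[OF assms] unfolding adjoin_def by (force intro: exI[of _ "[:_:]"])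
  have "poly_over E [:0, 1:]"
    by (intro poly_over_pCons[OF assms] poly_over_0[OF assms] subfield_closed[OF assms])
  thus "b \<in> adjoin E b" unfolding adjoin_def by (force intro: exI[of _ "[:0, 1:]"])
  show "x - y \<in> adjoin E b" if "x \<in> adjoin E b" "y \<in> adjoin E b"
    using that poly_over_diff[OF assms] unfolding adjoin_def by (auto, metis poly_diff)
  show "x * y \<in> adjoin E b" if "x \<in> adjoin E b" "y \<in> adjoin E b"
    using that poly_over_mult[OF assms] unfolding adjoin_def by (auto, metis poly_mult)
qed

lemma adjoin_minimal:
  assumes "is_subfield N" "E \<subseteq> N" "b \<in> N" shows "adjoin E b \<subseteq> N"
  using poly_over_poly[OF assms(1) _ assms(3)] assms(2) unfolding adjoin_def
  by (auto simp: poly_over_def subset_iff)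

text \<open>The Frobenius map sends \<open>E(b)\<close> into \<open>E\<close>, so \<open>1/z = z\<^sup>p\<^sup>-\<^sup>1/z\<^sup>p\<close>.\<close>

lemma frobenius_adjoin:
  fixes E :: "'a::field set"
  assumes E: "is_subfield E" and p: "prime CHAR('a)" and b: "b ^ CHAR('a) \<in> E"
    and z: "z \<in> adjoin E b"
  shows "z ^ CHAR('a) \<in> E"
proof -
  obtain f where f: "poly_over E f" "z = poly f b" using z by (auto simp: adjoin_def)
  have "poly f b ^ CHAR('a) = (\<Sum>i\<le>degree f. (coeff f i * b ^ i) ^ CHAR('a))"
    unfolding poly_altdef by (rule freshmans_dream_sum[OF p]) simp
  also have "\<dots> = (\<Sum>i\<le>degree f. coeff f i ^ CHAR('a) * (b ^ CHAR('a)) ^ i)"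
    by (simp add: power_mult_distrib power_mult[symmetric] mult.commute)
  also have "\<dots> \<in> E"
    using f b by (auto simp: poly_over_def intro!: subfield_sum[OF E] subfield_closed[OF E])
  finally show ?thesis using f by simp
qed

lemma is_subfield_adjoin:
  fixes E :: "'a::field set"
  assumes E: "is_subfield E" and p: "prime CHAR('a)" and b: "b ^ CHAR('a) \<in> E"
  shows "is_subfield (adjoin E b)"
proof -
  note r = adjoin_ring[OF E, where b = b]
  have pow: "z ^ n \<in> adjoin E b" if "z \<in> adjoin E b" for z n
    using that r subfield_one[OF E] by (induction n) auto
  have "inverse z \<in> adjoin E b" if z: "z \<in> adjoin E b" for z
  proof (cases "z = 0")
    case False
    have "CHAR('a) > 0" using p prime_gt_0_nat by blast
    hence "inverse z = z ^ (CHAR('a) - 1) * inverse (z ^ CHAR('a))"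
      using False by (cases "CHAR('a)") (auto simp: field_simps)
    moreover have "inverse (z ^ CHAR('a)) \<in> adjoin E b"
      using frobenius_adjoin[OF E p b z] subfield_inverse[OF E] r(1) by blast
    ultimately show ?thesis using pow[OF z] r(4) by metis
  qed (use that in auto)
  thus ?thesis using r subfield_zero[OF E] subfield_one[OF E] unfolding is_subfield_def by blast
qed

lemma adjoin_degree_less:
  assumes E: "is_subfield E" and h: "poly_over E h" "0 < degree h" "poly h b = 0"
    and z: "z \<in> adjoin E b"
  shows "\<exists>f. poly_over E f \<and> degree f < degree h \<and> z = poly f b"
proof -
  obtain g where g: "poly_over E g" "z = poly g b" using z by (auto simp: adjoin_def)
  have "h \<noteq> 0" using h by auto
  then obtain q s where "poly_over E s" "g = q * h + s" "s = 0 \<or> degree s < degree h"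
    using poly_over_division[OF E h(1) _ g(1)] by blast
  thus ?thesis using g h by (intro exI[of _ s]) auto
qed

section \<open>Powers of one element as a basis\<close>

definition powers :: "'a::field \<Rightarrow> nat \<Rightarrow> 'a list" where
  "powers b n = map (\<lambda>i. b ^ i) [0..<n]"

lemma length_powers [simp]: "length (powers b n) = n"
  by (simp add: powers_def)

lemma combine_powers:
  fixes b :: "'a::field"
  shows "ring.combine ring_of_type_algebra Ks (powers b n) = poly (Poly (take n Ks)) b"
proof -
  interpret field "ring_of_type_algebra :: 'a ring" by (rule field_from_type_algebra)
  \<comment> \<open>The exponents start at an arbitrary \<open>j\<close> so that the induction
    applies to the tail of the list. \<open>take n\<close> appears because \<open>combine\<close>
    stops at the end of the shorter list.\<close>
  have "combine Ks (map (\<lambda>i. b ^ (j + i)) [0..<n]) = b ^ j * poly (Poly (take n Ks)) b" for j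
  proof (induction Ks arbitrary: j n)
    case (Cons k Ks)
    show ?case
    proof (cases n)
      case (Suc m)
      have "map (\<lambda>i. b ^ (j + i)) [0..<n] = b ^ j # map (\<lambda>i. b ^ (Suc j + i)) [0..<m]"
        unfolding Suc by (subst upt_conv_Cons) (simp_all add: map_Suc_upt[symmetric] del: upt_Suc)
      thus ?thesis using Cons.IH[of "Suc j" m] by (simp add: Suc algebra_simps)
    qed simp
  qed simp
  from this[of 0] show ?thesis by (simp add: powers_def)
qed

lemma poly_over_Poly: "is_subfield K \<Longrightarrow> set Ks \<subseteq> K \<Longrightarrow> poly_over K (Poly Ks)"
  by (auto simp: poly_over_def nth_default_def subfield_zero)

lemma independent_powers_iff:
  fixes b :: "'a::field"
  assumes K: "is_subfield K"
  shows "ring.independent ring_of_type_algebra K (powers b n) \<longleftrightarrow>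
    (\<forall>f. poly_over K f \<and> f \<noteq> 0 \<and> (degree f < n) \<longrightarrow> poly f b \<noteq> 0)"
proof -
  interpret field "ring_of_type_algebra :: 'a ring" by (rule field_from_type_algebra)
  have sub: "subfield K ring_of_type_algebra" using K by (simp add: subfield_iff_is_subfield)
  show ?thesis
  proof (intro iffI allI impI)
    fix f assume ind: "independent K (powers b n)" and f: "poly_over K f \<and> f \<noteq> 0 \<and> degree f < n"
    show "poly f b \<noteq> 0"
    proof
      assume "poly f b = 0"
      moreover have "take n (coeffs f) = coeffs f" using f by (simp add: length_coeffs_degree)
      ultimately have "combine (coeffs f) (powers b n) = 0" by (simp add: combine_powers)
      moreover have "set (coeffs f) \<subseteq> K" using f by (auto simp: coeffs_def poly_over_def)
      moreover have "lead_coeff f \<in> set (coeffs f)" "lead_coeff f \<noteq> 0"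
        using f by (auto simp: coeffs_def)
      ultimately show False
        using non_trivial_combine_imp_dependent[OF sub, of "coeffs f" "powers b n"] ind
          \<open>take n (coeffs f) = coeffs f\<close> by auto
    qed
  next
    assume *: "\<forall>f. poly_over K f \<and> f \<noteq> 0 \<and> degree f < n \<longrightarrow> poly f b \<noteq> 0"
    show "independent K (powers b n)"
    proof (rule trivial_combine_imp_independent[OF sub])
      fix Ks assume Ks: "set Ks \<subseteq> K" "combine Ks (powers b n) = \<zero>\<^bsub>ring_of_type_algebra\<^esub>"
      let ?f = "Poly (take n Ks)"
      have "poly ?f b = 0" using Ks by (simp add: combine_powers)
      moreover have "poly_over K ?f" using Ks by (intro poly_over_Poly[OF K]) (auto dest: in_set_takeD)
      moreover have "degree ?f < n \<or> ?f = 0"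
      proof (cases "?f = 0")
        case False
        hence "degree ?f < length (coeffs ?f)" by (simp add: length_coeffs_degree del: coeffs_Poly)
        also have "\<dots> \<le> n" unfolding coeffs_Poly by (rule order_trans[OF length_strip_while_le]) simp
        finally show ?thesis by simp
      qed simp
      ultimately have "?f = 0" using * by blast
      hence "coeffs ?f = []" by simp
      hence "strip_while ((=) 0) (take n Ks) = []" by (simp only: coeffs_Poly)
      thus "set (take (length (powers b n)) Ks) \<subseteq> {\<zero>\<^bsub>ring_of_type_algebra\<^esub>}"
        by (auto simp: strip_while_eq_Nil)
    qed simp
  qed
qed

lemma Span_powers:
  fixes b :: "'a::field"
  assumes K: "is_subfield K" and n: "0 < n"
  shows "ring.Span ring_of_type_algebra K (powers b n) =
    {poly f b | f. poly_over K f \<and> degree f < n}"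
proof -
  interpret field "ring_of_type_algebra :: 'a ring" by (rule field_from_type_algebra)
  have sub: "subfield K ring_of_type_algebra" using K by (simp add: subfield_iff_is_subfield)
  have eq: "Span K (powers b n) = {combine Ks (powers b n) |Ks. length Ks = n \<and> set Ks \<subseteq> K}"
    using Span_eq_combine_set_length_version[OF sub, of "powers b n"] by simp
  show ?thesis unfolding eq
  proof (intro equalityI subsetI)
    fix x assume "x \<in> {combine Ks (powers b n) |Ks. length Ks = n \<and> set Ks \<subseteq> K}"
    then obtain Ks where Ks: "length Ks = n" "set Ks \<subseteq> K" "x = combine Ks (powers b n)" by auto
    have "length (coeffs (Poly Ks)) \<le> n"
      unfolding coeffs_Poly using length_strip_while_le[of _ Ks] Ks by simp
    hence "degree (Poly Ks) < n" using n by (cases "Poly Ks = 0") (simp_all add: length_coeffs_degree del: coeffs_Poly)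
    thus "x \<in> {poly f b | f. poly_over K f \<and> degree f < n}"
      using Ks poly_over_Poly[OF K Ks(2)] by (auto simp: combine_powers)
  next
    fix x assume "x \<in> {poly f b | f. poly_over K f \<and> degree f < n}"
    then obtain f where f: "poly_over K f" "degree f < n" "x = poly f b" by auto
    define Ks where "Ks = map (Polynomial.coeff f) [0..<n]"
    have "Poly Ks = f"
      unfolding Ks_def using f(2) by (intro poly_eqI) (auto simp: nth_default_def coeff_eq_0)
    hence "x = combine Ks (powers b n)" using f by (simp add: combine_powers Ks_def)
    moreover have "set Ks \<subseteq> K" using f by (auto simp: Ks_def poly_over_def)
    ultimately show "x \<in> {combine Ks (powers b n) |Ks. length Ks = n \<and> set Ks \<subseteq> K}"
      by (intro CollectI exI[of _ Ks]) (simp add: Ks_def)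
  qed
qed

section \<open>Purely inseparable extensions\<close>

lemma freshmans_dream_diff:
  fixes x y :: "'a::comm_ring_1"
  assumes "prime CHAR('a)" shows "(x - y) ^ CHAR('a) = x ^ CHAR('a) - y ^ CHAR('a)"
  using freshmans_dream[OF assms refl, of "x - y" y] by (simp add: algebra_simps)

context valued_field
begin

lemma distance_eq_mod_sym:
  assumes "is_subfield K" "(D, D') \<in> distance_eq_mod (value_group v K)"
  shows "(D', D) \<in> distance_eq_mod (value_group v K)"
proof -
  obtain \<alpha> where \<alpha>: "\<alpha> \<in> value_group v K" "D' = (\<lambda>\<gamma>. \<alpha> + \<gamma>) ` D"
    using assms(2) by (auto simp: distance_eq_mod_def)
  have "D = (\<lambda>\<gamma>. - \<alpha> + \<gamma>) ` D'" by (simp add: \<alpha>(2) image_image)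
  thus ?thesis using value_group_closed(3)[OF assms(1) \<alpha>(1)] unfolding distance_eq_mod_def by blast
qed

lemma distance_eq_mod_trans:
  assumes "is_subfield K" "(D, D') \<in> distance_eq_mod (value_group v K)"
    "(D', D'') \<in> distance_eq_mod (value_group v K)"
  shows "(D, D'') \<in> distance_eq_mod (value_group v K)"
proof -
  obtain \<alpha> \<beta> where *: "\<alpha> \<in> value_group v K" "D' = (\<lambda>\<gamma>. \<alpha> + \<gamma>) ` D"
    "\<beta> \<in> value_group v K" "D'' = (\<lambda>\<gamma>. \<beta> + \<gamma>) ` D'"
    using assms(2,3) by (auto simp: distance_eq_mod_def)
  have "D'' = (\<lambda>\<gamma>. (\<beta> + \<alpha>) + \<gamma>) ` D" by (simp add: * image_image add.assoc)
  thus ?thesis using value_group_closed(2)[OF assms(1) *(3,1)] unfolding distance_eq_mod_def by blast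
qed

text \<open>\<open>D\<close> meets every class of distances that occurs and may contain more, so its
  cardinality bounds the number of classes.\<close>

definition distances_in :: "'a set \<Rightarrow> 'a set \<Rightarrow> 'g set set \<Rightarrow> bool" where
  "distances_in K F D \<longleftrightarrow>
     (\<forall>z\<in>F - K. \<exists>d\<in>D. (d, distance v K z) \<in> distance_eq_mod (value_group v K))"

text \<open>If no member of \<open>E\<close> is closer to \<open>b\<close> than all of
  \<open>K\<close>, then v(b - K) is cofinal in v(b - E), and so v(b - E) has no maximum
  either.\<close>

lemma no_closer_pseudo_limit:
  assumes b: "pseudo_limit K b" and E: "is_subfield E" "K \<subseteq> E"
    and nc: "\<not> (\<exists>y\<in>E. \<forall>c\<in>K. vgt (v (b - c)) (y - b))"
  shows "pseudo_limit E b" "\<forall>y\<in>E. \<exists>c\<in>K. v (b - y) \<le> v (b - c)"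
proof -
  show 1: "\<forall>y\<in>E. \<exists>c\<in>K. v (b - y) \<le> v (b - c)"
  proof
    fix y assume "y \<in> E"
    then obtain c where "c \<in> K" "\<not> vgt (v (b - c)) (y - b)" using nc by blast
    thus "\<exists>c\<in>K. v (b - y) \<le> v (b - c)"
      unfolding vgt_def v_diff_commute[of y] by (auto simp: not_less)
  qed
  have "b \<notin> E" using nc by (metis diff_self vgt_0)
  thus "pseudo_limit E b"
    unfolding pseudo_limit_def
  proof (intro conjI ballI E(1))
    fix y assume "y \<in> E"
    then obtain c where c: "c \<in> K" "v (b - y) \<le> v (b - c)" using 1 by blast
    then obtain c' where "c' \<in> K" "v (b - c) < v (b - c')" using b by (auto simp: pseudo_limit_def)
    thus "\<exists>c'\<in>E. v (b - y) < v (b - c')" using c E(2) by (meson le_less_trans subsetD)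
  qed
qed

end

locale valued_alg_closed_field = valued_field v
  for v :: "'a::alg_closed_field \<Rightarrow> 'g::linordered_ab_group_add" +
  assumes prime_char: "prime CHAR('a)"
begin

lemma char_pos: "0 < CHAR('a)"
  using prime_char prime_gt_0_nat by blast

text \<open>In characteristic p the polynomial X^p - b^p is (X - b)^p, so its value at
  \<open>c\<close> is exactly (c - b)^p.\<close>

lemma tight_insep:
  assumes b: "pseudo_limit E b" and "b ^ CHAR('a) \<in> E"
  shows "tight_approximation v E b (monom 1 CHAR('a) - [:b ^ CHAR('a):])"
proof -
  interpret approximation v E b
    by (intro approximation.intro approximation_axioms.intro b) (fact valued_field_axioms)
  have eq: "poly (monom 1 CHAR('a) - [:b ^ CHAR('a):]) c = (c - b) ^ CHAR('a)" for c
    by (simp add: poly_monom freshmans_dream_diff[OF prime_char])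
  show ?thesis
  proof (unfold_locales, rule prime_char)
    show "poly_over E (monom 1 CHAR('a) - [:b ^ CHAR('a):])"
      by (intro poly_over_diff[OF K] poly_over_monom[OF K] poly_over_const[OF K]
          subfield_closed[OF K] assms)
    have "degree ([:b ^ CHAR('a):]) < degree (monom (1 :: 'a) CHAR('a))"
      using char_pos by (simp add: degree_monom_eq)
    thus "degree (monom 1 CHAR('a) - [:b ^ CHAR('a):]) = CHAR('a)"
      unfolding diff_conv_add_uminus by (subst degree_add_eq_left) (simp_all add: degree_monom_eq)
    show "leading (monom 1 CHAR('a) - [:b ^ CHAR('a):]) 1 CHAR('a)"
      unfolding leading_def eq using near_ne by eventually_elim (simp add: veq_refl)
  qed
qed

text \<open>Reduction modulo \<open>h\<close> writes every element of E[b] as f(b) with deg f < p,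
  to which the low-degree results apply. As no nonzero \<open>f\<close> of this kind vanishes at
  \<open>b\<close>, the powers 1, b, ..., b^(p-1) form a basis.\<close>

lemma tight_adjoin:
  assumes "tight_approximation v E b h" "poly h b = 0"
  shows "immediate_over E (adjoin E b)"
    and "z \<in> adjoin E b \<Longrightarrow> z \<notin> E \<Longrightarrow>
      (distance v E b, distance v E z) \<in> distance_eq_mod (value_group v E)"
    and "ring.dimension ring_of_type_algebra CHAR('a) E (adjoin E b)"
proof -
  interpret tight_approximation v E b h by fact
  have low: "\<exists>f. poly_over E f \<and> degree f < CHAR('a) \<and> z = poly f b" if "z \<in> adjoin E b" for z
    using adjoin_degree_less[OF K h(1) _ assms(2) that] h(2) char_pos by simp
  show imm: "immediate_over E (adjoin E b)"
    unfolding immediate_over_def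
  proof (intro conjI ballI adjoin_ring(1)[OF K])
    fix z assume z: "z \<in> adjoin E b - {0}"
    then obtain f where "poly_over E f" "degree f < CHAR('a)" "z = poly f b" using low by blast
    thus "\<exists>c\<in>E. veq z c" using low_degree_approximable z by blast
  qed
  show "(distance v E b, distance v E z) \<in> distance_eq_mod (value_group v E)"
    if z: "z \<in> adjoin E b" "z \<notin> E" for z
  proof -
    obtain f where f: "poly_over E f" "degree f < CHAR('a)" "z = poly f b" using low z by blast
    obtain \<gamma> where \<gamma>: "\<gamma>\<in>value_group v E"
      "\<forall>d\<in>E. \<exists>c\<in>E. v (z - d) \<le> \<gamma> + v (b - c)" "\<forall>c\<in>E. \<exists>d\<in>E. \<gamma> + v (b - c) \<le> v (z - d)"
      using low_degree_shift[OF f(1,2)] z(2) unfolding f(3)[symmetric] by blast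
    have "pseudo_limit E z"
      unfolding pseudo_limit_def
    proof (intro conjI ballI K z)
      fix d assume d: "d \<in> E"
      then obtain c where c: "c \<in> E" "v (z - d) \<le> \<gamma> + v (b - c)" using \<gamma> by blast
      obtain c' where c': "c' \<in> E" "v (b - c) < v (b - c')" using better c by blast
      obtain d' where d': "d' \<in> E" "\<gamma> + v (b - c') \<le> v (z - d')" using \<gamma> c' by blast
      have "\<gamma> + v (b - c) < \<gamma> + v (b - c')" using c' by simp
      thus "\<exists>d'\<in>E. v (z - d) < v (z - d')"
        using c(2) d' by (meson le_less_trans less_le_trans)
    qed
    thus ?thesis by (rule distance_eq_mod_shift[OF _ pseudo_limit refl \<gamma>])
  qed
  show "ring.dimension ring_of_type_algebra CHAR('a) E (adjoin E b)"
  proof -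
    interpret R: field "ring_of_type_algebra :: 'a ring" by (rule field_from_type_algebra)
    have "R.independent E (powers b CHAR('a))"
      unfolding independent_powers_iff[OF K] using near_low_degree(1) by blast
    moreover have "R.Span E (powers b CHAR('a)) = adjoin E b"
      unfolding Span_powers[OF K char_pos] using low by (auto simp: adjoin_def)
    ultimately show ?thesis using R.dimension_independent[of E "powers b CHAR('a)"] by simp
  qed
qed

lemma insep_adjoin:
  assumes "pseudo_limit E b" "b ^ CHAR('a) \<in> E"
  shows "immediate_over E (adjoin E b)"
    and "z \<in> adjoin E b \<Longrightarrow> z \<notin> E \<Longrightarrow>
      (distance v E b, distance v E z) \<in> distance_eq_mod (value_group v E)"
    and "ring.dimension ring_of_type_algebra CHAR('a) E (adjoin E b)"
  using tight_adjoin[OF tight_insep[OF assms]] by (simp_all add: poly_monom)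

text \<open>The new representative is the distance of \<open>b\<close> over \<open>E\<close>, not
  over \<open>K\<close>. It is a cut in the same divisible hull because the two fields have the same
  value group.\<close>

lemma distances_in_adjoin:
  assumes K: "is_subfield K" and E: "is_subfield E" "K \<subseteq> E" and b: "b \<notin> E" "b ^ CHAR('a) \<in> E"
    and imm: "immediate_over K (adjoin E b)" and D: "distances_in K E D"
  shows "distances_in K (adjoin E b) (insert (distance v E b) D)"
  unfolding distances_in_def
proof
  fix z assume z: "z \<in> adjoin E b - K"
  note sub = is_subfield_adjoin[OF E(1) prime_char b(2)] and r = adjoin_ring[OF E(1), where b = b]
  have immE: "immediate_over K E" "immediate_over E (adjoin E b)"
    using immediate_over_mono[OF imm] E(2) r(1) by auto
  have plz: "pseudo_limit K z" using pseudo_limit_immediate[OF K sub imm] z by auto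
  show "\<exists>d\<in>insert (distance v E b) D. (d, distance v K z) \<in> distance_eq_mod (value_group v K)"
  proof (cases "\<exists>y\<in>E. \<forall>c\<in>K. vgt (v (z - c)) (y - z)")
    case True
    then obtain y where y: "y \<in> E" "\<forall>c\<in>K. vgt (v (z - c)) (y - z)" by blast
    have "y \<in> E - K" "distance v K y = distance v K z"
      using closer_pseudo_limit[OF plz y(2)] y(1) by (auto simp: pseudo_limit_def)
    thus ?thesis using D unfolding distances_in_def by (metis insert_iff)
  next
    case False
    note n = no_closer_pseudo_limit[OF plz E False]
    have G: "value_group v E = value_group v K" by (rule value_group_immediate[OF immE(1)])
    have "(distance v E z, distance v K z) \<in> distance_eq_mod (value_group v K)"
      by (rule distance_eq_mod_shift[OF plz n(1) G value_group_closed(1)[OF K]]) (use n E in auto)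
    moreover have "(distance v E b, distance v E z) \<in> distance_eq_mod (value_group v K)"
      using insep_adjoin(2)[OF pseudo_limit_immediate[OF E(1) sub immE(2) r(2) b(1)] b(2), of z] z n(1)
      unfolding G by (auto simp: pseudo_limit_def)
    ultimately show ?thesis using distance_eq_mod_trans[OF K] by blast
  qed
qed

text \<open>A tower of maximal length n inside \<open>N\<close> is chosen; a basis of its top over
  \<open>K\<close> is independent in \<open>N\<close>, so p^n \<le> p^m bounds the length. One more
  immediate adjunction would give a longer tower.\<close>

lemma insep_chain:
  assumes K: "is_subfield K" and N: "is_subfield N" "K \<subseteq> N" "\<forall>x\<in>N. x ^ CHAR('a) \<in> K"
    and dim: "ring.dimension ring_of_type_algebra (CHAR('a) ^ m) K N"
  shows "\<exists>E D. is_subfield E \<and> K \<subseteq> E \<and> E \<subseteq> N \<and> immediate_over K E \<and> finite D \<and> card D \<le> m \<and>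
    distances_in K E D \<and> (\<forall>b\<in>N - E. \<not> immediate_over K (adjoin E b))"
proof -
  interpret R: field "ring_of_type_algebra :: 'a ring" by (rule field_from_type_algebra)
  define P where "P n E D \<longleftrightarrow> is_subfield E \<and> K \<subseteq> E \<and> E \<subseteq> N \<and> immediate_over K E \<and>
    R.dimension (CHAR('a) ^ n) K E \<and> finite D \<and> card D \<le> n \<and> distances_in K E D" for n E D
  have subK: "subfield K ring_of_type_algebra" using K by (simp add: subfield_iff_is_subfield)
  have P0: "P 0 K {}"
    using R.dimension_one[OF subK] K N(2)
    by (auto simp: P_def immediate_over_refl distances_in_def)
  have bound: "n \<le> m" if "P n E D" for n E D
  proof -
    obtain Us where Us: "R.independent K Us" "length Us = CHAR('a) ^ n" "R.Span K Us = E"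
      "set Us \<subseteq> UNIV"
      using R.exists_base[OF subK] \<open>P n E D\<close> unfolding P_def by (metis top_greatest)
    have "set Us \<subseteq> E" using R.Span_base_incl[OF subK, of Us] Us by simp
    hence "CHAR('a) ^ n \<le> CHAR('a) ^ m"
      using R.independent_length_le_dimension[OF subK dim Us(1)] Us(2) \<open>P n E D\<close> unfolding P_def by auto
    thus ?thesis using prime_gt_1_nat[OF prime_char] by simp
  qed
  have "\<exists>n. (\<exists>E D. P n E D) \<and> (\<forall>k. (\<exists>E D. P k E D) \<longrightarrow> k \<le> n)"
    using P0 bound by (intro ex_has_greatest_nat[of _ 0 "\<lambda>n. n" "Suc m"]) (auto simp: less_Suc_eq_le)
  then obtain n E D where P: "P n E D" and max: "\<And>k E D. P k E D \<Longrightarrow> k \<le> n" by blast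
  have "\<not> immediate_over K (adjoin E b)" if b: "b \<in> N - E" for b
  proof
    assume imm: "immediate_over K (adjoin E b)"
    have E: "is_subfield E" "K \<subseteq> E" "E \<subseteq> N" using P by (auto simp: P_def)
    have bp: "b ^ CHAR('a) \<in> E" using N(3) b E by auto
    note sub = is_subfield_adjoin[OF E(1) prime_char bp] and r = adjoin_ring[OF E(1), where b = b]
    have "immediate_over E (adjoin E b)" using immediate_over_mono[OF imm] E(2) r(1) by auto
    hence plb: "pseudo_limit E b" using pseudo_limit_immediate[OF E(1) sub _ r(2)] b by auto
    have "R.dimension (CHAR('a) ^ n * CHAR('a)) K (adjoin E b)"
      by (rule R.telescopic_base[OF subK _ _ insep_adjoin(3)[OF plb bp]])
        (use P E in \<open>auto simp: P_def subfield_iff_is_subfield\<close>)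
    hence "P (Suc n) (adjoin E b) (insert (distance v E b) D)"
      using sub E r(1) adjoin_minimal[OF N(1) E(3)] b imm P distances_in_adjoin[OF K E(1,2) _ bp imm]
      unfolding P_def by (auto simp: mult.commute card_insert_if)
    thus False using max by fastforce
  qed
  thus ?thesis using P bound[OF P] unfolding P_def by (meson le_trans)
qed

text \<open>If no member of \<open>E\<close> were closer to \<open>b\<close> than all of
  \<open>K\<close>, then v(b - E) would have no maximum and E(b) would be immediate over
  \<open>E\<close>, hence over \<open>K\<close>, against maximality. So some member of
  \<open>E\<close> has the distance of \<open>b\<close>.\<close>

lemma insep_distance:
  assumes K: "is_subfield K" and E: "is_subfield E" "K \<subseteq> E" "immediate_over K E"
    and D: "distances_in K E D"
    and max: "\<And>b. b ^ CHAR('a) \<in> K \<Longrightarrow> b \<notin> E \<Longrightarrow> \<not> immediate_over K (adjoin E b)"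
    and b: "pseudo_limit K b" "b ^ CHAR('a) \<in> K"
  shows "\<exists>d\<in>D. (d, distance v K b) \<in> distance_eq_mod (value_group v K)"
proof (cases "\<exists>y\<in>E. \<forall>c\<in>K. vgt (v (b - c)) (y - b)")
  case True
  then obtain y where y: "y \<in> E" "\<forall>c\<in>K. vgt (v (b - c)) (y - b)" by blast
  have "y \<in> E - K" "distance v K y = distance v K b"
    using closer_pseudo_limit[OF b(1) y(2)] y(1) by (auto simp: pseudo_limit_def)
  thus ?thesis using D unfolding distances_in_def by metis
next
  case False
  note n = no_closer_pseudo_limit[OF b(1) E(1,2) False]
  have "immediate_over E (adjoin E b)" using insep_adjoin(1)[OF n(1)] b(2) E(2) by auto
  hence "immediate_over K (adjoin E b)" by (rule immediate_over_trans[OF E(3)])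
  thus ?thesis using max[OF b(2)] n(1) by (auto simp: pseudo_limit_def)
qed

end

section \<open>Artin--Schreier extensions\<close>

context valued_alg_closed_field
begin

lemma v_artin_schreier:
  assumes "x \<noteq> 0" "v x < 0" shows "veq (x ^ CHAR('a)) (x ^ CHAR('a) - x)"
proof (rule veqI)
  have "v (x ^ (CHAR('a) - 1)) < v (1 ^ (CHAR('a) - 1))"
    using assms prime_gt_1_nat[OF prime_char] by (intro v_power_mono_strict) auto
  moreover have "x ^ CHAR('a) = x * x ^ (CHAR('a) - 1)"
    using char_pos by (cases "CHAR('a)") auto
  ultimately show "vgt (v (x ^ CHAR('a))) (x ^ CHAR('a) - (x ^ CHAR('a) - x))"
    using assms by (simp add: vgt_def v_mult)
qed (use assms in simp)

text \<open>With t = c - \<theta>, the polynomial takes the value t^p - t at \<open>c\<close>, where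
  t^p dominates because v t < 0. In terms of roots: they are \<theta> + i with i in the prime field,
  and integers have value at least 0, above every v(\<theta> - c).\<close>

lemma tight_artin_schreier:
  assumes \<theta>: "pseudo_limit K \<theta>" and d: "\<theta> ^ CHAR('a) - \<theta> \<in> K" and neg: "\<forall>c\<in>K. v (\<theta> - c) < 0"
  shows "tight_approximation v K \<theta> (monom 1 CHAR('a) - [:\<theta> ^ CHAR('a) - \<theta>, 1:])"
proof -
  interpret approximation v K \<theta>
    by (intro approximation.intro approximation_axioms.intro \<theta>) (fact valued_field_axioms)
  have eq: "poly (monom 1 CHAR('a) - [:\<theta> ^ CHAR('a) - \<theta>, 1:]) c = (c - \<theta>) ^ CHAR('a) - (c - \<theta>)" for c
    by (simp add: poly_monom freshmans_dream_diff[OF prime_char])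
  show ?thesis
  proof (unfold_locales, rule prime_char)
    show "poly_over K (monom 1 CHAR('a) - [:\<theta> ^ CHAR('a) - \<theta>, 1:])"
      by (intro poly_over_diff[OF K] poly_over_monom[OF K] poly_over_pCons[OF K] poly_over_0[OF K]
          subfield_one[OF K] d)
    have "degree [:\<theta> ^ CHAR('a) - \<theta>, 1:] < degree (monom (1 :: 'a) CHAR('a))"
      using prime_gt_1_nat[OF prime_char] by (simp add: degree_monom_eq)
    thus "degree (monom 1 CHAR('a) - [:\<theta> ^ CHAR('a) - \<theta>, 1:]) = CHAR('a)"
      unfolding diff_conv_add_uminus by (subst degree_add_eq_left) (simp_all add: degree_monom_eq)
    show "leading (monom 1 CHAR('a) - [:\<theta> ^ CHAR('a) - \<theta>, 1:]) 1 CHAR('a)"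
      unfolding leading_def eq using near_ne near_mem
    proof eventually_elim
      case (elim c)
      have "v (c - \<theta>) < 0" using neg elim(2) v_diff_commute[of c] by simp
      from v_artin_schreier[OF elim(1) this] show ?case by simp
    qed
  qed
qed

text \<open>The dependent case is the one in which \<open>p v(\<theta> - K)\<close> is bounded by an element of \<open>v(\<theta> - K)\<close>.
  Then \<open>\<eta> - c\<close> is a \<open>p\<close>-th root of \<open>(\<theta> - c)\<^sup>p - (\<theta> - c)\<close> for a suitable \<open>c\<close>, and
  \<open>(\<theta> - \<eta>)\<^sup>p = \<theta> - c\<close> shows that \<open>\<eta>\<close> is closer to \<open>\<theta>\<close> than \<open>K\<close> is.\<close>

lemma artin_schreier_distance_cases:
  assumes \<theta>: "pseudo_limit K \<theta>" and d: "\<theta> ^ CHAR('a) - \<theta> \<in> K" and neg: "\<forall>c\<in>K. v (\<theta> - c) < 0"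
  obtains (dependent) \<eta> where "pseudo_limit K \<eta>" "\<eta> ^ CHAR('a) \<in> K" "distance v K \<eta> = distance v K \<theta>"
  | (independent) H where "convex_subgroup (value_group v K) H" "H \<noteq> value_group v K"
      "distance v K \<theta> = {\<gamma> \<in> divisible_hull (value_group v K).
         \<exists>\<delta>\<in>value_group v K. (\<forall>h\<in>H. \<delta> < h) \<and> \<gamma> \<le> \<delta>}"
proof -
  have K: "is_subfield K" using \<theta> by (simp add: pseudo_limit_def)
  have ne: "\<theta> - c \<noteq> 0" if "c \<in> K" for c using \<theta> that by (auto simp: pseudo_limit_def)
  let ?G = "value_group v K"
  show thesis
  proof (cases "\<exists>c\<in>K. \<forall>c'\<in>K. v ((\<theta> - c') ^ CHAR('a)) < v (\<theta> - c)")
    case True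
    then obtain c where c: "c \<in> K" "\<And>c'. c' \<in> K \<Longrightarrow> v ((\<theta> - c') ^ CHAR('a)) < v (\<theta> - c)" by blast
    obtain \<xi> where \<xi>: "\<xi> ^ CHAR('a) = (\<theta> - c) ^ CHAR('a) - (\<theta> - c)"
      using nth_root_exists[OF char_pos] by blast
    define \<eta> where "\<eta> = \<xi> + c"
    have eq: "\<theta> - \<eta> = (\<theta> - c) - \<xi>" by (simp add: \<eta>_def)
    have "(\<theta> - \<eta>) ^ CHAR('a) = (\<theta> - c) ^ CHAR('a) - \<xi> ^ CHAR('a)"
      unfolding eq by (rule freshmans_dream_diff[OF prime_char])
    also have "\<dots> = \<theta> - c" unfolding \<xi> by simp
    finally have pow: "(\<theta> - \<eta>) ^ CHAR('a) = \<theta> - c" .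
    have "\<forall>c'\<in>K. vgt (v (\<theta> - c')) (\<eta> - \<theta>)"
    proof
      fix c' assume c': "c' \<in> K"
      show "vgt (v (\<theta> - c')) (\<eta> - \<theta>)"
        unfolding vgt_diff_commute[of _ \<eta>] vgt_def
        using c(2)[OF c'] v_power_less_iff[OF ne[OF c'] _ char_pos, of "\<theta> - \<eta>"] pow v_diff_commute[of \<theta> \<eta>]
        by auto
    qed
    note cl = closer_pseudo_limit[OF \<theta> this]
    have "\<eta> ^ CHAR('a) = (\<theta> ^ CHAR('a) - \<theta>) + c"
      using \<xi> freshmans_dream[OF prime_char refl, of \<xi> c] freshmans_dream_diff[OF prime_char, of \<theta> c]
      by (simp add: \<eta>_def algebra_simps)
    hence "\<eta> ^ CHAR('a) \<in> K" using subfield_add[OF K d c(1)] by simp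
    thus thesis using dependent cl by blast
  next
    case False
    \<comment> \<open>Negating the dependent case gives v(\<theta> - c) \<le> p v(\<theta> - c') for
      some c'. The values are negative and p \<ge> 2, so p may be replaced by 2, which is what
      closure of \<open>H\<close> under differences requires.\<close>
    hence half: "\<exists>c'\<in>K. v (\<theta> - c) \<le> v (\<theta> - c') + v (\<theta> - c')" if c: "c \<in> K" for c
    proof -
      obtain c' where c': "c' \<in> K" "v (\<theta> - c) \<le> v ((\<theta> - c') ^ CHAR('a))"
        using False c by (auto simp: not_less)
      have "v ((\<theta> - c') ^ CHAR('a)) \<le> v ((\<theta> - c') ^ 2)"
      proof -
        have "(\<theta> - c') ^ CHAR('a) = (\<theta> - c') ^ 2 * (\<theta> - c') ^ (CHAR('a) - 2)"
          using prime_ge_2_nat[OF prime_char] by (metis le_add_diff_inverse power_add)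
        moreover have "v ((\<theta> - c') ^ n) \<le> 0" for n
        proof (cases "n = 0")
          case False
          thus ?thesis using v_power_mono_strict[of "\<theta> - c'" 1 n] ne neg c' by (simp add: less_imp_le)
        qed simp
        ultimately show ?thesis using ne[OF c'(1)] by (simp add: v_mult)
      qed
      thus ?thesis using c' ne[OF c'(1)] by (auto simp: power2_eq_square v_mult intro: order_trans)
    qed
    \<comment> \<open>v(\<theta> - K) consists of negative elements, and \<open>H\<close> is the
      gap, symmetric about 0, that it leaves.\<close>
    define H where "H = {g \<in> ?G. \<forall>c\<in>K. v (\<theta> - c) < g \<and> v (\<theta> - c) < - g}"
    have below: "v (\<theta> - c) < x - y" if c: "c \<in> K" and "x \<in> H" "y \<in> H" for c x y
    proof -
      obtain c' where c': "c' \<in> K" "v (\<theta> - c) \<le> v (\<theta> - c') + v (\<theta> - c')" using half c by blast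
      have "v (\<theta> - c') + v (\<theta> - c') < x + - y" using that c'(1) by (intro add_strict_mono) (auto simp: H_def)
      thus ?thesis using c'(2) by simp
    qed
    have conv: "convex_subgroup ?G H"
      unfolding convex_subgroup_def
    proof (intro conjI ballI impI)
      show "H \<subseteq> ?G" by (auto simp: H_def)
      show "0 \<in> H" using neg value_group_closed(1)[OF K] by (auto simp: H_def)
      show "x - y \<in> H" if "x \<in> H" "y \<in> H" for x y
        using below that value_group_closed(4)[OF K, of x y] by (auto simp: H_def minus_diff_eq)
      show "y \<in> H" if "x \<in> H" "z \<in> H" "y \<in> ?G" "x \<le> y \<and> y \<le> z" for x y z
      proof -
        have "v (\<theta> - c) < y \<and> v (\<theta> - c) < - y" if "c \<in> K" for c
        proof -
          have "v (\<theta> - c) < x" "v (\<theta> - c) < - z" using \<open>x \<in> H\<close> \<open>z \<in> H\<close> that by (auto simp: H_def)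
          moreover have "- z \<le> - y" using \<open>x \<le> y \<and> y \<le> z\<close> by simp
          ultimately show ?thesis using \<open>x \<le> y \<and> y \<le> z\<close> by (meson less_le_trans)
        qed
        thus ?thesis using that(3) by (auto simp: H_def)
      qed
    qed
    have "v (\<theta> - 0) \<in> ?G - H"
      using pseudo_limit_value_group[OF \<theta> subfield_zero[OF K]] subfield_zero[OF K]
      unfolding H_def by blast
    hence proper: "H \<noteq> ?G" by blast
    \<comment> \<open>v(\<theta> - K) is an initial segment of the value group: moving
      \<open>c\<close> by an element of value g < v(\<theta> - c) lowers the value to g.\<close>
    have init: "\<exists>c\<in>K. g = v (\<theta> - c)" if g: "g \<in> ?G" "c \<in> K" "g \<le> v (\<theta> - c)" for g c
    proof (cases "g = v (\<theta> - c)")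
      case False
      hence lt: "g < v (\<theta> - c)" using g by simp
      obtain e where e: "e \<in> K" "e \<noteq> 0" "g = v e" using g(1) by (auto simp: value_group_def)
      have "v (- e + (\<theta> - c)) = v (- e)" using lt e by (intro v_add_dominant) (auto simp: vgt_def)
      hence "g = v (\<theta> - (c + e))" using e by (simp add: algebra_simps)
      thus ?thesis using subfield_add[OF K g(2) e(1)] by blast
    qed (use g in blast)
    \<comment> \<open>Thus v(\<theta> - K) is the set of group elements below \<open>H\<close>, and
      the cut depends on \<open>H\<close> alone. For the converse: a negative g above all of
      v(\<theta> - K) lies in \<open>H\<close>, since -g is positive and so above it as
      well.\<close>
    have char: "(\<exists>c\<in>K. g = v (\<theta> - c)) \<longleftrightarrow> (\<forall>h\<in>H. g < h)" if g: "g \<in> ?G" for g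
    proof
      assume *: "\<forall>h\<in>H. g < h"
      show "\<exists>c\<in>K. g = v (\<theta> - c)"
      proof (rule ccontr)
        assume no: "\<not> ?thesis"
        have "v (\<theta> - c) < g" if "c \<in> K" for c using init[OF g that] no by (meson not_less)
        moreover have "g < 0" using * conv by (auto simp: convex_subgroup_def)
        ultimately have "g \<in> H" using g neg unfolding H_def
          by (auto, meson less_trans neg_0_less_iff_less)
        thus False using * by auto
      qed
    qed (auto simp: H_def)
    have "(\<exists>c\<in>K. \<gamma> \<le> v (\<theta> - c)) \<longleftrightarrow> (\<exists>\<delta>\<in>?G. (\<forall>h\<in>H. \<delta> < h) \<and> \<gamma> \<le> \<delta>)" for \<gamma>
    proof
      assume "\<exists>c\<in>K. \<gamma> \<le> v (\<theta> - c)"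
      then obtain c where c: "c \<in> K" "\<gamma> \<le> v (\<theta> - c)" by blast
      note G = pseudo_limit_value_group[OF \<theta> c(1)]
      show "\<exists>\<delta>\<in>?G. (\<forall>h\<in>H. \<delta> < h) \<and> \<gamma> \<le> \<delta>"
        by (rule bexI[OF _ G]) (use char[OF G] c in blast)
    next
      assume "\<exists>\<delta>\<in>?G. (\<forall>h\<in>H. \<delta> < h) \<and> \<gamma> \<le> \<delta>"
      then obtain \<delta> where \<delta>: "\<delta> \<in> ?G" "\<forall>h\<in>H. \<delta> < h" "\<gamma> \<le> \<delta>" by blast
      thus "\<exists>c\<in>K. \<gamma> \<le> v (\<theta> - c)" using char[OF \<delta>(1)] by metis
    qed
    hence "distance v K \<theta> = {\<gamma> \<in> divisible_hull ?G. \<exists>\<delta>\<in>?G. (\<forall>h\<in>H. \<delta> < h) \<and> \<gamma> \<le> \<delta>}"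
      unfolding distance_eq[OF \<theta>] by simp
    thus thesis by (rule independent[OF conv proper])
  qed
qed

end

section \<open>Extensions of prime degree\<close>

lemma adjoin_subset_adjoin:
  assumes K: "is_subfield K" and x: "x \<in> adjoin K a" shows "adjoin K x \<subseteq> adjoin K a"
proof
  fix y assume "y \<in> adjoin K x"
  then obtain f where f: "poly_over K f" "y = poly f x" by (auto simp: adjoin_def)
  have add: "s + t \<in> adjoin K a" if "s \<in> adjoin K a" "t \<in> adjoin K a" for s t
    using that poly_over_add[OF K] unfolding adjoin_def by (auto, metis poly_add)
  have "poly f x \<in> adjoin K a" using f(1)
  proof (induction f)
    case 0
    show ?case using adjoin_ring(1)[OF K] subfield_zero[OF K] by auto
  next
    case (pCons c f)
    have "c \<in> K" using pCons.prems by (auto simp: poly_over_def dest: spec[of _ 0])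
    moreover have "poly_over K f" using pCons.prems by (auto simp: poly_over_def coeff_pCons dest: spec[of _ "Suc _"])
    ultimately show ?case using pCons.IH adjoin_ring(1,4)[OF K, where b = a] x by (auto intro!: add)
  qed
  thus "y \<in> adjoin K a" using f by simp
qed

text \<open>The induction strips factors X until the constant term c is nonzero; then f = c + X g
  and f(x) = 0 give 1/x = -g(x)/c.\<close>

lemma algebraic_inverse:
  assumes K: "is_subfield K" and f: "poly_over K f" "f \<noteq> 0" "poly f x = 0" and x: "x \<noteq> 0"
  shows "inverse x \<in> adjoin K x"
  using f
proof (induction f)
  case (pCons c g)
  have c: "c \<in> K" using pCons.prems by (auto simp: poly_over_def dest: spec[of _ 0])
  have g: "poly_over K g" using pCons.prems by (auto simp: poly_over_def coeff_pCons dest: spec[of _ "Suc _"])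
  show ?case
  proof (cases "c = 0")
    case True
    thus ?thesis using pCons g x by auto
  next
    case False
    have "x * poly g x = - c" using pCons.prems(3) by (simp add: add_eq_0_iff2)
    hence "inverse x = poly (smult (- inverse c) g) x" using False x by (simp add: field_simps)
    moreover have "poly_over K (smult (- inverse c) g)"
      by (intro poly_over_smult[OF K] g subfield_closed[OF K] c)
    ultimately show ?thesis unfolding adjoin_def by blast
  qed
qed simp

section \<open>Minimal polynomials and conjugates\<close>

definition minimal_poly :: "'a::field set \<Rightarrow> 'a \<Rightarrow> 'a poly \<Rightarrow> bool" where
  "minimal_poly K a h \<longleftrightarrow> poly_over K h \<and> lead_coeff h = 1 \<and> poly h a = 0 \<and>
     (\<forall>f. poly_over K f \<and> f \<noteq> 0 \<and> poly f a = 0 \<longrightarrow> degree h \<le> degree f)"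

lemma minimal_poly_exists:
  assumes K: "is_subfield K" and f: "poly_over K f" "f \<noteq> 0" "poly f a = 0"
  shows "\<exists>h. minimal_poly K a h"
proof -
  define P where "P g \<longleftrightarrow> poly_over K g \<and> g \<noteq> 0 \<and> poly g a = 0" for g
  obtain g where g: "P g" "\<And>f. P f \<Longrightarrow> degree g \<le> degree f"
    using ex_has_least_nat[of P f degree] f unfolding P_def by blast
  let ?h = "smult (inverse (lead_coeff g)) g"
  have "poly_over K ?h"
    using g(1) unfolding P_def by (intro poly_over_smult[OF K] subfield_inverse[OF K]) (auto simp: poly_over_def)
  hence "minimal_poly K a ?h" using g unfolding minimal_poly_def P_def by auto
  thus ?thesis by blast
qed

text \<open>Quantifying over all polynomials that vanish at \<open>a\<close> makes the assignment of
  f(\<rho>) to f(a) well defined at once.\<close>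

definition conjugate :: "'a::field set \<Rightarrow> 'a \<Rightarrow> 'a \<Rightarrow> bool" where
  "conjugate K a \<rho> \<longleftrightarrow> (\<forall>f. poly_over K f \<and> poly f a = 0 \<longrightarrow> poly f \<rho> = 0)"

lemma minimal_poly_root_conjugate:
  assumes K: "is_subfield K" and h: "minimal_poly K a h" and \<rho>: "poly h \<rho> = 0"
  shows "conjugate K a \<rho>"
  unfolding conjugate_def
proof (intro allI impI)
  fix f assume f: "poly_over K f \<and> poly f a = 0"
  have hK: "poly_over K h" "h \<noteq> 0" "poly h a = 0" using h by (auto simp: minimal_poly_def)
  obtain q s where qs: "poly_over K s" "f = q * h + s" "s = 0 \<or> degree s < degree h"
    using poly_over_division[OF K hK(1,2)] f by blast
  have "poly s a = 0" using f qs(2) hK(3) by simp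
  hence "s = 0" using h qs(1,3) by (auto simp: minimal_poly_def not_le)
  thus "poly f \<rho> = 0" using qs(2) \<rho> by simp
qed

locale prime_degree_extension =
  fixes K L :: "'a::field set" and q :: nat
  assumes K: "is_subfield K" and L: "is_subfield L" and KL: "K \<subseteq> L" and prime_degree: "prime q"
    and dimension: "ring.dimension ring_of_type_algebra q K L"
begin

sublocale R: field "ring_of_type_algebra :: 'a ring" by (rule field_from_type_algebra)

lemma subfield_K: "subfield K ring_of_type_algebra"
  using K by (simp add: subfield_iff_is_subfield)

lemma powers_subset: "is_subfield M \<Longrightarrow> a \<in> M \<Longrightarrow> set (powers a n) \<subseteq> M"
  by (auto simp: powers_def subfield_power)

lemma algebraic:
  assumes "a \<in> L" shows "\<exists>f. poly_over K f \<and> f \<noteq> 0 \<and> poly f a = 0 \<and> degree f \<le> q"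
proof -
  have "\<not> R.independent K (powers a (Suc q))"
    using R.independent_length_le_dimension[OF subfield_K dimension, of "powers a (Suc q)"]
      powers_subset[OF L assms] by auto
  thus ?thesis unfolding independent_powers_iff[OF K] by (auto simp: less_Suc_eq_le)
qed

text \<open>The tower formula for \<open>K\<close>, K[a] and \<open>L\<close> gives n * m = q with n
  = deg h, and n = 1 would put \<open>a\<close> into \<open>K\<close>. As q is prime, n = q.\<close>

lemma minimal_poly_degree:
  assumes a: "a \<in> L" "a \<notin> K" and h: "minimal_poly K a h"
  shows "degree h = q" "adjoin K a = L"
proof -
  define n where "n = degree h"
  have hK: "poly_over K h" "h \<noteq> 0" "poly h a = 0" using h by (auto simp: minimal_poly_def)
  have n: "0 < n"
  proof (rule ccontr)
    assume "\<not> 0 < n"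
    then obtain c where c: "h = [:c:]" using degree_0_id[of h] unfolding n_def by (metis gr0I)
    show False using hK(2,3) unfolding c by simp
  qed
  have ind: "R.independent K (powers a n)"
    unfolding independent_powers_iff[OF K] using h by (auto simp: minimal_poly_def n_def not_le)
  have Span: "R.Span K (powers a n) = adjoin K a"
    unfolding Span_powers[OF K n] using adjoin_degree_less[OF K hK(1) _ hK(3)] n
    by (auto simp: adjoin_def n_def)
  have sub: "adjoin K a \<subseteq> L" by (rule adjoin_minimal[OF L KL a(1)])
  have M: "is_subfield (adjoin K a)"
  proof -
    have "inverse x \<in> adjoin K a" if x: "x \<in> adjoin K a" for x
    proof (cases "x = 0")
      case False
      obtain f where "poly_over K f" "f \<noteq> 0" "poly f x = 0" using algebraic[of x] x sub by blast
      thus ?thesis using algebraic_inverse[OF K _ _ _ False] adjoin_subset_adjoin[OF K x] by blast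
    qed (use x in simp)
    thus ?thesis using adjoin_ring[OF K, where b = a] subfield_zero[OF K] subfield_one[OF K]
      unfolding is_subfield_def by blast
  qed
  hence subM: "subfield (adjoin K a) ring_of_type_algebra" by (simp add: subfield_iff_is_subfield)
  have dimM: "R.dimension n K (adjoin K a)" using R.dimension_independent[OF ind] Span by simp
  obtain Us where Us: "R.independent K Us" "length Us = q" "R.Span K Us = L"
    using R.exists_base[OF subfield_K dimension] by blast
  have UsL: "set Us \<subseteq> L" using R.Span_base_incl[OF subfield_K, of Us] Us by simp
  \<comment> \<open>A basis of \<open>L\<close> over \<open>K\<close> still spans \<open>L\<close>
    over K[a], so \<open>L\<close> is finite dimensional over K[a], as the tower formula
    requires.\<close>
  have "R.Span (adjoin K a) Us = L"
  proof
    have "R.combine Ks Us \<in> L" if "set Ks \<subseteq> L" "set Us \<subseteq> L" for Ks Us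
      using that by (induction Ks Us rule: R.combine.induct) (auto intro: subfield_closed[OF L])
    thus "R.Span (adjoin K a) Us \<subseteq> L"
      using R.Span_mem_iff_length_version[OF subM, of Us] sub UsL by auto
    have carrier: "set Us \<subseteq> carrier ring_of_type_algebra" by simp
    show "L \<subseteq> R.Span (adjoin K a) Us"
    proof
      fix x assume "x \<in> L"
      then obtain Ks where "set Ks \<subseteq> K" "length Ks = length Us" "x = R.combine Ks Us"
        unfolding Us(3)[symmetric] R.Span_mem_iff_length_version[OF subfield_K carrier] by blast
      thus "x \<in> R.Span (adjoin K a) Us"
        unfolding R.Span_mem_iff_length_version[OF subM carrier] using adjoin_ring(1)[OF K, of a] by blast
    qed
  qed
  then obtain m where "R.dimension m (adjoin K a) L"
    using R.Span_finite_dimension[OF subM, of Us] by (auto simp: R.finite_dimension_def)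
  hence "R.dimension (n * m) K L" by (rule R.telescopic_base[OF subfield_K subM dimM])
  hence "n * m = q" by (rule R.dimension_is_inj[OF subfield_K _ dimension])
  moreover have "n \<noteq> 1"
  proof
    assume "n = 1"
    hence "degree h = 1" by (simp add: n_def)
    then obtain c d where cd: "h = [:c, d:]" "d \<noteq> 0" using degree1_coeffs by metis
    hence "d = 1" using h by (simp add: minimal_poly_def)
    hence "a = - c" using cd hK(3) by (simp add: eq_neg_iff_add_eq_0 add.commute)
    moreover have "c \<in> K" using hK(1) unfolding cd poly_over_def by (metis coeff_pCons_0)
    ultimately show False using a(2) subfield_minus[OF K] by blast
  qed
  ultimately have nq: "n = q" using prime_degree prime_nat_iff by (metis dvd_triv_left)
  thus "degree h = q" by (simp add: n_def)
  show "adjoin K a = L"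
    using R.independent_length_eq_dimension[OF subfield_K dimension ind] powers_subset[OF L a(1)] Span nq
    by simp
qed

lemma minimal_poly_ex:
  assumes "a \<in> L" shows "\<exists>h. minimal_poly K a h"
  using algebraic[OF assms] minimal_poly_exists[OF K] by blast

lemma conjugate_embedding:
  assumes a: "a \<in> L" "a \<notin> K" and \<rho>: "conjugate K a \<rho>"
  obtains \<sigma> where "\<sigma> a = \<rho>" "\<And>c. c \<in> K \<Longrightarrow> \<sigma> c = c"
    "\<And>x y. x \<in> L \<Longrightarrow> y \<in> L \<Longrightarrow> \<sigma> (x + y) = \<sigma> x + \<sigma> y"
    "\<And>x y. x \<in> L \<Longrightarrow> y \<in> L \<Longrightarrow> \<sigma> (x * y) = \<sigma> x * \<sigma> y"
    "\<sigma> ` L \<subseteq> adjoin K \<rho>"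
proof -
  obtain h where "minimal_poly K a h" using minimal_poly_ex[OF a(1)] by blast
  note gen = minimal_poly_degree(2)[OF a this]
  \<comment> \<open>\<open>F x\<close> is a chosen polynomial with value \<open>x\<close> at
    \<open>a\<close>; conjugacy makes its value at \<rho> independent of the choice.\<close>
  define F where "F x = (SOME f. poly_over K f \<and> poly f a = x)" for x
  have F: "poly_over K (F x)" "poly (F x) a = x" if "x \<in> L" for x
  proof -
    have "\<exists>f. poly_over K f \<and> poly f a = x" using that gen by (auto simp: adjoin_def)
    from someI_ex[OF this] show "poly_over K (F x)" "poly (F x) a = x" by (auto simp: F_def)
  qed
  define \<sigma> where "\<sigma> x = poly (F x) \<rho>" for x
  have \<sigma>: "\<sigma> (poly f a) = poly f \<rho>" if f: "poly_over K f" for f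
  proof -
    have fL: "poly f a \<in> L" using gen f by (auto simp: adjoin_def)
    have "poly (F (poly f a) - f) a = 0" using F(2)[OF fL] by simp
    hence "poly (F (poly f a) - f) \<rho> = 0"
      using \<rho> poly_over_diff[OF K F(1)[OF fL] f] unfolding conjugate_def by blast
    thus ?thesis by (simp add: \<sigma>_def)
  qed
  show thesis
  proof (rule that[of \<sigma>])
    show "\<sigma> a = \<rho>" using \<sigma>[of "[:0, 1:]"]
      by (simp add: poly_over_pCons[OF K] poly_over_0[OF K] subfield_zero[OF K] subfield_one[OF K])
    show "\<sigma> c = c" if "c \<in> K" for c using \<sigma>[of "[:c:]"] poly_over_const[OF K that] by simp
    show "\<sigma> (x + y) = \<sigma> x + \<sigma> y" if "x \<in> L" "y \<in> L" for x y
      using \<sigma>[of "F x + F y"] poly_over_add[OF K F(1)[OF that(1)] F(1)[OF that(2)]] F(2) that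
      by (simp add: \<sigma>_def)
    show "\<sigma> (x * y) = \<sigma> x * \<sigma> y" if "x \<in> L" "y \<in> L" for x y
      using \<sigma>[of "F x * F y"] poly_over_mult[OF K F(1)[OF that(1)] F(1)[OF that(2)]] F(2) that
      by (simp add: \<sigma>_def)
    show "\<sigma> ` L \<subseteq> adjoin K \<rho>" using F(1) by (auto simp: \<sigma>_def adjoin_def)
  qed
qed

end

text \<open>This is (1 + \<Delta>)^n for the difference operator \<Delta>, where 1 + \<Delta> is the
  shift and \<open>D k i\<close> is the k-th difference at i. For n = p only the terms j = 0 and j =
  p survive in characteristic p.\<close>

lemma newton_forward:
  fixes D :: "nat \<Rightarrow> nat \<Rightarrow> 'a::comm_ring_1"
  assumes D: "\<And>k i. D (Suc k) i = D k (Suc i) - D k i"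
  shows "D k (n + i) = (\<Sum>j\<le>n. of_nat (n choose j) * D (k + j) i)"
proof (induction n arbitrary: k)
  case (Suc n)
  have step: "D k (Suc i) = D (Suc k) i + D k i" for k i using D[of k i] by simp
  have "D k (Suc n + i) = D (Suc k) (n + i) + D k (n + i)" using step[of k "n + i"] by simp
  also have "\<dots> = (\<Sum>j\<le>n. of_nat (n choose j) * D (k + Suc j) i) + (\<Sum>j\<le>n. of_nat (n choose j) * D (k + j) i)"
    by (simp add: Suc.IH)
  also have "(\<Sum>j\<le>n. of_nat (n choose j) * D (k + j) i)
      = D k i + (\<Sum>j\<le>n. of_nat (n choose Suc j) * D (k + Suc j) i)"
  proof -
    have "(\<Sum>j\<le>n. of_nat (n choose j) * D (k + j) i) = (\<Sum>j\<le>Suc n. of_nat (n choose j) * D (k + j) i)"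
      by (simp add: binomial_eq_0)
    thus ?thesis by (simp only: sum.atMost_Suc_shift) simp
  qed
  also have "(\<Sum>j\<le>n. of_nat (n choose j) * D (k + Suc j) i) +
      (D k i + (\<Sum>j\<le>n. of_nat (n choose Suc j) * D (k + Suc j) i)) =
      D k i + (\<Sum>j\<le>n. of_nat (Suc n choose Suc j) * D (k + Suc j) i)"
    by (simp add: sum.distrib[symmetric] algebra_simps)
  also have "\<dots> = (\<Sum>j\<le>Suc n. of_nat (Suc n choose j) * D (k + j) i)"
    by (simp only: sum.atMost_Suc_shift) simp
  finally show ?case .
qed simp

lemma (in valued_field) vgt_sum_mset: "(\<And>x. x \<in># A \<Longrightarrow> vgt g (f x)) \<Longrightarrow> vgt g (\<Sum>x\<in>#A. f x)"
  by (induction A) (auto intro: vgt_add)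

lemma sum_mset_map_diff: "(\<Sum>y\<in>#A. y - (t::'a::comm_ring_1)) = (\<Sum>y\<in>#A. y) - of_nat (size A) * t"
  by (induction A) (auto simp: algebra_simps)

text \<open>The subleading coefficient is needed to see that the sum of the roots of a minimal
  polynomial lies in \<open>K\<close>.\<close>

lemma coeff_prod_linear_factors:
  fixes A :: "'a::comm_ring_1 multiset"
  shows "coeff (\<Prod>x\<in>#A. [:- x, 1:]) (size A) = 1"
    and "degree (\<Prod>x\<in>#A. [:- x, 1:]) \<le> size A"
    and "A \<noteq> {#} \<Longrightarrow> coeff (\<Prod>x\<in>#A. [:- x, 1:]) (size A - 1) = - (\<Sum>x\<in>#A. x)"
proof -
  have *: "coeff (\<Prod>x\<in>#A. [:- x, 1:]) (size A) = 1 \<and> degree (\<Prod>x\<in>#A. [:- x, 1:]) \<le> size A" for A :: "'a multiset"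
  proof (induction A)
    case (add x A)
    let ?Q = "\<Prod>x\<in>#A. [:- x, 1:]"
    have "degree ([:- x, 1:] * ?Q) \<le> degree [:- x, 1:] + degree ?Q" by (rule degree_mult_le)
    also have "\<dots> \<le> size (add_mset x A)" using add.IH by (simp add: degree_pCons_eq_if)
    finally show ?case using add.IH by (auto simp: coeff_eq_0)
  qed simp
  show "coeff (\<Prod>x\<in>#A. [:- x, 1:]) (size A) = 1"
    and "degree (\<Prod>x\<in>#A. [:- x, 1:]) \<le> size A" using * by auto
  show "A \<noteq> {#} \<Longrightarrow> coeff (\<Prod>x\<in>#A. [:- x, 1:]) (size A - 1) = - (\<Sum>x\<in>#A. x)"
  proof (induction A)
    case (add x A)
    show ?case
    proof (cases "A = {#}")
      case False
      then obtain n where "size A = Suc n" by (cases "size A") auto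
      thus ?thesis using add.IH[OF False] *[of A] by simp
    qed simp
  qed simp
qed

section \<open>Isometric embeddings of an immediate normal extension\<close>

locale immediate_normal_extension = valued_alg_closed_field v + prime_degree_extension K L q
  for v :: "'a::alg_closed_field \<Rightarrow> 'g::linordered_ab_group_add" and K L :: "'a set" and q :: nat +
  assumes immediate: "immediate_over K L"
    and unique_extension: "\<And>w x. valuation_on L (w :: 'a \<Rightarrow> 'g) \<Longrightarrow> (\<And>x. x \<in> K - {0} \<Longrightarrow> w x = v x) \<Longrightarrow>
      x \<in> L - {0} \<Longrightarrow> w x = v x"
    and normal: "\<And>a \<rho>. a \<in> L \<Longrightarrow> conjugate K a \<rho> \<Longrightarrow> \<rho> \<in> L"
begin

text \<open>A \<open>K\<close>-embedding of \<open>L\<close> into itself, given by a function on the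
  whole type of which only the values on \<open>L\<close> matter.\<close>

definition embedding :: "('a \<Rightarrow> 'a) \<Rightarrow> bool" where
  "embedding \<sigma> \<longleftrightarrow> (\<forall>c\<in>K. \<sigma> c = c) \<and> (\<forall>x\<in>L. \<sigma> x \<in> L) \<and>
     (\<forall>x\<in>L. \<forall>y\<in>L. \<sigma> (x + y) = \<sigma> x + \<sigma> y \<and> \<sigma> (x * y) = \<sigma> x * \<sigma> y)"

lemma embedding_exists:
  assumes "a \<in> L" "a \<notin> K" "conjugate K a \<rho>"
  shows "\<exists>\<sigma>. embedding \<sigma> \<and> \<sigma> a = \<rho>"
proof -
  obtain \<sigma> where \<sigma>: "\<sigma> a = \<rho>" "\<And>c. c \<in> K \<Longrightarrow> \<sigma> c = c"
    "\<And>x y. x \<in> L \<Longrightarrow> y \<in> L \<Longrightarrow> \<sigma> (x + y) = \<sigma> x + \<sigma> y"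
    "\<And>x y. x \<in> L \<Longrightarrow> y \<in> L \<Longrightarrow> \<sigma> (x * y) = \<sigma> x * \<sigma> y"
    "\<sigma> ` L \<subseteq> adjoin K \<rho>"
    using conjugate_embedding[OF assms] by metis
  moreover have "adjoin K \<rho> \<subseteq> L" by (rule adjoin_minimal[OF L KL normal[OF assms(1,3)]])
  ultimately show ?thesis unfolding embedding_def by blast
qed

context
  fixes \<sigma>
  assumes \<sigma>: "embedding \<sigma>"
begin

lemma embedding_base: "c \<in> K \<Longrightarrow> \<sigma> c = c" and embedding_mem: "x \<in> L \<Longrightarrow> \<sigma> x \<in> L"
  and embedding_add: "x \<in> L \<Longrightarrow> y \<in> L \<Longrightarrow> \<sigma> (x + y) = \<sigma> x + \<sigma> y"
  and embedding_mult: "x \<in> L \<Longrightarrow> y \<in> L \<Longrightarrow> \<sigma> (x * y) = \<sigma> x * \<sigma> y"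
  using \<sigma> by (auto simp: embedding_def)

lemma embedding_diff: "x \<in> L \<Longrightarrow> y \<in> L \<Longrightarrow> \<sigma> (x - y) = \<sigma> x - \<sigma> y"
  using embedding_add[of "x - y" y] subfield_diff[OF L, of x y] by (simp add: eq_diff_eq)

lemma embedding_power: "x \<in> L \<Longrightarrow> \<sigma> (x ^ n) = \<sigma> x ^ n"
  by (induction n) (auto simp: embedding_mult subfield_power[OF L] embedding_base subfield_one[OF K])

lemma embedding_poly: "poly_over K f \<Longrightarrow> x \<in> L \<Longrightarrow> \<sigma> (poly f x) = poly f (\<sigma> x)"
proof (induction f)
  case 0
  thus ?case by (simp add: embedding_base subfield_zero[OF K])
next
  case (pCons c f)
  have c: "c \<in> K" using pCons.prems by (auto simp: poly_over_def dest: spec[of _ 0])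
  have f: "poly_over K f" using pCons.prems by (auto simp: poly_over_def coeff_pCons dest: spec[of _ "Suc _"])
  have fL: "poly f x \<in> L" using f pCons.prems KL by (intro poly_over_poly[OF L]) (auto simp: poly_over_def)
  have "c \<in> L" "x * poly f x \<in> L" using c KL subfield_mult[OF L pCons.prems(2) fL] by auto
  thus ?case using c pCons.prems(2) pCons.IH[OF f pCons.prems(2)] fL
    by (simp add: embedding_add embedding_base embedding_mult)
qed

lemma embedding_nonzero: "x \<in> L - {0} \<Longrightarrow> \<sigma> x \<noteq> 0"
  using embedding_mult[of x "inverse x"] subfield_inverse[OF L, of x] embedding_base[OF subfield_one[OF K]]
  by auto

text \<open>\<open>v\<close> composed with \<sigma> is a valuation of \<open>L\<close> that extends
  \<open>v\<close> from \<open>K\<close>, so uniqueness of the extension makes \<sigma> an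
  isometry.\<close>

lemma embedding_valuation:
  assumes "x \<in> L - {0}" shows "v (\<sigma> x) = v x"
proof (rule unique_extension[of "\<lambda>x. v (\<sigma> x)", OF _ _ assms])
  show "valuation_on L (\<lambda>x. v (\<sigma> x))"
    unfolding valuation_on_def
  proof (intro conjI ballI impI)
    fix x y assume xy: "x \<in> L - {0}" "y \<in> L - {0}"
    note ne = embedding_nonzero[OF xy(1)] embedding_nonzero[OF xy(2)]
    show "v (\<sigma> (x * y)) = v (\<sigma> x) + v (\<sigma> y)" using xy ne by (simp add: embedding_mult v_mult)
    assume "x + y \<noteq> 0"
    hence "\<sigma> (x + y) \<noteq> 0" using xy subfield_add[OF L] by (intro embedding_nonzero) auto
    thus "min (v (\<sigma> x)) (v (\<sigma> y)) \<le> v (\<sigma> (x + y))" using xy ne v_add by (simp add: embedding_add)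
  qed
qed (simp add: embedding_base)

lemma embedding_vgt: "x \<in> L \<Longrightarrow> vgt g x \<Longrightarrow> vgt g (\<sigma> x)"
  using embedding_valuation[of x] embedding_base[OF subfield_zero[OF K]]
  by (cases "x = 0") (auto simp: vgt_def)

text \<open>An element outside \<open>K\<close> generates \<open>L\<close>, the degree being prime;
  if \<sigma> fixed it, \<sigma> would be the identity on \<open>L\<close>.\<close>

lemma embedding_fixed: "a \<in> L \<Longrightarrow> \<sigma> a \<noteq> a \<Longrightarrow> y \<in> L \<Longrightarrow> \<sigma> y = y \<Longrightarrow> y \<in> K"
proof (rule ccontr)
  assume *: "a \<in> L" "\<sigma> a \<noteq> a" "y \<in> L" "\<sigma> y = y" "y \<notin> K"
  obtain h where "minimal_poly K y h" using minimal_poly_ex[OF *(3)] by blast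
  hence "a \<in> adjoin K y" using minimal_poly_degree(2)[OF *(3,5)] *(1) by simp
  then obtain f where "poly_over K f" "a = poly f y" by (auto simp: adjoin_def)
  thus False using embedding_poly[of f y] * by simp
qed

end

text \<open>Let \<open>c\<close> in \<open>K\<close> have the leading term of \<open>x\<close>.
  Embeddings are isometries fixing \<open>c\<close>, so every conjugate has the leading term of
  \<open>c\<close> as well, and n of them add up to n c plus terms of larger value, with v n =
  0.\<close>

lemma conjugates_sum_nonzero:
  assumes x: "x \<in> L - {0}" and p: "\<not> CHAR('a) dvd size A"
    and A: "\<And>y. y \<in># A \<Longrightarrow> \<exists>\<sigma>. embedding \<sigma> \<and> y = \<sigma> x"
  shows "(\<Sum>y\<in>#A. y) \<noteq> 0"
proof
  assume 0: "(\<Sum>y\<in>#A. y) = 0"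
  obtain c where c: "c \<in> K" "veq x c" using immediate x by (auto simp: immediate_over_def)
  have vc: "v x = v c" and c0: "c \<noteq> 0" using veq_v[OF c(2)] c(2) by (auto simp: veq_def)
  have xc: "x - c \<in> L" "vgt (v c) (x - c)"
    using x c KL subfield_diff[OF L, of x c] vc by (auto simp: veq_def)
  have "vgt (v c) (y - c)" if y: "y \<in># A" for y
  proof -
    obtain \<sigma> where \<sigma>: "embedding \<sigma>" "y = \<sigma> x" using A[OF y] by blast
    have "c \<in> L" using c(1) KL by auto
    hence "\<sigma> (x - c) = y - c" using \<sigma> x c(1) by (simp add: embedding_diff embedding_base)
    thus ?thesis using embedding_vgt[OF \<sigma>(1) xc] by simp
  qed
  hence "vgt (v c) (\<Sum>y\<in>#A. y - c)" by (rule vgt_sum_mset)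
  also have "(\<Sum>y\<in>#A. y - c) = - (of_nat (size A) * c)"
    unfolding sum_mset_map_diff 0 by simp
  finally have "vgt (v c) (of_nat (size A) * c)" by simp
  thus False using of_nat_unit[OF prime_char p] c0 by (simp add: vgt_def v_mult)
qed

lemma minimal_poly_factorization:
  assumes "minimal_poly K a h"
  obtains A where "size A = degree h" "h = (\<Prod>x\<in>#A. [:- x, 1:])"
proof -
  have "h \<noteq> 0" "lead_coeff h = 1" using assms by (auto simp: minimal_poly_def)
  thus thesis using that alg_closed_imp_factorization[of h] by auto
qed

text \<open>Otherwise p does not divide q, and subtracting the mean t of the conjugates of
  \<open>a\<close>, which lies in \<open>K\<close>, gives a nonzero element whose q conjugates add
  up to 0.\<close>

lemma degree_eq_char:
  assumes a: "a \<in> L" "a \<notin> K" shows "q = CHAR('a)"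
proof (rule ccontr)
  assume "q \<noteq> CHAR('a)"
  hence nd: "\<not> CHAR('a) dvd q"
    using prime_degree prime_char by (metis primes_dvd_imp_eq)
  obtain h where h: "minimal_poly K a h" using minimal_poly_ex[OF a(1)] by blast
  obtain A where A: "size A = degree h" "h = (\<Prod>x\<in>#A. [:- x, 1:])"
    using minimal_poly_factorization[OF h] .
  have size: "size A = q" using A(1) minimal_poly_degree(1)[OF a h] by simp
  hence ne: "A \<noteq> {#}" using prime_gt_0_nat[OF prime_degree] by auto
  have "coeff h (size A - 1) \<in> K" using h by (auto simp: minimal_poly_def poly_over_def)
  hence TK: "(\<Sum>x\<in>#A. x) \<in> K"
    using coeff_prod_linear_factors(3)[OF ne] A(2) subfield_minus[OF K] by (metis minus_minus)
  define t where "t = (\<Sum>x\<in>#A. x) / of_nat q"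
  have tK: "t \<in> K" unfolding t_def by (intro subfield_divide[OF K] TK subfield_of_nat[OF K])
  hence tL: "t \<in> L" using KL by auto
  have q0: "(of_nat q :: 'a) \<noteq> 0" using of_nat_unit(1)[OF prime_char nd] .
  define B where "B = image_mset (\<lambda>y. y - t) A"
  have "(\<Sum>y\<in>#B. y) \<noteq> 0"
  proof (rule conjugates_sum_nonzero)
    show "a - t \<in> L - {0}" using subfield_diff[OF L a(1) tL] a(2) tK by auto
    show "\<not> CHAR('a) dvd size B" using nd size by (simp add: B_def)
    fix y assume "y \<in># B"
    then obtain \<rho> where \<rho>: "\<rho> \<in># A" "y = \<rho> - t" by (auto simp: B_def)
    have "poly h \<rho> = 0" unfolding A(2) poly_prod_mset using \<rho>(1)
      by (auto simp: prod_mset_zero_iff image_image intro!: image_eqI[of _ _ \<rho>])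
    then obtain \<sigma> where \<sigma>: "embedding \<sigma>" "\<sigma> a = \<rho>"
      using embedding_exists[OF a minimal_poly_root_conjugate[OF K h]] by blast
    thus "\<exists>\<sigma>. embedding \<sigma> \<and> y = \<sigma> (a - t)"
      using \<rho>(2) a(1) tK tL by (auto simp: embedding_diff embedding_base intro!: exI[of _ \<sigma>])
  qed
  moreover have "(\<Sum>y\<in>#B. y) = 0"
    unfolding B_def image_mset.comp using sum_mset_map_diff[of t A] size q0 by (simp add: t_def)
  ultimately show False by simp
qed

text \<open>An additive Hilbert 90 by nilpotency of \<sigma> - 1: once the p-th iterate of \<sigma>
  fixes \<open>a\<close>, the p-th difference of the orbit vanishes. A nonzero difference w followed
  by 0 is fixed by \<sigma>, hence lies in \<open>K\<close>, and the difference before w, divided by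
  w, is \<theta>.\<close>

lemma artin_schreier_generator:
  assumes a: "a \<in> L" "a \<notin> K" and \<sigma>: "embedding \<sigma>" "\<sigma> a \<noteq> a"
  shows "\<exists>\<theta>\<in>L. \<sigma> \<theta> = \<theta> + 1"
proof -
  define u where "u i = (\<sigma> ^^ i) a" for i
  have u0: "u 0 = a" and uS: "u (Suc i) = \<sigma> (u i)" for i by (simp_all add: u_def)
  have uL: "u i \<in> L" for i by (induction i) (auto simp: u0 uS a embedding_mem[OF \<sigma>(1)])
  have inj: "x = y" if "\<sigma> x = \<sigma> y" "x \<in> L" "y \<in> L" for x y
    using embedding_nonzero[OF \<sigma>(1), of "x - y"] embedding_diff[OF \<sigma>(1) that(2,3)] that(1)
      subfield_diff[OF L that(2,3)] by auto
  \<comment> \<open>Injectivity of \<sigma> cancels m steps, so any repetition in the orbit yields a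
    return to \<open>a\<close> itself.\<close>
  have "u (m + n) = u m \<longrightarrow> u n = u 0" for m n
    by (induction m) (auto simp: uS intro: inj uL)
  hence shift: "u (j - i) = a" if "i < j" "u i = u j" for i j
    using that u0 by (metis le_add_diff_inverse less_imp_le)
  obtain h where h: "minimal_poly K a h" using minimal_poly_ex[OF a(1)] by blast
  have hK: "poly_over K h" "h \<noteq> 0" "poly h a = 0" using h by (auto simp: minimal_poly_def)
  have degh: "degree h = CHAR('a)" using minimal_poly_degree(1)[OF a h] degree_eq_char[OF a] by simp
  have root: "poly h (u i) = 0" for i
  proof (induction i)
    case (Suc i)
    have "poly h (u (Suc i)) = \<sigma> (poly h (u i))"
      using embedding_poly[OF \<sigma>(1) hK(1) uL] by (simp only: uS)
    thus ?case using Suc embedding_base[OF \<sigma>(1) subfield_zero[OF K]] by simp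
  qed (simp add: u0 hK)
  have fin: "finite {x. poly h x = 0}" using poly_roots_finite[OF hK(2)] .
  have "\<not> inj u" using root finite_subset[OF _ fin, of "range u"] finite_imageD[of u UNIV] by auto
  then obtain i j where ij: "i < j" "u i = u j" unfolding inj_def by (metis nat_neq_iff)
  hence "0 < j - i \<and> u (j - i) = a" using shift[OF ij] by simp
  hence "\<exists>s. 0 < s \<and> u s = a" by blast
  define s where "s = (LEAST s. 0 < s \<and> u s = a)"
  have s: "0 < s" "u s = a" using LeastI_ex[OF \<open>\<exists>s. 0 < s \<and> u s = a\<close>] by (simp_all add: s_def)
  have least: "u i \<noteq> a" if "0 < i" "i < s" for i using not_less_Least[of i] that unfolding s_def by auto
  have "inj_on u {..<s}"
  proof (rule linorder_inj_onI')
    fix i j assume ij: "i \<in> {..<s}" "j \<in> {..<s}" "i < j"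
    hence "0 < j - i" "j - i < s" by auto
    thus "u i \<noteq> u j" using shift[OF ij(3)] least by blast
  qed
  hence "s \<le> card {x. poly h x = 0}"
    using card_inj_on_le[of u "{..<s}" "{x. poly h x = 0}", OF _ _ fin] root by (simp add: image_subset_iff)
  also have "\<dots> \<le> CHAR('a)" using card_poly_roots_bound[OF hK(2)] degh by simp
  finally have s_le: "s \<le> CHAR('a)" .
  \<comment> \<open>Otherwise the mean of the orbit is fixed by \<sigma>, hence in \<open>K\<close>,
    and subtracting it from the s members of the orbit leaves conjugates with sum 0. Since the orbit
    consists of roots of \<open>h\<close>, s is at most p, so s = p.\<close>
  have "CHAR('a) dvd s"
  proof (rule ccontr)
    assume nd: "\<not> CHAR('a) dvd s"
    note s0 = of_nat_unit(1)[OF prime_char nd]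
    define T where "T = (\<Sum>i<s. u i)"
    have sumL: "(\<Sum>i<n. u i) \<in> L" for n by (rule subfield_sum[OF L uL])
    have "\<sigma> (\<Sum>i<n. u i) = (\<Sum>i<n. u (Suc i))" for n
      by (induction n) (simp_all add: embedding_add[OF \<sigma>(1)] sumL uL uS
          embedding_base[OF \<sigma>(1) subfield_zero[OF K]])
    moreover have "(\<Sum>i<s. u (Suc i)) = (\<Sum>i<s. u i)"
      using sum.lessThan_Suc_shift[of u s] s(2) u0 by simp
    ultimately have "T \<in> K" using embedding_fixed[OF \<sigma>(1) a(1) \<sigma>(2)] sumL by (simp add: T_def)
    define t where "t = T / of_nat s"
    have tK: "t \<in> K" unfolding t_def by (intro subfield_divide[OF K] \<open>T \<in> K\<close> subfield_of_nat[OF K])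
    hence tL: "t \<in> L" using KL by auto
    have "(\<Sum>y\<in>#image_mset (\<lambda>i. u i - t) (mset_set {..<s}). y) \<noteq> 0"
    proof (rule conjugates_sum_nonzero)
      show "a - t \<in> L - {0}" using subfield_diff[OF L a(1) tL] a(2) tK by auto
      show "\<not> CHAR('a) dvd size (image_mset (\<lambda>i. u i - t) (mset_set {..<s}))" using nd by simp
      fix y assume "y \<in># image_mset (\<lambda>i. u i - t) (mset_set {..<s})"
      then obtain i where i: "y = u i - t" by auto
      obtain \<tau> where \<tau>: "embedding \<tau>" "\<tau> a = u i"
        using embedding_exists[OF a minimal_poly_root_conjugate[OF K h root]] by blast
      thus "\<exists>\<sigma>. embedding \<sigma> \<and> y = \<sigma> (a - t)"
        using i a(1) tK tL by (auto simp: embedding_diff embedding_base intro!: exI[of _ \<tau>])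
    qed
    moreover have "(\<Sum>y\<in>#image_mset (\<lambda>i. u i - t) (mset_set {..<s}). y) = (\<Sum>i<s. u i - t)"
      by (simp add: sum_unfold_sum_mset)
    moreover have "(\<Sum>i<s. u i - t) = 0" using s0 by (simp add: sum_subtractf t_def T_def)
    ultimately show False by simp
  qed
  hence "s = CHAR('a)" using s_le s(1) by (simp add: dvd_imp_le le_antisym)
  hence per: "u (CHAR('a)) = u 0" using s u0 by simp
  \<comment> \<open>\<open>D k i\<close> is the k-th forward difference of the orbit at i, obtained
    from \<open>a\<close> by applying \<sigma> - 1 k times and \<sigma> i times.\<close>
  define D where "D = rec_nat u (\<lambda>_ f i. f (Suc i) - f i)"
  have D0: "D 0 = u" and DS: "D (Suc k) i = D k (Suc i) - D k i" for k i by (simp_all add: D_def)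
  have DL: "D k i \<in> L" for k i by (induction k arbitrary: i) (auto simp: D0 DS uL intro: subfield_diff[OF L])
  have D\<sigma>: "\<sigma> (D k i) = D k (Suc i)" for k i
    by (induction k arbitrary: i) (auto simp: D0 DS uS embedding_diff[OF \<sigma>(1)] DL)
  have "u (CHAR('a)) = (\<Sum>j\<le>CHAR('a). of_nat (CHAR('a) choose j) * D j 0)"
    using newton_forward[of D 0 "CHAR('a)" 0, OF DS] by (simp add: D0)
  also have "\<dots> = (\<Sum>j\<in>{0, CHAR('a)}. of_nat (CHAR('a) choose j) * D j 0)"
  proof (rule sum.mono_neutral_right)
    show "\<forall>j\<in>{..CHAR('a)} - {0, CHAR('a)}. of_nat (CHAR('a) choose j) * D j 0 = 0"
    proof
      fix j assume "j \<in> {..CHAR('a)} - {0, CHAR('a)}"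
      hence "CHAR('a) dvd (CHAR('a) choose j)" using prime_char by (intro dvd_choose_prime) auto
      thus "of_nat (CHAR('a) choose j) * D j 0 = 0" by (simp add: of_nat_eq_0_iff_char_dvd)
    qed
  qed auto
  also have "\<dots> = u 0 + D (CHAR('a)) 0" using char_pos by (simp add: D0)
  finally have Dp: "D (CHAR('a)) 0 = 0" using per by simp
  have D1: "D 1 0 \<noteq> 0" using \<sigma>(2) by (simp add: DS D0 uS u0)
  have "\<exists>k. D (Suc k) 0 \<noteq> 0 \<and> D (Suc (Suc k)) 0 = 0"
  proof (rule ccontr)
    assume "\<not> ?thesis"
    hence "D (Suc k) 0 \<noteq> 0" for k using D1 by (induction k) auto
    thus False using Dp char_pos by (metis Suc_pred')
  qed
  then obtain k where k: "D (Suc k) 0 \<noteq> 0" "D (Suc (Suc k)) 0 = 0" by blast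
  define w where "w = D (Suc k) 0"
  have "\<sigma> w = w" using D\<sigma>[of "Suc k" 0] k(2) DS[of "Suc k" 0] by (simp add: w_def)
  hence wK: "w \<in> K" using embedding_fixed[OF \<sigma>(1) a(1) \<sigma>(2)] DL by (simp add: w_def)
  hence wL: "inverse w \<in> L" "inverse w \<in> K" using subfield_inverse[OF K] KL by auto
  have "\<sigma> (D k 0) = D k 0 + w" using D\<sigma>[of k 0] DS[of k 0] by (simp add: w_def)
  hence "\<sigma> (D k 0 * inverse w) = (D k 0 + w) * inverse w"
    using embedding_mult[OF \<sigma>(1) DL wL(1), of k 0] embedding_base[OF \<sigma>(1) wL(2)] by simp
  also have "\<dots> = D k 0 * inverse w + 1"
    using k(1) by (simp add: w_def distrib_right)
  finally have "\<sigma> (D k 0 * inverse w) = D k 0 * inverse w + 1" .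
  thus ?thesis using subfield_mult[OF L DL wL(1)] by blast
qed

text \<open>For the negative values, let \<open>e\<close> in \<open>K\<close> have the leading term
  of \<theta> - c. Then \<theta> - c - e has value above v(\<theta> - c), and so has its image under
  \<sigma>, which is \<theta> - c - e + 1. Their difference 1 therefore has value above v(\<theta> -
  c).\<close>

lemma artin_schreier_pseudo_limit:
  assumes \<theta>: "\<theta> \<in> L" and \<sigma>: "embedding \<sigma>" "\<sigma> \<theta> = \<theta> + 1"
  shows "pseudo_limit K \<theta>" "\<theta> ^ CHAR('a) - \<theta> \<in> K" "\<forall>c\<in>K. v (\<theta> - c) < 0"
proof -
  have nK: "\<theta> \<notin> K" using embedding_base[OF \<sigma>(1), of \<theta>] \<sigma>(2) by auto
  show "pseudo_limit K \<theta>" by (rule pseudo_limit_immediate[OF K L immediate \<theta> nK])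
  have "\<sigma> (\<theta> ^ CHAR('a) - \<theta>) = \<theta> ^ CHAR('a) - \<theta>"
    using \<theta> \<sigma>(2) freshmans_dream[OF prime_char refl, of \<theta> 1]
    by (simp add: embedding_diff[OF \<sigma>(1)] embedding_power[OF \<sigma>(1)] subfield_power[OF L])
  thus "\<theta> ^ CHAR('a) - \<theta> \<in> K"
    using embedding_fixed[OF \<sigma>(1) \<theta>] \<sigma>(2) \<theta> subfield_diff[OF L] subfield_power[OF L] by auto
  show "\<forall>c\<in>K. v (\<theta> - c) < 0"
  proof
    fix c assume c: "c \<in> K"
    have cL: "c \<in> L" using c KL by auto
    have "\<theta> - c \<in> L - {0}" using subfield_diff[OF L \<theta> cL] nK c by auto
    then obtain e where e: "e \<in> K" "veq (\<theta> - c) e"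
      using immediate unfolding immediate_over_def by blast
    have eL: "e \<in> L" using e KL by auto
    have *: "\<theta> - c - e \<in> L" "vgt (v (\<theta> - c)) (\<theta> - c - e)"
      using e \<theta> cL eL by (auto simp: veq_def intro!: subfield_diff[OF L])
    have "\<sigma> (\<theta> - c - e) = \<theta> - c - e + 1"
      using \<sigma>(2) \<theta> cL eL c e by (simp add: embedding_diff[OF \<sigma>(1)] embedding_base[OF \<sigma>(1)] subfield_diff[OF L])
    hence "vgt (v (\<theta> - c)) (\<theta> - c - e + 1)" using embedding_vgt[OF \<sigma>(1) *] by simp
    from vgt_diff[OF this *(2)] show "v (\<theta> - c) < 0" by (simp add: vgt_def)
  qed
qed

text \<open>If the minimal polynomial has a root other than \<open>b\<close>, some embedding moves
  \<open>b\<close> and \<open>L\<close> has an Artin-Schreier generator. Otherwise it is (X - b)^p,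
  with constant term -b^p.\<close>

lemma distance_cases:
  assumes b: "b \<in> L" "b \<notin> K"
  obtains "b ^ CHAR('a) \<in> K"
  | \<theta> where "pseudo_limit K \<theta>" "\<theta> ^ CHAR('a) - \<theta> \<in> K" "\<forall>c\<in>K. v (\<theta> - c) < 0"
      "(distance v K \<theta>, distance v K b) \<in> distance_eq_mod (value_group v K)"
proof -
  obtain h where h: "minimal_poly K b h" using minimal_poly_ex[OF b(1)] by blast
  obtain A where A: "size A = degree h" "h = (\<Prod>x\<in>#A. [:- x, 1:])"
    using minimal_poly_factorization[OF h] .
  have root: "poly h x = 0" if "x \<in># A" for x
    unfolding A(2) poly_prod_mset using that
    by (auto simp: prod_mset_zero_iff image_image intro!: image_eqI[of _ _ x])
  show thesis
  proof (cases "\<exists>\<rho>\<in>#A. \<rho> \<noteq> b")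
    case True
    then obtain \<rho> where \<rho>: "\<rho> \<in># A" "\<rho> \<noteq> b" by blast
    obtain \<sigma> where \<sigma>: "embedding \<sigma>" "\<sigma> b = \<rho>"
      using embedding_exists[OF b minimal_poly_root_conjugate[OF K h root[OF \<rho>(1)]]] by blast
    obtain \<theta> where \<theta>: "\<theta> \<in> L" "\<sigma> \<theta> = \<theta> + 1" using artin_schreier_generator[OF b \<sigma>(1)] \<sigma>(2) \<rho>(2) by blast
    note as = artin_schreier_pseudo_limit[OF \<theta>(1) \<sigma>(1) \<theta>(2)]
    obtain g where g: "minimal_poly K \<theta> g" using minimal_poly_ex[OF \<theta>(1)] by blast
    have "\<theta> \<notin> K" using as(1) by (simp add: pseudo_limit_def)
    hence "adjoin K \<theta> = L" by (rule minimal_poly_degree(2)[OF \<theta>(1) _ g])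
    hence "(distance v K \<theta>, distance v K b) \<in> distance_eq_mod (value_group v K)"
      using tight_adjoin(2)[OF tight_artin_schreier[OF as], of b] b by (simp add: poly_monom)
    thus thesis using that(2) as by blast
  next
    case False
    hence "A = replicate_mset (size A) b"
      by (intro set_mset_subset_singletonD) auto
    hence "h = [:- b, 1:] ^ CHAR('a)"
      using A minimal_poly_degree(1)[OF b h] degree_eq_char[OF b] by (metis image_replicate_mset prod_mset_replicate_mset)
    hence "poly h 0 = (0 - b) ^ CHAR('a)" by (simp add: poly_power)
    also have "\<dots> = - (b ^ CHAR('a))" unfolding freshmans_dream_diff[OF prime_char] using char_pos by simp
    finally have "b ^ CHAR('a) = - poly h 0" by simp
    moreover have "poly h 0 \<in> K"
      using h poly_over_poly[OF K _ subfield_zero[OF K]] by (auto simp: minimal_poly_def)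
    ultimately show thesis using that(1) subfield_minus[OF K] by metis
  qed
qed

end

section \<open>Residue fields\<close>

context valued_field
begin

abbreviation val_ring :: "'a ring" where
  "val_ring \<equiv> ring_of_type_algebra\<lparr>carrier := valuation_ring v UNIV\<rparr>"

abbreviation res :: "'a \<Rightarrow> 'a set" where
  "res x \<equiv> valuation_ideal v UNIV +>\<^bsub>val_ring\<^esub> x"

lemma valuation_ideal_iff: "x \<in> valuation_ideal v F \<longleftrightarrow> x \<in> F \<and> vgt 0 x"
  by (auto simp: valuation_ideal_def vgt_def)

lemma valuation_ring_closed:
  assumes "is_subfield F"
  shows "1 \<in> valuation_ring v F" "0 \<in> valuation_ring v F"
    "x \<in> valuation_ring v F \<Longrightarrow> - x \<in> valuation_ring v F"
    "x \<in> valuation_ring v F \<Longrightarrow> y \<in> valuation_ring v F \<Longrightarrow> x * y \<in> valuation_ring v F"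
    "x \<in> valuation_ring v F \<Longrightarrow> y \<in> valuation_ring v F \<Longrightarrow> x + y \<in> valuation_ring v F"
proof -
  note F = subfield_closed[OF assms]
  show "1 \<in> valuation_ring v F" "0 \<in> valuation_ring v F"
    "x \<in> valuation_ring v F \<Longrightarrow> - x \<in> valuation_ring v F"
    using F by (auto simp: valuation_ring_def)
  show "x * y \<in> valuation_ring v F" if "x \<in> valuation_ring v F" "y \<in> valuation_ring v F"
    using that F by (auto simp: valuation_ring_def v_mult)
  show "x + y \<in> valuation_ring v F" if "x \<in> valuation_ring v F" "y \<in> valuation_ring v F"
  proof (cases "x = 0 \<or> y = 0 \<or> x + y = 0")
    case False
    thus ?thesis using that F v_add[of x y]
      by (auto simp: valuation_ring_def min_def split: if_splits)
  qed (use that F in \<open>auto simp: valuation_ring_def\<close>)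
qed

lemma is_subfield_UNIV: "is_subfield UNIV"
  by (simp add: is_subfield_def)

lemmas valuation_ring_UNIV_closed = valuation_ring_closed[OF is_subfield_UNIV]

lemma cring_val_ring: "cring val_ring"
proof -
  interpret field "ring_of_type_algebra :: 'a ring" by (rule field_from_type_algebra)
  have "subring (valuation_ring v UNIV) ring_of_type_algebra"
    by (rule subringI) (simp_all add: valuation_ring_UNIV_closed)
  thus ?thesis using subcring_iff[of "valuation_ring v UNIV"] subcringI' by simp
qed

lemma a_inv_val_ring: "x \<in> valuation_ring v UNIV \<Longrightarrow> \<ominus>\<^bsub>val_ring\<^esub> x = - x"
proof -
  interpret cring val_ring by (rule cring_val_ring)
  assume "x \<in> valuation_ring v UNIV"
  thus ?thesis by (intro minus_equality) (simp_all add: valuation_ring_UNIV_closed)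
qed

lemma ideal_valuation_ideal: "ideal (valuation_ideal v UNIV) val_ring"
proof -
  interpret cring val_ring by (rule cring_val_ring)
  have mult: "x * a \<in> valuation_ideal v UNIV"
    if "a \<in> valuation_ideal v UNIV" "x \<in> valuation_ring v UNIV" for a x
    using that by (auto simp: valuation_ideal_def valuation_ring_def v_mult add_nonneg_pos)
  have sub: "valuation_ideal v UNIV \<subseteq> valuation_ring v UNIV"
    by (auto simp: valuation_ideal_def valuation_ring_def)
  have zero: "0 \<in> valuation_ideal v UNIV" by (simp add: valuation_ideal_iff)
  show ?thesis
  proof (rule idealI[OF ring_axioms])
    show "subgroup (valuation_ideal v UNIV) (add_monoid val_ring)"
    proof (rule add.subgroupI)
      show "\<ominus>\<^bsub>val_ring\<^esub> a \<in> valuation_ideal v UNIV" if "a \<in> valuation_ideal v UNIV" for a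
        using that sub a_inv_val_ring[of a] by (auto simp: valuation_ideal_iff)
      show "valuation_ideal v UNIV \<noteq> {}" using zero by blast
    qed (use sub in \<open>auto simp: valuation_ideal_iff intro: vgt_add\<close>)
  qed (use mult in \<open>simp_all add: mult.commute\<close>)
qed

lemma res_eq_iff:
  assumes "x \<in> valuation_ring v UNIV" "y \<in> valuation_ring v UNIV"
  shows "res x = res y \<longleftrightarrow> vgt 0 (x - y)"
proof -
  interpret cring val_ring by (rule cring_val_ring)
  have "x \<ominus>\<^bsub>val_ring\<^esub> y = x - y" using assms by (simp add: a_minus_def a_inv_val_ring)
  thus ?thesis
    using quotient_eq_iff_same_a_r_cos[OF ideal_valuation_ideal, of x y] assms
    by (simp add: valuation_ideal_iff)
qed

lemma res_hom: "ring_hom_ring val_ring (ambient_residue_field v) res"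
  unfolding ambient_residue_field_def by (rule ideal.rcos_ring_hom_ring[OF ideal_valuation_ideal])

lemma carrier_ambient_residue_field:
  "carrier (ambient_residue_field v) = res ` valuation_ring v UNIV"
  unfolding ambient_residue_field_def FactRing_def A_RCOSETS_def RCOSETS_def a_r_coset_def
  by auto

lemma zero_ambient_residue_field: "\<zero>\<^bsub>ambient_residue_field v\<^esub> = res 0"
  and one_ambient_residue_field: "\<one>\<^bsub>ambient_residue_field v\<^esub> = res 1"
proof -
  interpret ring_hom_ring val_ring "ambient_residue_field v" res by (rule res_hom)
  show "\<zero>\<^bsub>ambient_residue_field v\<^esub> = res 0" "\<one>\<^bsub>ambient_residue_field v\<^esub> = res 1"
    using hom_zero hom_one by simp_all
qed

lemma res_inverse:
  assumes "x \<in> valuation_ring v F" "is_subfield F" "res x \<noteq> res 0"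
  shows "inverse x \<in> valuation_ring v F" "res x \<otimes>\<^bsub>ambient_residue_field v\<^esub> res (inverse x) = res 1"
proof -
  interpret ring_hom_ring val_ring "ambient_residue_field v" res by (rule res_hom)
  have x: "x \<in> valuation_ring v UNIV" using assms(1) by (simp add: valuation_ring_def)
  have "\<not> vgt 0 x" using assms(3) res_eq_iff[OF x, of 0] valuation_ring_UNIV_closed by simp
  hence x0: "x \<noteq> 0" "v x = 0" using x by (auto simp: vgt_def valuation_ring_def)
  show inv: "inverse x \<in> valuation_ring v F"
    using assms x0 subfield_inverse[OF assms(2)] by (auto simp: valuation_ring_def v_inverse)
  hence "inverse x \<in> valuation_ring v UNIV" by (simp add: valuation_ring_def)
  thus "res x \<otimes>\<^bsub>ambient_residue_field v\<^esub> res (inverse x) = res 1"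
    using hom_mult[of x "inverse x"] x x0 by simp
qed

lemma field_ambient_residue_field: "field (ambient_residue_field v)"
proof -
  interpret ring_hom_ring val_ring "ambient_residue_field v" res by (rule res_hom)
  interpret S: cring "ambient_residue_field v"
    unfolding ambient_residue_field_def
    by (rule ideal.quotient_is_cring[OF ideal_valuation_ideal cring_val_ring])
  show ?thesis
  proof (rule S.cring_fieldI2)
    show "\<zero>\<^bsub>ambient_residue_field v\<^esub> \<noteq> \<one>\<^bsub>ambient_residue_field v\<^esub>"
      unfolding zero_ambient_residue_field one_ambient_residue_field
      using res_eq_iff[of 0 1] valuation_ring_UNIV_closed by (simp add: vgt_def)
    fix a assume "a \<in> carrier (ambient_residue_field v)" "a \<noteq> \<zero>\<^bsub>ambient_residue_field v\<^esub>"
    then obtain x where x: "x \<in> valuation_ring v UNIV" "a = res x" "res x \<noteq> res 0"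
      unfolding carrier_ambient_residue_field zero_ambient_residue_field by auto
    note inv = res_inverse[OF x(1) is_subfield_UNIV x(3)]
    show "\<exists>b\<in>carrier (ambient_residue_field v). a \<otimes>\<^bsub>ambient_residue_field v\<^esub> b = \<one>\<^bsub>ambient_residue_field v\<^esub>"
      unfolding carrier_ambient_residue_field one_ambient_residue_field x(2) using inv by blast
  qed
qed

lemma subfield_residue_field:
  assumes "is_subfield F" shows "subfield (residue_field v F) (ambient_residue_field v)"
proof -
  interpret ring_hom_ring val_ring "ambient_residue_field v" res by (rule res_hom)
  interpret S: field "ambient_residue_field v" by (rule field_ambient_residue_field)
  have sub: "valuation_ring v F \<subseteq> valuation_ring v UNIV" by (auto simp: valuation_ring_def)
  have "subring (valuation_ring v F) val_ring"
  proof (rule R.subringI)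
    show "\<ominus>\<^bsub>val_ring\<^esub> h \<in> valuation_ring v F" if "h \<in> valuation_ring v F" for h
      using that sub a_inv_val_ring[of h] valuation_ring_closed(3)[OF assms] by auto
  qed (use sub in \<open>simp_all add: valuation_ring_closed[OF assms]\<close>)
  hence "subring (residue_field v F) (ambient_residue_field v)"
    unfolding residue_field_def by (rule img_is_subring)
  thus ?thesis
  proof (rule S.subfieldI')
    fix k assume "k \<in> residue_field v F - {\<zero>\<^bsub>ambient_residue_field v\<^esub>}"
    then obtain x where x: "x \<in> valuation_ring v F" "k = res x" "res x \<noteq> res 0"
      unfolding residue_field_def zero_ambient_residue_field by auto
    note inv = res_inverse[OF x(1) assms x(3)]
    have "res x \<in> carrier (ambient_residue_field v)" "res (inverse x) \<in> carrier (ambient_residue_field v)"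
      using sub x(1) inv(1) unfolding carrier_ambient_residue_field by auto
    hence "inv\<^bsub>ambient_residue_field v\<^esub> (res x) = res (inverse x)"
      using inv(2) by (intro S.comm_inv_char) (auto simp: one_ambient_residue_field)
    thus "inv\<^bsub>ambient_residue_field v\<^esub> k \<in> residue_field v F"
      using inv(1) unfolding x(2) residue_field_def by auto
  qed
qed

text \<open>Dividing \<open>z\<close> by some \<open>c\<close> in \<open>K\<close> of the same value
  leaves a unit, whose residue is that of some \<open>d\<close> in \<open>K\<close>; then c d has
  the leading term of \<open>z\<close>.\<close>

lemma immediate_overI:
  assumes K: "is_subfield K" and L: "is_subfield L" "K \<subseteq> L"
    and vg: "value_group v L = value_group v K" and rf: "residue_field v L = residue_field v K"
  shows "immediate_over K L"
  unfolding immediate_over_def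
proof (intro conjI ballI L(2))
  fix z assume z: "z \<in> L - {0}"
  hence "v z \<in> value_group v K" unfolding vg[symmetric] by (auto simp: value_group_def)
  then obtain c where c: "c \<in> K" "c \<noteq> 0" "v z = v c" by (auto simp: value_group_def)
  have "c \<in> L" using c L by auto
  hence zc: "z / c \<in> valuation_ring v L"
    using z c subfield_divide[OF L(1), of z c] by (auto simp: valuation_ring_def v_divide)
  hence "res (z / c) \<in> residue_field v K" unfolding rf[symmetric] by (auto simp: residue_field_def)
  then obtain d where d: "d \<in> valuation_ring v K" "res (z / c) = res d" by (auto simp: residue_field_def)
  have "vgt 0 (z / c - d)"
    using d zc res_eq_iff[of "z / c" d] by (auto simp: valuation_ring_def)
  moreover have "v (z / c) = 0" using z c by (simp add: v_divide)
  ultimately have "veq (z / c) d" using z c by (intro veqI) auto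
  hence "veq (c * (z / c)) (c * d)" using c by (intro veq_mult veq_refl) auto
  moreover have "c * d \<in> K" using c d subfield_mult[OF K] by (auto simp: valuation_ring_def)
  ultimately show "\<exists>c\<in>K. veq z c" using c by auto
qed

lemma residue_field_immediate:
  assumes K: "is_subfield K" and "immediate_over K L" shows "residue_field v L = residue_field v K"
proof
  have KL: "K \<subseteq> L" using assms by (simp add: immediate_over_def)
  show "residue_field v K \<subseteq> residue_field v L"
    using KL unfolding residue_field_def valuation_ring_def by auto
  show "residue_field v L \<subseteq> residue_field v K"
  proof
    fix r assume "r \<in> residue_field v L"
    then obtain x where x: "x \<in> L" "x \<noteq> 0 \<longrightarrow> 0 \<le> v x" "r = res x"
      by (auto simp: residue_field_def valuation_ring_def)
    show "r \<in> residue_field v K"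
    proof (cases "x = 0")
      case False
      then obtain c where c: "c \<in> K" "veq x c" using assms x by (auto simp: immediate_over_def)
      hence "vgt 0 (x - c)" "c \<in> valuation_ring v K"
        using veq_v[OF c(2)] x False by (auto simp: veq_def valuation_ring_def intro: vgt_mono)
      thus ?thesis using x res_eq_iff[of x c] by (auto simp: residue_field_def valuation_ring_def)
    next
      case True
      thus ?thesis using x valuation_ring_closed(2)[OF K] by (auto simp: residue_field_def)
    qed
  qed
qed

end

section \<open>Consequences of a nontrivial defect in prime degree\<close>

context valued_field
begin

text \<open>A linear relation over \<open>K\<close> can be scaled so that all coefficients are integral and one is \<open>1\<close>.\<close>

lemma independent_residues_lift:
  assumes K: "is_subfield K" and us: "set us \<subseteq> valuation_ring v UNIV"
    and ind: "ring.independent (ambient_residue_field v) (residue_field v K) (map res us)"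
  shows "ring.independent ring_of_type_algebra K us"
proof -
  interpret R: field "ring_of_type_algebra :: 'a ring" by (rule field_from_type_algebra)
  interpret hom: ring_hom_ring val_ring "ambient_residue_field v" res by (rule res_hom)
  have subK: "subfield K ring_of_type_algebra" using K by (simp add: subfield_iff_is_subfield)
  have combine: "R.combine Ks Us = ring.combine val_ring Ks Us" for Ks Us
    by (induction Ks Us rule: R.combine.induct) simp_all
  show ?thesis
  proof (rule R.trivial_combine_imp_independent[OF subK], simp)
    fix Ks assume Ks: "set Ks \<subseteq> K" "R.combine Ks us = \<zero>\<^bsub>ring_of_type_algebra\<^esub>"
    define Cs where "Cs = take (length us) Ks"
    have Cs: "set Cs \<subseteq> K" "R.combine Cs us = 0"
      using Ks R.combine_take[of us Ks] unfolding Cs_def by (auto dest: in_set_takeD)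
    show "set (take (length us) Ks) \<subseteq> {\<zero>\<^bsub>ring_of_type_algebra\<^esub>}"
    proof (rule ccontr)
      assume "\<not> ?thesis"
      hence "set Cs - {0} \<noteq> {}" by (auto simp: Cs_def)
      hence "Min (v ` (set Cs - {0})) \<in> v ` (set Cs - {0})" by (intro Min_in) auto
      then obtain c where c: "c \<in> set Cs" "c \<noteq> 0" "v c = Min (v ` (set Cs - {0}))"
        unfolding image_iff by (metis Diff_iff singletonI)
      have min: "v c \<le> v d" if "d \<in> set Cs" "d \<noteq> 0" for d
        unfolding c(3) using that by (intro Min_le) auto
      define Ds where "Ds = map (\<lambda>d. inverse c * d) Cs"
      have cK: "inverse c \<in> K" using c Cs subfield_inverse[OF K] by auto
      have Ds: "set Ds \<subseteq> valuation_ring v K"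
      proof
        fix x assume "x \<in> set Ds"
        then obtain d where d: "d \<in> set Cs" "x = inverse c * d" by (auto simp: Ds_def)
        have "x \<in> K" unfolding d(2) using d(1) Cs(1) cK by (intro subfield_mult[OF K]) auto
        moreover have "0 \<le> v x" if "x \<noteq> 0"
          using min[OF d(1)] that c(2) unfolding d(2) by (simp add: v_mult v_inverse)
        ultimately show "x \<in> valuation_ring v K" by (simp add: valuation_ring_def)
      qed
      hence Ds': "set Ds \<subseteq> valuation_ring v UNIV" by (auto simp: valuation_ring_def)
      have "(\<otimes>\<^bsub>ring_of_type_algebra\<^esub>) (inverse c) = (\<lambda>d. inverse c * d)" by (rule ext) simp
      hence "R.combine Ds us = inverse c * R.combine Cs us"
        using R.combine_r_distr[of Cs us "inverse c"] by (simp add: Ds_def)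
      hence "R.combine Ds us = 0" using Cs(2) by simp
      hence "hom.S.combine (map res Ds) (map res us) = res 0"
        using hom.combine_hom[of Ds us] Ds' us combine by simp
      hence "hom.S.combine (map res Ds) (map res us) = \<zero>\<^bsub>ambient_residue_field v\<^esub>"
        by (simp add: zero_ambient_residue_field)
      moreover have "set (map res Ds) \<subseteq> residue_field v K" using Ds by (auto simp: residue_field_def)
      ultimately have "set (take (length us) (map res Ds)) \<subseteq> {res 0}"
        using hom.S.independent_imp_trivial_combine[OF subfield_residue_field[OF K] ind, of "map res Ds"]
        by (simp add: zero_ambient_residue_field)
      moreover have "length Ds \<le> length us" by (simp add: Ds_def Cs_def)
      ultimately have "res ` set Ds \<subseteq> {res 0}" by simp
      moreover have "1 \<in> set Ds" using c by (auto simp: Ds_def image_iff intro!: bexI[of _ c])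
      ultimately have "res 1 = res 0" by blast
      thus False using res_eq_iff[of 1 0] valuation_ring_UNIV_closed by (simp add: vgt_def)
    qed
  qed
qed

text \<open>\<open>ring.dim\<close> is a definite description, so finiteness of the residue extension must be
  established before its value can be used.\<close>

lemma inertia_degree_1:
  assumes K: "is_subfield K" and L: "is_subfield L" "K \<subseteq> L"
    and dim: "ring.dimension ring_of_type_algebra n K L" and f: "inertia_degree v K L = 1"
  shows "residue_field v L = residue_field v K"
proof -
  interpret R: field "ring_of_type_algebra :: 'a ring" by (rule field_from_type_algebra)
  interpret S: field "ambient_residue_field v" by (rule field_ambient_residue_field)
  let ?k = "residue_field v K" and ?l = "residue_field v L"
  have subK: "subfield K ring_of_type_algebra" using K by (simp add: subfield_iff_is_subfield)
  note subk = subfield_residue_field[OF K] and subl = subfield_residue_field[OF L(1)]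
  note k_ring = subringE[OF subfieldE(1)[OF subk]] and l_ring = subringE[OF subfieldE(1)[OF subl]]
  have kl: "?k \<subseteq> ?l" using L(2) by (auto simp: residue_field_def valuation_ring_def)
  \<comment> \<open>Independent residues lift to elements independent over \<open>K\<close>, so
    there are at most n of them. A longest independent list is then a basis, and its length is the
    inertia degree.\<close>
  define P where "P m \<longleftrightarrow> (\<exists>Us. S.independent ?k Us \<and> set Us \<subseteq> ?l \<and> length Us = m)" for m
  have bound: "m \<le> n" if Pm: "P m" for m
  proof -
    obtain Us where Us: "S.independent ?k Us" "set Us \<subseteq> ?l" "length Us = m"
      using Pm by (auto simp: P_def)
    define us where "us = map (inv_into (valuation_ring v L) res) Us"
    have img: "x \<in> res ` valuation_ring v L" if "x \<in> set Us" for x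
      using Us(2) that unfolding residue_field_def by blast
    have "map res us = Us"
      unfolding us_def map_map by (rule map_idI) (simp add: f_inv_into_f[OF img])
    moreover have "set us \<subseteq> valuation_ring v L"
      using inv_into_into[OF img] by (auto simp: us_def)
    ultimately have us: "Us = map res us" "set us \<subseteq> valuation_ring v L" by simp_all
    have "R.independent K us"
      using us Us(1) by (intro independent_residues_lift[OF K]) (auto simp: valuation_ring_def)
    moreover have "set us \<subseteq> L" using us by (auto simp: valuation_ring_def)
    ultimately have "length us \<le> n" by (rule R.independent_length_le_dimension[OF subK dim])
    thus ?thesis using us Us by simp
  qed
  have "P 0" by (auto simp: P_def)
  then obtain m where m: "P m" "\<And>j. P j \<Longrightarrow> j \<le> m"
    using ex_has_greatest_nat[of P 0 "\<lambda>m. m" "Suc n"] bound by (auto simp: less_Suc_eq_le)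
  obtain Us where Us: "S.independent ?k Us" "set Us \<subseteq> ?l" "length Us = m" using m(1) by (auto simp: P_def)
  have carrier: "set Us \<subseteq> carrier (ambient_residue_field v)" using Us(2) l_ring(1) by auto
  have "S.Span ?k Us = ?l"
  proof
    have combine: "S.combine Ks Vs \<in> ?l" if "set Ks \<subseteq> ?l" "set Vs \<subseteq> ?l" for Ks Vs
      using that by (induction Ks Vs rule: S.combine.induct) (auto intro: l_ring)
    show "S.Span ?k Us \<subseteq> ?l"
    proof
      fix x assume "x \<in> S.Span ?k Us"
      then obtain Ks where Ks: "set Ks \<subseteq> ?k" "x = S.combine Ks Us"
        unfolding S.Span_mem_iff_length_version[OF subk carrier] by blast
      show "x \<in> ?l" unfolding Ks(2) by (rule combine[OF subset_trans[OF Ks(1) kl] Us(2)])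
    qed
    show "?l \<subseteq> S.Span ?k Us"
    proof (rule ccontr)
      assume "\<not> ?thesis"
      then obtain x where x: "x \<in> ?l" "x \<notin> S.Span ?k Us" by blast
      hence "S.independent ?k (x # Us)" using Us(1) l_ring(1) by (intro S.li_Cons) auto
      hence "P (Suc m)" unfolding P_def using x Us by (intro exI[of _ "x # Us"]) auto
      thus False using m(2) by fastforce
    qed
  qed
  hence diml: "S.dimension m ?k ?l" using S.dimension_independent[OF Us(1)] Us(3) by simp
  have "m = 1" using S.dimI[OF subk diml] f by (simp add: inertia_degree_def over_def)
  \<comment> \<open>In dimension 1 the single vector 1 spans the residue field of \<open>L\<close>;
    it also spans that of \<open>K\<close>.\<close>
  have ind1: "S.independent ?k [\<one>\<^bsub>ambient_residue_field v\<^esub>]"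
    by (rule S.li_Cons) auto
  have "S.Span ?k [\<one>\<^bsub>ambient_residue_field v\<^esub>] = ?l"
    using S.independent_length_eq_dimension[OF subk diml ind1] l_ring(3) \<open>m = 1\<close> by simp
  moreover have "S.Span ?k [\<one>\<^bsub>ambient_residue_field v\<^esub>] = ?k"
    using S.independent_length_eq_dimension[OF subk S.dimension_one[OF subk] ind1] k_ring(3) by simp
  ultimately show ?thesis by simp
qed

lemma ramification_index_1:
  assumes K: "is_subfield K" and KL: "K \<subseteq> L" and e: "ramification_index v K L = 1"
  shows "value_group v L = value_group v K"
proof
  show "value_group v K \<subseteq> value_group v L" using KL by (auto simp: value_group_def)
  show "value_group v L \<subseteq> value_group v K"
  proof
    fix \<gamma> assume \<gamma>: "\<gamma> \<in> value_group v L"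
    have 0: "0 \<in> value_group v L"
      using value_group_closed(1)[OF K] \<open>value_group v K \<subseteq> value_group v L\<close> by auto
    define coset where "coset \<gamma> = (\<lambda>\<alpha>. \<alpha> + \<gamma>) ` value_group v K" for \<gamma>
    obtain Z where "coset ` value_group v L = {Z}"
      using e unfolding ramification_index_def coset_def by (rule card_1_singletonE)
    hence "coset \<gamma> = coset 0" using imageI[OF \<gamma>, of coset] imageI[OF 0, of coset] by simp
    hence "(\<lambda>\<alpha>. \<alpha> + \<gamma>) ` value_group v K = (\<lambda>\<alpha>. \<alpha> + 0) ` value_group v K"
      by (simp only: coset_def)
    moreover have "0 + \<gamma> \<in> (\<lambda>\<alpha>. \<alpha> + \<gamma>) ` value_group v K"
      using value_group_closed(1)[OF K] by (rule imageI)
    ultimately show "\<gamma> \<in> value_group v K" by simp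
  qed
qed

text \<open>Extensions are counted as functions normalised outside \<open>L - {0}\<close>, so
  \<open>w\<close> and \<open>v\<close> are compared through their restrictions, both members of a
  one-element set.\<close>

lemma num_extensions_1:
  assumes L: "is_subfield L" "K \<subseteq> L" and g: "num_extensions v K L = 1"
    and w: "valuation_on L w" "\<And>x. x \<in> K - {0} \<Longrightarrow> w x = v x" and x: "x \<in> L - {0}"
  shows "w x = v x"
proof -
  let ?S = "{w \<in> extensional (L - {0}). valuation_on L w \<and> (\<forall>x\<in>K - {0}. w x = v x)}"
  have mem: "restrict u (L - {0}) \<in> ?S" if u: "valuation_on L u" "\<And>x. x \<in> K - {0} \<Longrightarrow> u x = v x" for u
    using u L(2) subfield_mult[OF L(1)] subfield_add[OF L(1)]
    by (auto simp: valuation_on_def subset_iff)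
  have "valuation_on L v" using valuation by (simp add: valuation_on_def)
  hence v_mem: "restrict v (L - {0}) \<in> ?S" by (intro mem) auto
  have w_mem: "restrict w (L - {0}) \<in> ?S" by (rule mem[OF w])
  obtain W where W: "?S = {W}" using g unfolding num_extensions_def by (rule card_1_singletonE)
  have "restrict w (L - {0}) = restrict v (L - {0})"
    using v_mem w_mem unfolding W by simp
  thus ?thesis using x by (metis restrict_apply')
qed

lemma nontrivial_defect_prime:
  assumes K: "is_subfield K" and L: "is_subfield L" "K \<subseteq> L" and q: "prime q"
    and dim: "ring.dimension ring_of_type_algebra q K L" and defect: "nontrivial_defect v K L"
  shows "immediate_over K L" "num_extensions v K L = 1"
proof -
  interpret R: field "ring_of_type_algebra :: 'a ring" by (rule field_from_type_algebra)
  have subK: "subfield K ring_of_type_algebra" using K by (simp add: subfield_iff_is_subfield)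
  obtain n d where nd: "R.dimension n K L"
    "n = d * (ramification_index v K L * inertia_degree v K L * num_extensions v K L)" "d > 1"
    using defect by (auto simp: nontrivial_defect_def has_degree_def mult.assoc)
  have "n = q" by (rule R.dimension_is_inj[OF subK nd(1) dim])
  hence "ramification_index v K L * inertia_degree v K L * num_extensions v K L = 1"
    using nd(2,3) q by (metis prime_product less_irrefl_nat)
  hence efg: "ramification_index v K L = 1" "inertia_degree v K L = 1" "num_extensions v K L = 1"
    by auto
  show "num_extensions v K L = 1" by (rule efg)
  show "immediate_over K L"
    by (rule immediate_overI[OF K L ramification_index_1[OF K L(2) efg(1)] inertia_degree_1[OF K L dim efg(2)]])
qed

end

section \<open>The base field inside its algebraic closure\<close>

lemma is_subfield_base_field: "is_subfield (base_field :: 'k::field alg_closure set)"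
  unfolding is_subfield_def
  by (auto simp: image_iff) (metis to_ac_0 to_ac_1 to_ac_diff to_ac_mult to_ac_inverse)+

lemma map_poly_to_ac_mult: "map_poly to_ac (f * g) = map_poly to_ac f * map_poly to_ac g"
  by (rule poly_eqI) (simp add: coeff_map_poly coeff_mult to_ac_sum)

lemma degree_map_poly_to_ac: "degree (map_poly to_ac f) = degree f"
  by (rule degree_map_poly) simp

lemma poly_over_base_field_iff: "poly_over base_field f \<longleftrightarrow> (\<exists>g. f = map_poly to_ac g)"
proof
  assume f: "poly_over base_field f"
  have "f = map_poly to_ac (map_poly of_ac f)"
    by (rule poly_eqI) (use f in \<open>auto simp: coeff_map_poly poly_over_def to_ac_of_ac\<close>)
  thus "\<exists>g. f = map_poly to_ac g" ..
qed (auto simp: poly_over_def coeff_map_poly)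

text \<open>Normality speaks of irreducible polynomials over \<open>'k\<close>, and the minimal
  polynomial comes from such a polynomial \<open>g\<close>: in a factorization of \<open>g\<close>,
  one factor vanishes at \<open>a\<close> and so has full degree, which makes the other a
  unit.\<close>

lemma normal_extension_conjugate:
  fixes L :: "'k::field alg_closure set"
  assumes normal: "normal_extension L" and a: "a \<in> L" and h: "minimal_poly base_field a h"
    and \<rho>: "conjugate base_field a \<rho>"
  shows "\<rho> \<in> L"
proof -
  obtain g where g: "h = map_poly to_ac g" using h poly_over_base_field_iff by (auto simp: minimal_poly_def)
  have h0: "h \<noteq> 0" "poly h a = 0" using h by (auto simp: minimal_poly_def)
  have "Factorial_Ring.irreducible g"
  proof (rule Factorial_Ring.irreducibleI)
    show "g \<noteq> 0" using h0 g by auto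
    show "\<not> g dvd 1"
    proof
      assume "g dvd 1"
      then obtain c where "g = [:c:]" by (auto simp: is_unit_poly_iff)
      hence "h = [:to_ac c:]" by (simp add: g map_poly_pCons)
      thus False using h0 by simp
    qed
    fix a1 b1 assume ab: "g = a1 * b1"
    have ne: "a1 \<noteq> 0" "b1 \<noteq> 0" using h0 g ab by auto
    have unit: "s dvd 1" if "poly (map_poly to_ac r) a = 0" "g = r * s" "r \<noteq> 0" "s \<noteq> 0" for r s
    proof -
      have "map_poly to_ac r \<noteq> 0" using that(3) by (simp add: map_poly_eq_0_iff)
      hence "degree h \<le> degree r"
        using h that(1) poly_over_base_field_iff[of "map_poly to_ac r"] degree_map_poly_to_ac[of r]
        unfolding minimal_poly_def by metis
      hence "degree s = 0" using that(2-4) g by (simp add: degree_map_poly_to_ac degree_mult_eq)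
      thus ?thesis using that(4) is_unit_iff_degree by blast
    qed
    have "poly (map_poly to_ac a1) a * poly (map_poly to_ac b1) a = 0"
      using h0(2) by (simp add: g ab map_poly_to_ac_mult)
    thus "a1 dvd 1 \<or> b1 dvd 1"
      using unit[of a1 b1] unit[of b1 a1] ab ne by (auto simp: mult.commute)
  qed
  moreover have "poly h \<rho> = 0" using \<rho> h unfolding conjugate_def minimal_poly_def by blast
  ultimately show ?thesis using normal a h0(2) unfolding normal_extension_def g by blast
qed

lemma is_subfield_p_root_field:
  assumes p: "prime CHAR('k)"
  shows "is_subfield (p_root_field :: 'k::field alg_closure set)"
proof -
  note K = subfield_closed[OF is_subfield_base_field]
  have p': "prime CHAR('k alg_closure)" using p by simp
  have diff: "(x - y) ^ CHAR('k) = x ^ CHAR('k) - y ^ CHAR('k)" for x y :: "'k alg_closure"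
    using freshmans_dream_diff[OF p', of x y] by simp
  have "0 < CHAR('k)" using p prime_gt_0_nat by blast
  thus ?thesis
    unfolding is_subfield_def p_root_field_def mem_Collect_eq
    by (intro conjI ballI) (simp_all only: mem_Collect_eq diff power_mult_distrib power_inverse power_one zero_power K)
qed

section \<open>Counting distances\<close>

text \<open>Every class is the class of some member of \<open>A\<close>, which may lie outside
  \<open>S\<close>; so cuts may be counted without being distances in the extensions
  considered.\<close>

lemma card_quotient_le:
  assumes R: "sym R" "trans R" and A: "finite A" and rep: "\<And>x. x \<in> S \<Longrightarrow> \<exists>a\<in>A. (a, x) \<in> R"
  shows "finite (S // R)" "card (S // R) \<le> card A"
proof -
  have "S // R \<subseteq> (\<lambda>a. R `` {a}) ` A"
  proof
    fix Z assume "Z \<in> S // R"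
    then obtain x where x: "x \<in> S" "Z = R `` {x}" by (auto simp: quotient_def)
    then obtain a where "a \<in> A" "(a, x) \<in> R" using rep by blast
    moreover have "R `` {x} = R `` {a}"
      using \<open>(a, x) \<in> R\<close> R by (auto dest: symD transD)
    ultimately show "Z \<in> (\<lambda>a. R `` {a}) ` A" using x by blast
  qed
  thus "finite (S // R)" "card (S // R) \<le> card A"
    using A finite_subset card_mono[of "(\<lambda>a. R `` {a}) ` A" "S // R"] card_image_le[OF A, of "\<lambda>a. R `` {a}"]
    by (auto intro: finite_subset le_trans)
qed

locale valued_base_field = valued_alg_closed_field v
  for v :: "'k::field alg_closure \<Rightarrow> 'g::linordered_ab_group_add"
begin

text \<open>Here the defect, given through d, e, f and g, is turned into immediacy and uniqueness of
  the extension, and normality into closure under conjugates.\<close>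

lemma distance_cases_base:
  fixes b :: "'k alg_closure"
  assumes L: "normal_defect_extension_prime_degree v L" and b: "b \<in> L - base_field"
  shows "(pseudo_limit base_field b \<and> b ^ CHAR('k) \<in> base_field) \<or>
    (\<exists>\<theta>. pseudo_limit base_field \<theta> \<and> \<theta> ^ CHAR('k) - \<theta> \<in> base_field \<and> (\<forall>c\<in>base_field. v (\<theta> - c) < 0) \<and>
      (distance v base_field \<theta>, distance v base_field b) \<in> distance_eq_mod (value_group v base_field))"
proof -
  obtain q where q: "prime q" "ring.dimension ring_of_type_algebra q base_field L"
    using L by (auto simp: normal_defect_extension_prime_degree_def has_degree_def)
  have normal: "normal_extension L" and defect: "nontrivial_defect v base_field L"
    using L by (auto simp: normal_defect_extension_prime_degree_def)
  have sub: "is_subfield L" "base_field \<subseteq> L"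
    using normal by (auto simp: normal_extension_def field_extension_def subfield_iff_is_subfield)
  note K = is_subfield_base_field
  note imm = nontrivial_defect_prime[OF K sub q defect]
  interpret E: prime_degree_extension base_field L q
    by unfold_locales (use K sub q in auto)
  interpret immediate_normal_extension v base_field L q
  proof unfold_locales
    fix w x assume "valuation_on L w" "\<And>x. x \<in> base_field - {0} \<Longrightarrow> w x = v x" "x \<in> L - {0}"
    thus "w x = v x" by (rule num_extensions_1[OF sub imm(2)])
  next
    fix a \<rho> assume a: "a \<in> L" "conjugate base_field a \<rho>"
    obtain h where "minimal_poly base_field a h" using E.minimal_poly_ex[OF a(1)] by blast
    thus "\<rho> \<in> L" using normal_extension_conjugate[OF normal a(1) _ a(2)] by blast
  qed (rule imm(1))
  show ?thesis
  proof (rule distance_cases[of b])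
    show "b \<in> L" "b \<notin> base_field" using b by auto
    assume "b ^ CHAR('k alg_closure) \<in> base_field"
    moreover have "pseudo_limit base_field b"
      using pseudo_limit_immediate[OF K sub(1) imm(1)] b by auto
    ultimately show ?thesis by simp
  qed auto
qed

lemma distances_bound:
  assumes rank: "has_rank v base_field r"
    and E: "is_subfield E" "base_field \<subseteq> E" "immediate_over base_field E"
    and D: "distances_in base_field E D" "finite D" "card D \<le> m"
    and max: "\<And>b. b ^ CHAR('k) \<in> base_field \<Longrightarrow> b \<notin> E \<Longrightarrow> \<not> immediate_over base_field (adjoin E b)"
    and P: "\<And>L. P L \<Longrightarrow> normal_defect_extension_prime_degree v L"
  shows "finite (distances_mod v base_field P) \<and> card (distances_mod v base_field P) \<le> r + m"
proof -
  note K = is_subfield_base_field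
  let ?G = "value_group v base_field"
  let ?R = "distance_eq_mod ?G"
  define C where "C = {H. convex_subgroup ?G H \<and> H \<noteq> ?G}"
  define F where "F H = {\<gamma> \<in> divisible_hull ?G. \<exists>\<delta>\<in>?G. (\<forall>h\<in>H. \<delta> < h) \<and> \<gamma> \<le> \<delta>}" for H
  \<comment> \<open>One cut for each of the r proper convex subgroups, for independent
    Artin-Schreier distances, and the at most m members of \<open>D\<close>, for distances of p-th
    roots and thereby the dependent Artin-Schreier distances.\<close>
  define A where "A = F ` C \<union> D"
  have C: "finite C" "card C = r" using rank by (auto simp: has_rank_def C_def)
  have max': "\<not> immediate_over base_field (adjoin E b)"
    if "b ^ CHAR('k alg_closure) \<in> base_field" "b \<notin> E" for b using max that by simp
  have insep: "\<exists>d\<in>A. (d, distance v base_field \<eta>) \<in> ?R"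
    if "pseudo_limit base_field \<eta>" "\<eta> ^ CHAR('k alg_closure) \<in> base_field" for \<eta>
    using insep_distance[OF K E D(1) max' that] by (auto simp: A_def)
  have rep: "\<exists>d\<in>A. (d, x) \<in> ?R" if x: "x \<in> {distance v base_field b |b L. P L \<and> b \<in> L - base_field}" for x
  proof -
    obtain b L where b: "x = distance v base_field b" "P L" "b \<in> L - base_field" using x by auto
    from distance_cases_base[OF P[OF b(2)] b(3)] show ?thesis
    proof (elim disjE exE conjE)
      assume "pseudo_limit base_field b" "b ^ CHAR('k) \<in> base_field"
      thus ?thesis using insep[of b] b by simp
    next
      fix \<theta> assume \<theta>: "pseudo_limit base_field \<theta>" "\<theta> ^ CHAR('k) - \<theta> \<in> base_field"
        "\<forall>c\<in>base_field. v (\<theta> - c) < 0"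
        "(distance v base_field \<theta>, distance v base_field b) \<in> ?R"
      have \<theta>2: "\<theta> ^ CHAR('k alg_closure) - \<theta> \<in> base_field" using \<theta>(2) by simp
      have "\<exists>d\<in>A. (d, distance v base_field \<theta>) \<in> ?R"
      proof (rule artin_schreier_distance_cases[OF \<theta>(1) \<theta>2 \<theta>(3)])
        fix \<eta> assume "pseudo_limit base_field \<eta>" "\<eta> ^ CHAR('k alg_closure) \<in> base_field"
          "distance v base_field \<eta> = distance v base_field \<theta>"
        thus ?thesis using insep[of \<eta>] by simp
      next
        fix H assume H: "convex_subgroup ?G H" "H \<noteq> ?G"
          "distance v base_field \<theta> = {\<gamma> \<in> divisible_hull ?G. \<exists>\<delta>\<in>?G. (\<forall>h\<in>H. \<delta> < h) \<and> \<gamma> \<le> \<delta>}"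
        have "distance v base_field \<theta> \<in> A" using H by (auto simp: A_def C_def F_def)
        thus ?thesis using distance_eq_mod_refl[OF K] by blast
      qed
      thus ?thesis using \<theta>(4) distance_eq_mod_trans[OF K] b(1) by blast
    qed
  qed
  have "sym ?R" by (rule symI) (rule distance_eq_mod_sym[OF K])
  moreover have "trans ?R" by (rule transI) (rule distance_eq_mod_trans[OF K])
  moreover have "finite A" using C D by (simp add: A_def)
  ultimately have "finite (distances_mod v base_field P)" "card (distances_mod v base_field P) \<le> card A"
    unfolding distances_mod_def using card_quotient_le[of ?R A] rep by blast+
  moreover have "card A \<le> r + m"
    unfolding A_def using card_Un_le[of "F ` C" D] card_image_le[OF C(1), of F] C(2) D(3) by linarith
  ultimately show ?thesis by simp
qed

lemma immediate_extension_iff: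
  "immediate_extension v base_field N \<longleftrightarrow> is_subfield N \<and> immediate_over base_field N"
proof
  assume "immediate_extension v base_field N"
  hence "is_subfield N" "base_field \<subseteq> N" "value_group v N = value_group v base_field"
    "residue_field v N = residue_field v base_field"
    by (simp_all add: immediate_extension_def field_extension_def subfield_iff_is_subfield)
  thus "is_subfield N \<and> immediate_over base_field N"
    using immediate_overI[OF is_subfield_base_field] by blast
next
  assume N: "is_subfield N \<and> immediate_over base_field N"
  hence "base_field \<subseteq> N" by (simp add: immediate_over_def)
  thus "immediate_extension v base_field N"
    using N is_subfield_base_field residue_field_immediate[OF is_subfield_base_field, of N]
      value_group_immediate[of base_field N]
    by (simp add: immediate_extension_def field_extension_def subfield_iff_is_subfield)
qed

text \<open>A longest tower inside \<open>K'\<close> exhausts \<open>K'\<close>, because adjoining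
  any element of \<open>K'\<close> stays inside this immediate extension. Maximality of
  \<open>K'\<close> then excludes the p-th roots outside \<open>K'\<close>.\<close>

lemma maximal_chain:
  assumes K': "maximal_immediate_in_p_root_field v K'" and dim: "has_degree base_field K' (CHAR('k) ^ m)"
  shows "\<exists>D. is_subfield K' \<and> base_field \<subseteq> K' \<and> immediate_over base_field K' \<and>
    distances_in base_field K' D \<and> finite D \<and> card D \<le> m \<and>
    (\<forall>b. b ^ CHAR('k) \<in> base_field \<longrightarrow> b \<notin> K' \<longrightarrow> \<not> immediate_over base_field (adjoin K' b))"
proof -
  note K = is_subfield_base_field
  have p: "prime CHAR('k)" using prime_char by simp
  have K'_sub: "is_subfield K'" "immediate_over base_field K'" "K' \<subseteq> p_root_field"
    using K' by (auto simp: maximal_immediate_in_p_root_field_def immediate_extension_iff)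
  have incl: "base_field \<subseteq> K'" using K'_sub(2) by (simp add: immediate_over_def)
  have pow: "\<forall>x\<in>K'. x ^ CHAR('k alg_closure) \<in> base_field"
    using K'_sub(3) by (auto simp: p_root_field_def)
  have dim': "ring.dimension ring_of_type_algebra (CHAR('k alg_closure) ^ m) base_field K'"
    using dim by (simp add: has_degree_def)
  obtain E D where E: "is_subfield E" "base_field \<subseteq> E" "E \<subseteq> K'" "finite D" "card D \<le> m"
    "distances_in base_field E D" "\<forall>b\<in>K' - E. \<not> immediate_over base_field (adjoin E b)"
    using insep_chain[OF K K'_sub(1) incl pow dim'] by blast
  have "K' \<subseteq> E"
  proof
    fix b assume b: "b \<in> K'"
    have "adjoin E b \<subseteq> K'" by (rule adjoin_minimal[OF K'_sub(1) E(3) b])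
    moreover have "E \<subseteq> adjoin E b" by (rule adjoin_ring(1)[OF E(1)])
    ultimately have "immediate_over base_field (adjoin E b)"
      using immediate_over_mono[OF K'_sub(2)] E(2) by blast
    thus "b \<in> E" using E(7) b by blast
  qed
  hence EK: "E = K'" using E(3) by simp
  have "\<not> immediate_over base_field (adjoin K' b)" if b: "b ^ CHAR('k) \<in> base_field" "b \<notin> K'" for b
  proof
    assume imm: "immediate_over base_field (adjoin K' b)"
    have bp: "b ^ CHAR('k alg_closure) \<in> K'" using b(1) incl by auto
    have "is_subfield (adjoin K' b)" by (rule is_subfield_adjoin[OF K'_sub(1) prime_char bp])
    hence "immediate_extension v base_field (adjoin K' b)" using imm by (simp add: immediate_extension_iff)
    moreover have "adjoin K' b \<subseteq> p_root_field"
      by (rule adjoin_minimal[OF is_subfield_p_root_field[OF p] K'_sub(3)]) (use b in \<open>simp add: p_root_field_def\<close>)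
    moreover have "K' \<subseteq> adjoin K' b" by (rule adjoin_ring(1)[OF K'_sub(1)])
    ultimately have "adjoin K' b = K'"
      using K' unfolding maximal_immediate_in_p_root_field_def by blast
    thus False using adjoin_ring(2)[OF K'_sub(1), of b] b(2) by simp
  qed
  thus ?thesis using E K'_sub incl unfolding EK by blast
qed

text \<open>The tower is built directly in K^(1/p), so that k bounds its length; its top field takes
  over the role of \<open>K'\<close>.\<close>

lemma p_degree_chain:
  assumes dim: "has_degree base_field (p_root_field :: 'k alg_closure set) (CHAR('k) ^ k)"
  shows "\<exists>E D. is_subfield E \<and> base_field \<subseteq> E \<and> immediate_over base_field E \<and>
    distances_in base_field E D \<and> finite D \<and> card D \<le> k \<and>
    (\<forall>b. b ^ CHAR('k) \<in> base_field \<longrightarrow> b \<notin> E \<longrightarrow> \<not> immediate_over base_field (adjoin E b))"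
proof -
  note K = is_subfield_base_field
  have p: "prime CHAR('k)" using prime_char by simp
  have incl: "base_field \<subseteq> (p_root_field :: 'k alg_closure set)"
    using subfield_power[OF K] by (auto simp: p_root_field_def)
  have pow: "\<forall>x\<in>(p_root_field :: 'k alg_closure set). x ^ CHAR('k alg_closure) \<in> base_field"
    by (simp add: p_root_field_def)
  have dim': "ring.dimension ring_of_type_algebra (CHAR('k alg_closure) ^ k) base_field
      (p_root_field :: 'k alg_closure set)"
    using dim by (simp add: has_degree_def)
  obtain E D where "is_subfield E" "base_field \<subseteq> E" "immediate_over base_field E" "finite D" "card D \<le> k"
    "distances_in base_field E D" "\<forall>b\<in>p_root_field - E. \<not> immediate_over base_field (adjoin E b)"
    using insep_chain[OF K is_subfield_p_root_field[OF p] incl pow dim'] by blast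
  thus ?thesis unfolding p_root_field_def by blast
qed

end

theorem theorem23:
  fixes v :: "'k::field alg_closure \<Rightarrow> 'g::linordered_ab_group_add"
    and p r :: nat
  assumes "CHAR('k) = p" and "p > 0"
    and "valuation_on UNIV v"
    and "has_rank v base_field r"
  shows "(\<forall>K' m. maximal_immediate_in_p_root_field v K' \<and> has_degree base_field K' (p ^ m) \<longrightarrow>
            finite (distances_mod v base_field (normal_defect_extension_prime_degree v)) \<and>
            card (distances_mod v base_field (normal_defect_extension_prime_degree v)) \<le> r + m \<and>
            finite (distances_mod v base_field (artin_schreier_defect_extension v)) \<and>
            card (distances_mod v base_field (artin_schreier_defect_extension v)) \<le> r + m) \<and>
         (\<forall>k. has_p_degree TYPE('k) k \<longrightarrow>
            finite (distances_mod v base_field (normal_defect_extension_prime_degree v)) \<and>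
            card (distances_mod v base_field (normal_defect_extension_prime_degree v)) \<le> r + k \<and>
            finite (distances_mod v base_field (artin_schreier_defect_extension v)) \<and>
            card (distances_mod v base_field (artin_schreier_defect_extension v)) \<le> r + k)"
proof -
  have prime: "prime CHAR('k)" using prime_CHAR_semidom[where ?'a = 'k] assms(1,2) by simp
  interpret valued_base_field v
    by unfold_locales (use assms(3) prime in auto)
  \<comment> \<open>The degree p is prime, so Artin-Schreier defect extensions form a subfamily and
    obey the same bound.\<close>
  have as: "normal_defect_extension_prime_degree v L" if "artin_schreier_defect_extension v L" for L
    using that prime unfolding artin_schreier_defect_extension_def normal_defect_extension_prime_degree_def
      galois_extension_def by blast
  have bound: "finite (distances_mod v base_field (normal_defect_extension_prime_degree v)) \<and>
            card (distances_mod v base_field (normal_defect_extension_prime_degree v)) \<le> r + m \<and>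
            finite (distances_mod v base_field (artin_schreier_defect_extension v)) \<and>
            card (distances_mod v base_field (artin_schreier_defect_extension v)) \<le> r + m"
    if chain: "\<exists>E D. is_subfield E \<and> base_field \<subseteq> E \<and> immediate_over base_field E \<and>
      distances_in base_field E D \<and> finite D \<and> card D \<le> m \<and>
      (\<forall>b. b ^ CHAR('k) \<in> base_field \<longrightarrow> b \<notin> E \<longrightarrow> \<not> immediate_over base_field (adjoin E b))" for m
  proof -
    obtain E D where E: "is_subfield E" "base_field \<subseteq> E" "immediate_over base_field E"
      "distances_in base_field E D" "finite D" "card D \<le> m"
      "\<And>b. b ^ CHAR('k) \<in> base_field \<Longrightarrow> b \<notin> E \<Longrightarrow> \<not> immediate_over base_field (adjoin E b)"
      using chain by blast
    show ?thesis
      using distances_bound[OF assms(4) E, of "normal_defect_extension_prime_degree v"]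
        distances_bound[OF assms(4) E as] by blast
  qed
  show ?thesis
  proof (intro conjI[of "All _"] allI impI)
    fix K' m assume "maximal_immediate_in_p_root_field v K' \<and> has_degree base_field K' (p ^ m)"
    thus "finite (distances_mod v base_field (normal_defect_extension_prime_degree v)) \<and>
            card (distances_mod v base_field (normal_defect_extension_prime_degree v)) \<le> r + m \<and>
            finite (distances_mod v base_field (artin_schreier_defect_extension v)) \<and>
            card (distances_mod v base_field (artin_schreier_defect_extension v)) \<le> r + m"
      using maximal_chain[of K' m] assms(1) by (intro bound) blast
  next
    fix k assume "has_p_degree TYPE('k) k"
    thus "finite (distances_mod v base_field (normal_defect_extension_prime_degree v)) \<and>
            card (distances_mod v base_field (normal_defect_extension_prime_degree v)) \<le> r + k \<and>
            finite (distances_mod v base_field (artin_schreier_defect_extension v)) \<and>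
            card (distances_mod v base_field (artin_schreier_defect_extension v)) \<le> r + k"
      by (intro bound p_degree_chain) (simp add: has_p_degree_def)
  qed
qed

end
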